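(* Let $n\ge 1$, let $E_n = \wedge\{\alpha_1,\dots,\alpha_n,\theta_1,\dots,\theta_n\}$ be the exterior algebra over $\mathbb{C}$, bigraded by $(E_n)_{i,j} = \wedge^i\{\alpha_1,\dots,\alpha_n\}\otimes\wedge^j\{\theta_1,\dots,\theta_n\}$, with the symmetric group $\mathfrak{S}_n$ acting by $w\cdot\alpha_i = \alpha_{w(i)}$, $w\cdot\theta_i = \theta_{w(i)}$. Let $T:E_n\to E_n$ be the algebra homomorphism with $T(\theta_i)=\theta_i+\alpha_i$, $T(\alpha_i)=\alpha_i$, let $H^0(M,\mathcal{O}) = \{f\in E_n : T(f)=f\}$, and let $H^0(M,\mathcal{O})_{i,j} = H^0(M,\mathcal{O})\cap (E_n)_{i,j}$ (an $\mathfrak{S}_n$-submodule). Then $H^0(M,\mathcal{O})_{i,j} = 0$ unless $i \ge j$, and if $i \geq j$ then in the Grothendieck ring of $\mathfrak{S}_n$ $$[H^0(M,\mathcal{O})_{i,j}] = [\wedge^i\mathbb{C}^n]\cdot[\wedge^j\mathbb{C}^n] - [\wedge^{i+1}\mathbb{C}^n]\cdot[\wedge^{j-1}\mathbb{C}^n] = [(E_n)_{i,j}] - [(E_n)_{i+1,j-1}],$$ where $\mathfrak{S}_n$ acts on $\mathbb{C}^n$ by coordinate permutation.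
   Context: The Grothendieck ring of a finite group $G$ is the free $\mathbb{Z}$-module on isomorphism classes $[V]$ of irreducible $\mathbb{C}[G]$-modules, with $[V]=[U]+[W]$ for short exact sequences $0\to U\to V\to W\to 0$ and product $[V]\cdot[W]=[V\otimes W]$ (diagonal action). Exterior powers $\wedge^k\mathbb{C}^n$ with $k<0$ or $k>n$ are zero, and $(E_n)_{i,j}=0$ if $i$ or $j$ lies outside $\{0,\dots,n\}$. *)

theory Defs
  imports
    Complex_Main
    "HOL-Library.Function_Algebras"
    "HOL-Algebra.Free_Abelian_Groups"
    "HOL-Algebra.Ring"
    "HOL-Algebra.Sym_Groups"
begin

section \<open>Finite-dimensional modules over a complex group algebra\<close>

text \<open>
  Complex vector spaces are subspaces of a space of functions \<open>'i \<Rightarrow> complex\<close> with the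
  pointwise operations. Up to isomorphism this covers all finite-dimensional spaces as soon as
  \<open>'i\<close> is infinite.
\<close>

definition cscale :: "complex \<Rightarrow> ('i \<Rightarrow> complex) \<Rightarrow> ('i \<Rightarrow> complex)" where
  "cscale c f = (\<lambda>x. c * f x)"

global_interpretation cfun: vector_space "cscale :: complex \<Rightarrow> ('i \<Rightarrow> complex) \<Rightarrow> 'i \<Rightarrow> complex"
  by standard (auto simp: cscale_def fun_eq_iff algebra_simps)

definition linear_between ::
    "('i \<Rightarrow> complex) set \<Rightarrow> ('j \<Rightarrow> complex) set \<Rightarrow> (('i \<Rightarrow> complex) \<Rightarrow> ('j \<Rightarrow> complex)) \<Rightarrow> bool" where
  "linear_between U W f \<longleftrightarrow>
     f \<in> U \<rightarrow> W \<and>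
     (\<forall>x\<in>U. \<forall>y\<in>U. f (x + y) = f x + f y) \<and>
     (\<forall>c. \<forall>x\<in>U. f (cscale c x) = cscale c (f x))"

text \<open>Only the values of \<open>act\<close> for group elements acting on vectors of \<open>vecs\<close> are meaningful.\<close>

record ('g, 'i) gmod =
  vecs :: "('i \<Rightarrow> complex) set"
  act :: "'g \<Rightarrow> ('i \<Rightarrow> complex) \<Rightarrow> ('i \<Rightarrow> complex)"

definition is_gmod :: "('g, 'm) monoid_scheme \<Rightarrow> ('g, 'i) gmod \<Rightarrow> bool" where
  "is_gmod G V \<longleftrightarrow>
     cfun.subspace (vecs V) \<and>
     (\<exists>B. finite B \<and> cfun.span B = vecs V) \<and>
     (\<forall>g\<in>carrier G. linear_between (vecs V) (vecs V) (act V g)) \<and>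
     (\<forall>v\<in>vecs V. act V \<one>\<^bsub>G\<^esub> v = v) \<and>
     (\<forall>g\<in>carrier G. \<forall>h\<in>carrier G. \<forall>v\<in>vecs V. act V (g \<otimes>\<^bsub>G\<^esub> h) v = act V g (act V h v))"

definition is_submodule :: "('g, 'm) monoid_scheme \<Rightarrow> ('g, 'i) gmod \<Rightarrow> ('i \<Rightarrow> complex) set \<Rightarrow> bool" where
  "is_submodule G V U \<longleftrightarrow>
     cfun.subspace U \<and> U \<subseteq> vecs V \<and> (\<forall>g\<in>carrier G. act V g ` U \<subseteq> U)"

definition irreducible_gmod :: "('g, 'm) monoid_scheme \<Rightarrow> ('g, 'i) gmod \<Rightarrow> bool" where
  "irreducible_gmod G V \<longleftrightarrow>
     is_gmod G V \<and> vecs V \<noteq> {0} \<and> (\<forall>U. is_submodule G V U \<longrightarrow> U = {0} \<or> U = vecs V)"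

definition gmod_hom ::
    "('g, 'm) monoid_scheme \<Rightarrow> ('g, 'i) gmod \<Rightarrow> ('g, 'j) gmod \<Rightarrow> (('i \<Rightarrow> complex) \<Rightarrow> ('j \<Rightarrow> complex)) \<Rightarrow> bool" where
  "gmod_hom G V W f \<longleftrightarrow>
     linear_between (vecs V) (vecs W) f \<and>
     (\<forall>g\<in>carrier G. \<forall>v\<in>vecs V. f (act V g v) = act W g (f v))"

definition gmod_iso :: "('g, 'm) monoid_scheme \<Rightarrow> ('g, 'i) gmod \<Rightarrow> ('g, 'j) gmod \<Rightarrow> bool" where
  "gmod_iso G V W \<longleftrightarrow> (\<exists>f. gmod_hom G V W f \<and> bij_betw f (vecs V) (vecs W))"

text \<open>Exactness of \<open>0 \<rightarrow> U \<rightarrow> V \<rightarrow> W \<rightarrow> 0\<close> for some pair of module homomorphisms.\<close>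

definition short_exact ::
    "('g, 'm) monoid_scheme \<Rightarrow> ('g, 'i) gmod \<Rightarrow> ('g, 'j) gmod \<Rightarrow> ('g, 'k) gmod \<Rightarrow> bool" where
  "short_exact G U V W \<longleftrightarrow>
     (\<exists>f h. gmod_hom G U V f \<and> gmod_hom G V W h \<and>
        inj_on f (vecs U) \<and> f ` vecs U = {v \<in> vecs V. h v = 0} \<and> h ` vecs V = vecs W)"

text \<open>
  The tensor product of \<open>V \<subseteq> ('i \<Rightarrow> complex)\<close> and \<open>W \<subseteq> ('j \<Rightarrow> complex)\<close> is realised inside
  \<open>'i \<times> 'j \<Rightarrow> complex\<close>, where \<open>v \<otimes> w\<close> is the function \<open>(a, b) \<mapsto> v a * w b\<close>. The linear map chosen
  in \<open>gmod_tensor\<close> is determined on the span of the pure tensors, and this is all that matters.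
\<close>

definition pure_tensor :: "('i \<Rightarrow> complex) \<Rightarrow> ('j \<Rightarrow> complex) \<Rightarrow> ('i \<times> 'j \<Rightarrow> complex)" where
  "pure_tensor v w = (\<lambda>(a, b). v a * w b)"

definition gmod_tensor :: "('g, 'i) gmod \<Rightarrow> ('g, 'j) gmod \<Rightarrow> ('g, 'i \<times> 'j) gmod" where
  "gmod_tensor V W =
     \<lparr> vecs = cfun.span {pure_tensor v w | v w. v \<in> vecs V \<and> w \<in> vecs W},
       act = (\<lambda>g. SOME L. Vector_Spaces.linear cscale cscale L \<and>
                (\<forall>v\<in>vecs V. \<forall>w\<in>vecs W.
                   L (pure_tensor v w) = pure_tensor (act V g v) (act W g w))) \<rparr>"

definition trivial_gmod :: "('g, unit) gmod" where
  "trivial_gmod = \<lparr> vecs = UNIV, act = (\<lambda>g v. v) \<rparr>"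


section \<open>The Grothendieck ring\<close>

text \<open>
  Modules over different index types \<open>'i\<close> have to be comparable, so an isomorphism class is
  recorded by its representatives inside \<open>nat \<Rightarrow> complex\<close>; every finite-dimensional module has one.
\<close>

type_synonym 'g gmod_class = "('g, nat) gmod set"

definition iso_class :: "('g, 'm) monoid_scheme \<Rightarrow> ('g, 'i) gmod \<Rightarrow> 'g gmod_class" where
  "iso_class G V = {S. is_gmod G S \<and> gmod_iso G V S}"

definition irr_classes :: "('g, 'm) monoid_scheme \<Rightarrow> 'g gmod_class set" where
  "irr_classes G = {iso_class G S | S :: ('g, nat) gmod. irreducible_gmod G S}"

text \<open>
  \<open>has_class G V x\<close>: the relations \<open>[V] = [U] + [W]\<close> for short exact sequences express \<open>[V]\<close>
  as the integral combination \<open>x\<close> of classes of irreducible modules. By the Jordan-Hoelder theorem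
  there is exactly one such \<open>x\<close> for every finite-dimensional \<open>V\<close>.
\<close>

inductive has_class :: "('g, 'm) monoid_scheme \<Rightarrow> ('g, 'i) gmod \<Rightarrow> ('g gmod_class \<Rightarrow>\<^sub>0 int) \<Rightarrow> bool"
  for G :: "('g, 'm) monoid_scheme" where
  zero: "is_gmod G V \<Longrightarrow> vecs V = {0} \<Longrightarrow> has_class G V 0"
| irreducible: "irreducible_gmod G V \<Longrightarrow> has_class G V (frag_of (iso_class G V))"
| exact: "is_gmod G V \<Longrightarrow> short_exact G U V W \<Longrightarrow> has_class G U x \<Longrightarrow> has_class G W y \<Longrightarrow>
    has_class G V (x + y)"

definition groth_class :: "('g, 'm) monoid_scheme \<Rightarrow> ('g, 'i) gmod \<Rightarrow> ('g gmod_class \<Rightarrow>\<^sub>0 int)" where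
  "groth_class G V = (THE x. has_class G V x)"

definition class_rep :: "'g gmod_class \<Rightarrow> ('g, nat) gmod" where
  "class_rep p = (SOME S. S \<in> p)"

text \<open>The product is the bilinear extension of \<open>[S] [S'] = [S \<otimes> S']\<close> from irreducible classes.\<close>

definition groth_ring :: "('g, 'm) monoid_scheme \<Rightarrow> ('g gmod_class \<Rightarrow>\<^sub>0 int) ring" where
  "groth_ring G =
     \<lparr> carrier = carrier (free_Abelian_group (irr_classes G)),
       monoid.mult = (\<lambda>x y. frag_extend (\<lambda>p. frag_extend
          (\<lambda>q. groth_class G (gmod_tensor (class_rep p) (class_rep q))) y) x),
       one = groth_class G trivial_gmod,
       zero = 0,
       add = (+) \<rparr>"


section \<open>Exterior algebras on ordered generators\<close>

text \<open>
  An element \<open>f\<close> of the exterior algebra on a finite set \<open>X\<close> of generators stands for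
  \<open>\<Sum>A\<subseteq>X. f A \<cdot> x_A\<close>, where \<open>x_A\<close> is the product of the generators in \<open>A\<close> in increasing order.
  Thus \<open>x_A x_B\<close> is zero unless \<open>A\<close> and \<open>B\<close> are disjoint, when it is
  \<open>ext_sign A B \<cdot> x_(A \<union> B)\<close>, the sign counting the transpositions needed to sort.
\<close>

definition ext_sign :: "'x::linorder set \<Rightarrow> 'x set \<Rightarrow> complex" where
  "ext_sign A B = (-1) ^ card {(a, b). a \<in> A \<and> b \<in> B \<and> b < a}"

definition ext_alg :: "'x set \<Rightarrow> ('x set \<Rightarrow> complex) set" where
  "ext_alg X = {f. \<forall>A. f A \<noteq> 0 \<longrightarrow> A \<subseteq> X}"

definition ext_mult :: "('x::linorder set \<Rightarrow> complex) \<Rightarrow> ('x set \<Rightarrow> complex) \<Rightarrow> ('x set \<Rightarrow> complex)" where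
  "ext_mult f g = (\<lambda>C. \<Sum>A\<in>Pow C. ext_sign A (C - A) * f A * g (C - A))"

definition ext_one :: "'x set \<Rightarrow> complex" where
  "ext_one = (\<lambda>A. if A = {} then 1 else 0)"

definition ext_gen :: "'x \<Rightarrow> ('x set \<Rightarrow> complex)" where
  "ext_gen x = (\<lambda>A. if A = {x} then 1 else 0)"

definition ext_endo :: "'x::linorder set \<Rightarrow> (('x set \<Rightarrow> complex) \<Rightarrow> ('x set \<Rightarrow> complex)) \<Rightarrow> bool" where
  "ext_endo X T \<longleftrightarrow>
     linear_between (ext_alg X) (ext_alg X) T \<and>
     T ext_one = ext_one \<and>
     (\<forall>f\<in>ext_alg X. \<forall>g\<in>ext_alg X. T (ext_mult f g) = ext_mult (T f) (T g))"

text \<open>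
  The algebra automorphism induced by a permutation \<open>\<sigma>\<close> of the generators \<open>X\<close>: it sends \<open>x_A\<close> to
  the product of the \<open>\<sigma> a\<close>, with \<open>a\<close> running through \<open>A\<close> in increasing order.
\<close>

definition ext_perm :: "'x::linorder set \<Rightarrow> ('x \<Rightarrow> 'x) \<Rightarrow> ('x set \<Rightarrow> complex) \<Rightarrow> ('x set \<Rightarrow> complex)" where
  "ext_perm X \<sigma> f =
     (\<Sum>A\<in>Pow X. cscale (f A)
        (foldr ext_mult (map (\<lambda>a. ext_gen (\<sigma> a)) (sorted_list_of_set A)) ext_one))"

text \<open>
  \<open>\<And>\<^sup>k \<complex>\<^sup>n\<close>, the generators \<open>1, \<dots>, n\<close> being the standard basis of \<open>\<complex>\<^sup>n\<close>. Degrees are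
  integers, so that this is zero for \<open>k < 0\<close> (and for \<open>k > n\<close>).
\<close>

definition ext_power :: "nat \<Rightarrow> int \<Rightarrow> (nat \<Rightarrow> nat, nat set) gmod" where
  "ext_power n k =
     \<lparr> vecs = {f \<in> ext_alg {1..n}. \<forall>A. f A \<noteq> 0 \<longrightarrow> int (card A) = k},
       act = (\<lambda>w. ext_perm {1..n} w) \<rparr>"


section \<open>The bigraded algebra \<open>E\<^sub>n\<close>\<close>

datatype gen = Alpha nat | Theta nat

text \<open>The order is \<open>\<alpha>\<^sub>1 < \<alpha>\<^sub>2 < \<dots> < \<theta>\<^sub>1 < \<theta>\<^sub>2 < \<dots>\<close>.\<close>

instantiation gen :: linorder
begin

fun less_eq_gen :: "gen \<Rightarrow> gen \<Rightarrow> bool" where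
  "Alpha i \<le> Alpha j \<longleftrightarrow> i \<le> j"
| "Alpha i \<le> Theta j \<longleftrightarrow> True"
| "Theta i \<le> Alpha j \<longleftrightarrow> False"
| "Theta i \<le> Theta j \<longleftrightarrow> i \<le> j"

definition less_gen :: "gen \<Rightarrow> gen \<Rightarrow> bool" where
  "x < y \<longleftrightarrow> x \<le> y \<and> \<not> y \<le> (x::gen)"

instance
proof
  fix x y z :: gen
  show "x < y \<longleftrightarrow> x \<le> y \<and> \<not> y \<le> x" by (rule less_gen_def)
  show "x \<le> x" by (cases x) auto
  show "x \<le> y \<Longrightarrow> y \<le> z \<Longrightarrow> x \<le> z" by (cases x; cases y; cases z) auto
  show "x \<le> y \<Longrightarrow> y \<le> x \<Longrightarrow> x = y" by (cases x; cases y) auto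
  show "x \<le> y \<or> y \<le> x" by (cases x; cases y) auto
qed

end

definition gens :: "nat \<Rightarrow> gen set" where
  "gens n = Alpha ` {1..n} \<union> Theta ` {1..n}"

abbreviation E_alg :: "nat \<Rightarrow> (gen set \<Rightarrow> complex) set" where
  "E_alg n \<equiv> ext_alg (gens n)"

definition E_part :: "nat \<Rightarrow> int \<Rightarrow> int \<Rightarrow> (gen set \<Rightarrow> complex) set" where
  "E_part n i j =
     {f \<in> E_alg n. \<forall>A. f A \<noteq> 0 \<longrightarrow> int (card (A \<inter> range Alpha)) = i \<and> int (card (A \<inter> range Theta)) = j}"

fun gen_perm :: "(nat \<Rightarrow> nat) \<Rightarrow> gen \<Rightarrow> gen" where
  "gen_perm w (Alpha i) = Alpha (w i)"
| "gen_perm w (Theta i) = Theta (w i)"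

definition E_act :: "nat \<Rightarrow> (nat \<Rightarrow> nat) \<Rightarrow> (gen set \<Rightarrow> complex) \<Rightarrow> (gen set \<Rightarrow> complex)" where
  "E_act n w = ext_perm (gens n) (gen_perm w)"

definition E_gmod :: "nat \<Rightarrow> int \<Rightarrow> int \<Rightarrow> (nat \<Rightarrow> nat, gen set) gmod" where
  "E_gmod n i j = \<lparr> vecs = E_part n i j, act = E_act n \<rparr>"

definition H0 :: "nat \<Rightarrow> ((gen set \<Rightarrow> complex) \<Rightarrow> (gen set \<Rightarrow> complex)) \<Rightarrow> (gen set \<Rightarrow> complex) set" where
  "H0 n T = {f \<in> E_alg n. T f = f}"

definition H0_gmod ::
    "nat \<Rightarrow> ((gen set \<Rightarrow> complex) \<Rightarrow> (gen set \<Rightarrow> complex)) \<Rightarrow> int \<Rightarrow> int \<Rightarrow> (nat \<Rightarrow> nat, gen set) gmod" where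
  "H0_gmod n T i j = \<lparr> vecs = H0 n T \<inter> E_part n i j, act = E_act n \<rparr>"

end

theory Submission
  imports Defs
begin

text \<open>
  Let \<open>D\<close> be the derivation with \<open>D \<theta>\<^sub>i = \<alpha>\<^sub>i\<close>, \<open>D \<alpha>\<^sub>i = 0\<close>, so that \<open>T = exp D\<close> and the
  \<open>T\<close>-invariants of a given bidegree are the kernel of \<open>D\<close>. Together with the opposite derivation
  \<open>\<alpha>\<^sub>i \<mapsto> \<theta>\<^sub>i\<close> it makes \<open>E\<^sub>n\<close> a representation of \<open>sl\<^sub>2\<close> in which bidegree \<open>(i, j)\<close> has
  weight \<open>i - j\<close>. Hence \<open>D\<close> is injective on bidegree \<open>(i, j)\<close> for \<open>i < j\<close> and maps it onto
  bidegree \<open>(i + 1, j - 1)\<close> for \<open>i \<ge> j\<close>. As \<open>D\<close> commutes with the symmetric group, this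
  is a short exact sequence of modules, and \<open>(E\<^sub>n)\<^sub>i\<^sub>,\<^sub>j\<close> is the tensor product of the two exterior powers.
  That classes in the Grothendieck group exist and are unique is a Jordan--Hoelder argument, and
  linear splittings of exact sequences make the tensor product well defined on classes.
\<close>

subsection \<open>Modules and their homomorphisms\<close>

text \<open>An inductive predicate has one type throughout, so in the rule \<open>exact\<close> of
  \<open>has_class\<close> all three modules lie in the same function space. Subquotients are
  therefore cut out of the space at hand, quotients as complements, and a derivation has to be
  rebuilt when a module is transported to another index type.

  Actions and homomorphisms are constrained only on \<open>vecs\<close>. Before they are composed or
  tensored they are replaced by total linear maps, for which \<open>tens\<close> is defined
  everywhere and identities can be tested on pure tensors.

  Signs are kept local: they are computed only for left multiplication by one generator and for the
  dual contraction. Since left multiplications produce the whole exterior algebra from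
  \<open>ext_one\<close>, a linear operator is known from its value at \<open>ext_one\<close> and
  its rule for passing a generator. The relations of sl_2, the equivariance and the commutation rule
  for T are all obtained in this way.\<close>

abbreviation clinear :: "(('i \<Rightarrow> complex) \<Rightarrow> ('j \<Rightarrow> complex)) \<Rightarrow> bool" where
  "clinear \<equiv> Vector_Spaces.linear cscale cscale"

global_interpretation cpair: vector_space_pair
  "cscale :: complex \<Rightarrow> ('i \<Rightarrow> complex) \<Rightarrow> 'i \<Rightarrow> complex"
  "cscale :: complex \<Rightarrow> ('j \<Rightarrow> complex) \<Rightarrow> 'j \<Rightarrow> complex"
  by standard

lemma fun_sum_apply: "(\<Sum>a\<in>A. f a) x = (\<Sum>a\<in>A. f a x)"
  by (induction A rule: infinite_finite_induct) auto

lemma clinearI: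
  assumes "\<And>x y. F (x + y) = F x + F y" "\<And>c x. F (cscale c x) = cscale c (F x)"
  shows "clinear F"
  using assms by (intro Vector_Spaces.linear.intro module_hom.intro)
    (auto simp: module_hom_axioms_def cfun.vector_space_axioms cfun.module_axioms)

lemma clinearD:
  assumes "clinear F"
  shows "F (x + y) = F x + F y" "F (x - y) = F x - F y" "F (cscale c x) = cscale c (F x)" "F 0 = 0" "F (- x) = - F x"
  using assms cpair.linear_add cpair.linear_diff cpair.linear_scale cpair.linear_0 cpair.linear_neg by metis+

lemma clinear_sum: "clinear F \<Longrightarrow> F (\<Sum>a\<in>A. g a) = (\<Sum>a\<in>A. F (g a))"
  by (rule cpair.linear_sum)

lemma clinear_comp: "clinear F \<Longrightarrow> clinear K \<Longrightarrow> clinear (\<lambda>x. F (K x))"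
  by (rule clinearI) (simp_all only: clinearD[of F] clinearD[of K])

lemma clinear_add: "clinear F \<Longrightarrow> clinear K \<Longrightarrow> clinear (\<lambda>x. F x + K x)"
  by (rule clinearI) (simp_all add: clinearD[of F] clinearD[of K] cfun.scale_right_distrib algebra_simps)

lemma clinear_diff: "clinear F \<Longrightarrow> clinear K \<Longrightarrow> clinear (\<lambda>x. F x - K x)"
  by (rule clinearI) (simp_all add: clinearD[of F] clinearD[of K] cfun.scale_right_diff_distrib algebra_simps)

lemma clinear_id: "clinear (\<lambda>x. x)"
  by (rule clinearI) simp_all

lemma clinear_eq_on_span:
  assumes "clinear F" "clinear K" "x \<in> cfun.span B" "\<And>b. b \<in> B \<Longrightarrow> F b = K b"
  shows "F x = K x"
  using cpair.linear_eq_on[OF assms(1,2,3)] assms(4) by blast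

lemma linear_betweenD:
  assumes "linear_between U W f" "x \<in> U" "y \<in> U"
  shows "f x \<in> W" "f (x + y) = f x + f y" "f (cscale c x) = cscale c (f x)"
  using assms unfolding linear_between_def by auto

text \<open>A basis of \<open>U\<close> is independent in the whole space, so the values of
  \<open>f\<close> on it extend to a total linear map, and linearity on \<open>U\<close> carries the
  agreement from the basis to its span. This is the passage from maps meaningful only on
  \<open>vecs\<close> to total ones.\<close>

lemma linear_between_extend:
  assumes f: "linear_between U W f" and U: "cfun.subspace U"
  obtains F where "clinear F" "\<And>x. x \<in> U \<Longrightarrow> F x = f x"
proof -
  obtain B where B: "B \<subseteq> U" "cfun.independent B" "U \<subseteq> cfun.span B"
    using cfun.maximal_independent_subset by metis
  obtain F where F: "clinear F" "\<And>x. x \<in> B \<Longrightarrow> F x = f x"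
    using cpair.linear_independent_extend[OF B(2), of f] by blast
  have UB: "U = cfun.span B"
    using B U cfun.span_minimal by blast
  have "x \<in> U \<and> F x = f x" if "x \<in> cfun.span B" for x
  proof (rule cfun.span_induct_alt[OF that])
    show "0 \<in> U \<and> F 0 = f 0"
      using linear_betweenD(3)[OF f, of 0 0 0] cfun.subspace_0[OF U] clinearD(4)[OF F(1)] by simp
    show "cscale c x + y \<in> U \<and> F (cscale c x + y) = f (cscale c x + y)"
      if "x \<in> B" "y \<in> U \<and> F y = f y" for c x y
      using that B(1) U linear_betweenD(2,3)[OF f] F clinearD[OF F(1)]
      by (auto simp: cfun.subspace_scale cfun.subspace_add subset_iff)
  qed
  with UB F that show ?thesis by auto
qed

lemma is_gmod_subspace: "is_gmod G V \<Longrightarrow> cfun.subspace (vecs V)"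
  by (simp add: is_gmod_def)

lemma is_gmodD:
  assumes "is_gmod G V"
  shows "0 \<in> vecs V"
    "x \<in> vecs V \<Longrightarrow> y \<in> vecs V \<Longrightarrow> x + y \<in> vecs V"
    "x \<in> vecs V \<Longrightarrow> y \<in> vecs V \<Longrightarrow> x - y \<in> vecs V"
    "x \<in> vecs V \<Longrightarrow> cscale c x \<in> vecs V"
    "g \<in> carrier G \<Longrightarrow> x \<in> vecs V \<Longrightarrow> act V g x \<in> vecs V"
    "g \<in> carrier G \<Longrightarrow> x \<in> vecs V \<Longrightarrow> y \<in> vecs V \<Longrightarrow> act V g (x + y) = act V g x + act V g y"
    "g \<in> carrier G \<Longrightarrow> x \<in> vecs V \<Longrightarrow> act V g (cscale c x) = cscale c (act V g x)"
  using assms unfolding is_gmod_def linear_between_def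
  by (auto intro: cfun.subspace_0 cfun.subspace_add cfun.subspace_diff cfun.subspace_scale)

lemma gmod_homD:
  assumes "gmod_hom G V W f" "x \<in> vecs V"
  shows "f x \<in> vecs W"
    "y \<in> vecs V \<Longrightarrow> f (x + y) = f x + f y"
    "f (cscale c x) = cscale c (f x)"
    "g \<in> carrier G \<Longrightarrow> f (act V g x) = act W g (f x)"
  using assms unfolding gmod_hom_def linear_between_def by auto

lemma gmod_homI:
  assumes "\<And>x. x \<in> vecs V \<Longrightarrow> f x \<in> vecs W"
    "\<And>x y. x \<in> vecs V \<Longrightarrow> y \<in> vecs V \<Longrightarrow> f (x + y) = f x + f y"
    "\<And>c x. x \<in> vecs V \<Longrightarrow> f (cscale c x) = cscale c (f x)"
    "\<And>g x. g \<in> carrier G \<Longrightarrow> x \<in> vecs V \<Longrightarrow> f (act V g x) = act W g (f x)"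
  shows "gmod_hom G V W f"
  using assms unfolding gmod_hom_def linear_between_def by auto

lemma gmod_hom_zero: "is_gmod G V \<Longrightarrow> gmod_hom G V W f \<Longrightarrow> f 0 = 0"
  using gmod_homD(3)[of G V W f 0 0] is_gmodD(1)[of G V] by simp

lemma gmod_hom_diff:
  assumes "is_gmod G V" "gmod_hom G V W f" "x \<in> vecs V" "y \<in> vecs V"
  shows "f (x - y) = f x - f y"
  using gmod_homD(2)[OF assms(2) is_gmodD(3)[OF assms(1,3,4)] assms(4)]
  by (simp add: algebra_simps)

lemma gmod_hom_comp:
  "gmod_hom G U V f \<Longrightarrow> gmod_hom G V W h \<Longrightarrow> gmod_hom G U W (\<lambda>x. h (f x))"
  by (rule gmod_homI) (simp_all add: gmod_homD[of G U V f] gmod_homD[of G V W h])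

lemma gmod_hom_inj_iff:
  assumes "is_gmod G V" "gmod_hom G V W f"
  shows "inj_on f (vecs V) \<longleftrightarrow> (\<forall>v\<in>vecs V. f v = 0 \<longrightarrow> v = 0)"
  using assms gmod_hom_diff[OF assms] gmod_hom_zero[OF assms] is_gmodD(1,3)[OF assms(1)]
  by (auto simp: inj_on_def) (metis right_minus_eq)

section \<open>Submodules, kernels, images and quotients\<close>

definition sub_gmod :: "('g, 'i) gmod \<Rightarrow> ('i \<Rightarrow> complex) set \<Rightarrow> ('g, 'i) gmod" where
  "sub_gmod V U = V\<lparr>vecs := U\<rparr>"

lemma sub_gmod_simps [simp]: "vecs (sub_gmod V U) = U" "act (sub_gmod V U) = act V"
  by (simp_all add: sub_gmod_def)

lemma finite_span_subspace:
  assumes "finite B" "cfun.subspace U" "U \<subseteq> cfun.span B"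
  shows "\<exists>C. finite C \<and> cfun.span C = U"
proof -
  obtain C where "C \<subseteq> U" "cfun.independent C" "U \<subseteq> cfun.span C"
    using cfun.maximal_independent_subset by metis
  moreover from this assms have "finite C"
    using cfun.independent_span_bound by (metis order_trans)
  ultimately show ?thesis
    using assms(2) cfun.span_minimal by blast
qed

lemma is_gmod_sub:
  assumes V: "is_gmod G V" and U: "is_submodule G V U"
  shows "is_gmod G (sub_gmod V U)"
proof -
  have "\<exists>B. finite B \<and> cfun.span B = U"
    using assms finite_span_subspace unfolding is_gmod_def is_submodule_def by metis
  moreover have "linear_between U U (act V g)" if "g \<in> carrier G" for g
  proof -
    have "U \<subseteq> vecs V" "act V g ` U \<subseteq> U" using U that by (auto simp: is_submodule_def)
    then show ?thesis
      using is_gmodD(6,7)[OF V that] by (auto simp: linear_between_def subset_iff)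
  qed
  moreover have "cfun.subspace U" "U \<subseteq> vecs V" using U by (auto simp: is_submodule_def)
  ultimately show ?thesis
    using V unfolding is_gmod_def by auto
qed

lemma is_submodule_image:
  assumes V: "is_gmod G V" and f: "gmod_hom G V W f"
  shows "is_submodule G W (f ` vecs V)"
  unfolding is_submodule_def
proof (intro conjI ballI)
  show "cfun.subspace (f ` vecs V)"
  proof (rule cfun.subspaceI)
    show "0 \<in> f ` vecs V" using gmod_hom_zero[OF V f] is_gmodD(1)[OF V] by force
  next
    fix x y assume "x \<in> f ` vecs V" "y \<in> f ` vecs V"
    then show "x + y \<in> f ` vecs V"
      by (auto simp: gmod_homD(2)[OF f, symmetric] is_gmodD(2)[OF V])
  next
    fix c x assume "x \<in> f ` vecs V"
    then show "cscale c x \<in> f ` vecs V"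
      by (auto simp: gmod_homD(3)[OF f, symmetric] is_gmodD(4)[OF V])
  qed
  show "f ` vecs V \<subseteq> vecs W" using gmod_homD(1)[OF f] by auto
  fix g assume "g \<in> carrier G"
  then show "act W g ` f ` vecs V \<subseteq> f ` vecs V"
    by (auto simp: gmod_homD(4)[OF f, symmetric] is_gmodD(5)[OF V])
qed

lemma is_submodule_vimage:
  assumes V: "is_gmod G V" and f: "gmod_hom G V W f" and U: "is_submodule G W U"
  shows "is_submodule G V {v \<in> vecs V. f v \<in> U}"
proof -
  have "cfun.subspace {v \<in> vecs V. f v \<in> U}"
    using U gmod_hom_zero[OF V f] gmod_homD(2,3)[OF f] is_gmodD(1,2,4)[OF V]
    by (auto intro!: cfun.subspaceI simp: is_submodule_def cfun.subspace_0 cfun.subspace_add cfun.subspace_scale)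
  then show ?thesis
    using U gmod_homD(4)[OF f] is_gmodD(5)[OF V] by (auto simp: is_submodule_def image_subset_iff)
qed

lemma is_submodule_zero:
  assumes "is_gmod G V"
  shows "is_submodule G V {0}"
proof -
  have "act V g 0 = 0" if "g \<in> carrier G" for g
    using is_gmodD(7)[OF assms that, of 0 0] is_gmodD(1)[OF assms] by simp
  then show ?thesis
    using is_gmodD(1)[OF assms] by (auto simp: is_submodule_def)
qed

lemma is_submodule_kernel:
  assumes "is_gmod G V" "is_gmod G W" "gmod_hom G V W f"
  shows "is_submodule G V {v \<in> vecs V. f v = 0}"
  using is_submodule_vimage[OF assms(1,3) is_submodule_zero[OF assms(2)]] by simp

lemma gmod_hom_image: "gmod_hom G V W f \<Longrightarrow> gmod_hom G V (sub_gmod W (f ` vecs V)) f"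
  by (auto simp: gmod_hom_def linear_between_def)

lemma short_exact_kernel_image:
  assumes "is_gmod G V" "is_gmod G W" "gmod_hom G V W f"
  shows "short_exact G (sub_gmod V {v \<in> vecs V. f v = 0}) V (sub_gmod W (f ` vecs V))"
  unfolding short_exact_def
  using gmod_hom_image[OF assms(3)]
  by (intro exI[of _ "\<lambda>x. x"] exI[of _ f]) (auto simp: gmod_hom_def linear_between_def)

text \<open>The quotient is realised on a complement of \<open>U\<close>, with the action followed by the projection.\<close>

lemma quotient_gmod_exists:
  assumes V: "is_gmod G V" and U: "is_submodule G V U"
  obtains W h where "is_gmod G W" "gmod_hom G V W h" "h ` vecs V = vecs W"
    "\<And>v. v \<in> vecs V \<Longrightarrow> h v = 0 \<longleftrightarrow> v \<in> U" "vecs W \<subseteq> vecs V" "vecs W \<inter> U = {0}"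
proof -
  have sU: "cfun.subspace U" and UV: "U \<subseteq> vecs V"
    and Uact: "\<And>g u. g \<in> carrier G \<Longrightarrow> u \<in> U \<Longrightarrow> act V g u \<in> U"
    using U by (auto simp: is_submodule_def)
  \<comment> \<open>A linear left inverse of the inclusion of \<open>U\<close> is a projection onto
    \<open>U\<close>; the complementary projection \<open>p\<close> then has kernel
    \<open>U\<close>.\<close>
  obtain q where q: "range q \<subseteq> U" "clinear q" "\<And>v. v \<in> U \<Longrightarrow> q v = v"
    using cpair.linear_exists_left_inverse_on[OF clinear_id sU] by auto
  define p where "p v = v - q v" for v
  have p: "clinear p" unfolding p_def by (intro clinear_diff clinear_id q)
  have pU: "p v = 0" if "v \<in> U" for v using that by (simp add: p_def q)
  have vp: "v - p v \<in> U" for v using q(1) by (auto simp: p_def)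
  have pV: "p v \<in> vecs V" if "v \<in> vecs V" for v
    using is_gmodD(3)[OF V that] q(1) UV by (auto simp: p_def)
  have pp: "p (p v) = p v" for v
    using pU[OF vp[of v]] by (simp add: clinearD[OF p])
  have ker: "p v = 0 \<longleftrightarrow> v \<in> U" for v
    using pU vp[of v] by (metis diff_0_right)
  define W where "W = \<lparr>vecs = p ` vecs V, act = (\<lambda>g v. p (act V g v))\<rparr>"
  \<comment> \<open>Since \<open>v - p v\<close> lies in the stable subspace \<open>U\<close>,
    projecting before acting makes no difference after the final projection. This is what makes the
    projected action multiplicative and \<open>p\<close> equivariant.\<close>
  have pact: "p (act V g (p v)) = p (act V g v)" if "g \<in> carrier G" "v \<in> vecs V" for g v
  proof -
    have "act V g v = act V g (v - p v) + act V g (p v)"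
      using is_gmodD(6)[OF V that(1), of "v - p v" "p v"] is_gmodD(3)[OF V that(2) pV[OF that(2)]] pV[OF that(2)]
      by simp
    then show ?thesis using pU[OF Uact[OF that(1) vp[of v]]] by (simp add: clinearD[OF p])
  qed
  have hom: "gmod_hom G V W p"
    by (rule gmod_homI) (auto simp: W_def clinearD[OF p] pact)
  have sW: "cfun.subspace (p ` vecs V)"
    using cpair.linear_subspace_image[OF p is_gmod_subspace[OF V]] .
  have WV: "p ` vecs V \<subseteq> vecs V" using pV by auto
  have W: "is_gmod G W"
    unfolding is_gmod_def
  proof (intro conjI ballI)
    show "cfun.subspace (vecs W)" using sW by (simp add: W_def)
    show "\<exists>B. finite B \<and> cfun.span B = vecs W"
      using V finite_span_subspace[OF _ sW] WV unfolding is_gmod_def W_def by auto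
    show "linear_between (vecs W) (vecs W) (act W g)" if g: "g \<in> carrier G" for g
      using is_gmodD(5,6,7)[OF V g] pV by (auto simp: W_def linear_between_def clinearD[OF p])
    show "act W \<one>\<^bsub>G\<^esub> v = v" if "v \<in> vecs W" for v
      using that V pV by (auto simp: W_def is_gmod_def pp)
    show "act W (g \<otimes>\<^bsub>G\<^esub> h) v = act W g (act W h v)"
      if "g \<in> carrier G" "h \<in> carrier G" "v \<in> vecs W" for g h v
    proof -
      have v: "v \<in> vecs V" using that pV by (auto simp: W_def)
      have hv: "act V h v \<in> vecs V" using is_gmodD(5)[OF V that(2) v] .
      have "act V (g \<otimes>\<^bsub>G\<^esub> h) v = act V g (act V h v)" using V that v by (simp add: is_gmod_def)
      then show ?thesis using pact[OF that(1) hv] by (simp add: W_def)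
    qed
  qed
  show ?thesis
  proof (rule that[OF W hom])
    show "p ` vecs V = vecs W" "vecs W \<subseteq> vecs V" using WV by (auto simp: W_def)
    show "p v = 0 \<longleftrightarrow> v \<in> U" for v by (rule ker)
    show "vecs W \<inter> U = {0}"
      using pU pp cfun.subspace_0[OF sU] cfun.subspace_0[OF sW] by (auto simp: W_def) force
  qed
qed

text \<open>Two preimages of a vector under \<open>h\<close> differ by an element of its kernel, on
  which \<open>k\<close> vanishes; so \<open>k'\<close> may evaluate \<open>k\<close> at an
  arbitrarily chosen preimage.\<close>

lemma gmod_hom_factor:
  assumes V: "is_gmod G V" and h: "gmod_hom G V W h" "h ` vecs V = vecs W"
    and k: "gmod_hom G V X k" and ker: "\<And>v. v \<in> vecs V \<Longrightarrow> h v = 0 \<Longrightarrow> k v = 0"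
  obtains k' where "gmod_hom G W X k'" "\<And>v. v \<in> vecs V \<Longrightarrow> k' (h v) = k v"
proof -
  define k' where "k' w = k (SOME v. v \<in> vecs V \<and> h v = w)" for w
  have k': "k' (h v) = k v" if v: "v \<in> vecs V" for v
  proof -
    let ?u = "SOME u. u \<in> vecs V \<and> h u = h v"
    have u: "?u \<in> vecs V" "h ?u = h v"
      using someI_ex[of "\<lambda>u. u \<in> vecs V \<and> h u = h v"] v by blast+
    then have "k (?u - v) = 0"
      using v by (intro ker) (auto simp: gmod_hom_diff[OF V h(1)] is_gmodD[OF V])
    then show ?thesis using u v by (simp add: k'_def gmod_hom_diff[OF V k])
  qed
  have "gmod_hom G W X k'"
  proof (rule gmod_homI)
    show "k' x \<in> vecs X" if "x \<in> vecs W" for x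
      using that gmod_homD(1)[OF k] by (auto simp: h(2)[symmetric] k')
    show "k' (x + y) = k' x + k' y" if xy: "x \<in> vecs W" "y \<in> vecs W" for x y
    proof -
      obtain a b where ab: "a \<in> vecs V" "b \<in> vecs V" "x = h a" "y = h b" using xy h(2) by blast
      then have "x + y = h (a + b)" by (simp add: gmod_homD(2)[OF h(1)])
      with ab show ?thesis by (simp add: k' gmod_homD(2)[OF k] is_gmodD[OF V])
    qed
    show "k' (cscale c x) = cscale c (k' x)" if xy: "x \<in> vecs W" for c x
    proof -
      obtain a where ab: "a \<in> vecs V" "x = h a" using xy h(2) by blast
      then have "cscale c x = h (cscale c a)" by (simp add: gmod_homD(3)[OF h(1)])
      with ab show ?thesis by (simp add: k' gmod_homD(3)[OF k] is_gmodD[OF V])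
    qed
    show "k' (act W g x) = act X g (k' x)" if xy: "x \<in> vecs W" "g \<in> carrier G" for g x
    proof -
      obtain a where ab: "a \<in> vecs V" "x = h a" using xy h(2) by blast
      then have "act W g x = h (act V g a)" by (simp add: gmod_homD(4)[OF h(1)] xy)
      with ab xy show ?thesis by (simp add: k' gmod_homD(4)[OF k] is_gmodD[OF V])
    qed
  qed
  with k' that show ?thesis by blast
qed

subsection \<open>Isomorphisms\<close>

lemma gmod_iso_sym:
  assumes V: "is_gmod G V" and iso: "gmod_iso G V W"
  shows "gmod_iso G W V"
proof -
  obtain f where f: "gmod_hom G V W f" "bij_betw f (vecs V) (vecs W)"
    using iso by (auto simp: gmod_iso_def)
  have im: "f ` vecs V = vecs W" and inj: "inj_on f (vecs V)" using f(2) by (auto simp: bij_betw_def)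
  \<comment> \<open>The inverse of \<open>f\<close> arises by factoring the identity of
    \<open>V\<close> through \<open>f\<close>, which makes it a homomorphism at once.\<close>
  have id: "gmod_hom G V V (\<lambda>x. x)" by (rule gmod_homI) simp_all
  obtain k where k: "gmod_hom G W V k" "\<And>v. v \<in> vecs V \<Longrightarrow> k (f v) = v"
    using gmod_hom_factor[OF V f(1) im id] inj gmod_hom_inj_iff[OF V f(1)] by metis
  have "bij_betw k (vecs W) (vecs V)"
    using k(2) f(2) by (intro bij_betw_byWitness[where f' = f]) (auto simp: im[symmetric])
  with k(1) show ?thesis by (auto simp: gmod_iso_def)
qed

lemma gmod_iso_trans:
  assumes "gmod_iso G U V" "gmod_iso G V W"
  shows "gmod_iso G U W"
proof -
  obtain f h where "gmod_hom G U V f" "bij_betw f (vecs U) (vecs V)"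
    "gmod_hom G V W h" "bij_betw h (vecs V) (vecs W)"
    using assms by (auto simp: gmod_iso_def)
  then have "gmod_hom G U W (\<lambda>x. h (f x))" "bij_betw (\<lambda>x. h (f x)) (vecs U) (vecs W)"
    using gmod_hom_comp bij_betw_trans[unfolded comp_def] by fast+
  then show ?thesis by (auto simp: gmod_iso_def)
qed

lemma gmod_iso_image:
  assumes "gmod_hom G V W f" "inj_on f (vecs V)"
  shows "gmod_iso G V (sub_gmod W (f ` vecs V))"
  unfolding gmod_iso_def bij_betw_def using assms gmod_hom_image[OF assms(1)]
  by (intro exI[of _ f]) simp

lemma iso_class_eq:
  assumes "is_gmod G V" "gmod_iso G V W"
  shows "iso_class G V = iso_class G W"
  using gmod_iso_trans[OF assms(2)] gmod_iso_trans[OF gmod_iso_sym[OF assms]]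
  by (auto simp: iso_class_def)

lemma irreducible_gmod_iso:
  assumes V: "irreducible_gmod G V" and W: "is_gmod G W" and iso: "gmod_iso G V W"
  shows "irreducible_gmod G W"
proof -
  have gV: "is_gmod G V" using V by (simp add: irreducible_gmod_def)
  obtain f where f: "gmod_hom G V W f" "inj_on f (vecs V)" "f ` vecs V = vecs W"
    using iso by (auto simp: gmod_iso_def bij_betw_def)
  have "vecs W \<noteq> {0}"
  proof
    assume "vecs W = {0}"
    then have "\<forall>v\<in>vecs V. v = 0" using f gmod_hom_inj_iff[OF gV f(1)] by auto
    then show False using V is_gmodD(1)[OF gV] by (auto simp: irreducible_gmod_def)
  qed
  moreover have "U = {0} \<or> U = vecs W" if U: "is_submodule G W U" for U
  proof -
    let ?U = "{v \<in> vecs V. f v \<in> U}"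
    have "U \<subseteq> vecs W" using U by (simp add: is_submodule_def)
    then have im: "f ` ?U = U" using f(3) by auto
    have "?U = {0} \<or> ?U = vecs V"
      using is_submodule_vimage[OF gV f(1) U] V by (simp add: irreducible_gmod_def)
    moreover have "U = {0}" if "?U = {0}"
      using im gmod_hom_zero[OF gV f(1)] unfolding that by simp
    moreover have "U = vecs W" if "?U = vecs V"
      using im f(3) unfolding that by simp
    ultimately show ?thesis by blast
  qed
  ultimately show ?thesis using W by (simp add: irreducible_gmod_def)
qed

subsection \<open>Classes in the Grothendieck group\<close>

lemma has_class_is_gmod: "has_class G V x \<Longrightarrow> is_gmod G V"
  by (cases rule: has_class.cases) (auto simp: irreducible_gmod_def)

lemma short_exactI:
  assumes "gmod_hom G U V f" "gmod_hom G V W h" "inj_on f (vecs U)"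
    "f ` vecs U = {v \<in> vecs V. h v = 0}" "h ` vecs V = vecs W"
  shows "short_exact G U V W"
  using assms unfolding short_exact_def by blast

lemma short_exactE:
  assumes "short_exact G U V W"
  obtains f h where "gmod_hom G U V f" "gmod_hom G V W h" "inj_on f (vecs U)"
    "f ` vecs U = {v \<in> vecs V. h v = 0}" "h ` vecs V = vecs W"
  using assms unfolding short_exact_def by blast

lemma short_exact_submodule:
  assumes "is_submodule G V U" "gmod_hom G V W h" "h ` vecs V = vecs W"
    "\<And>v. v \<in> vecs V \<Longrightarrow> h v = 0 \<longleftrightarrow> v \<in> U"
  shows "short_exact G (sub_gmod V U) V W"
proof (rule short_exactI[OF _ assms(2) _ _ assms(3)])
  have "U \<subseteq> vecs V" using assms(1) by (simp add: is_submodule_def)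
  then show "gmod_hom G (sub_gmod V U) V (\<lambda>x. x)" "inj_on (\<lambda>x. x) (vecs (sub_gmod V U))"
    "(\<lambda>x. x) ` vecs (sub_gmod V U) = {v \<in> vecs V. h v = 0}"
    using assms(4) by (auto intro!: gmod_homI)
qed

text \<open>\<open>V'\<close> may live in another function space than \<open>V\<close>, so the ends
  of an exact step cannot be kept. They are replaced by the image \<open>?I\<close> of
  \<open>U\<close> in \<open>V'\<close> and a quotient of \<open>V'\<close> by \<open>?I\<close>;
  the latter is isomorphic to \<open>W\<close> because the composite map from \<open>V\<close> to it
  has the same kernel as \<open>h\<close>.\<close>

lemma has_class_iso:
  assumes "has_class G V x" "is_gmod G V'" "gmod_iso G V V'"
  shows "has_class G V' x"
  using assms
proof (induction arbitrary: V' rule: has_class.induct)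
  case (zero V)
  then obtain f where "gmod_hom G V V' f" "f ` vecs V = vecs V'"
    by (auto simp: gmod_iso_def bij_betw_def)
  then have "vecs V' = {0}"
    using gmod_hom_zero[OF zero(1), of V' f] zero(2) by auto
  with zero show ?case by (intro has_class.zero)
next
  case (irreducible V)
  have "is_gmod G V" using irreducible(1) by (simp add: irreducible_gmod_def)
  then have "iso_class G V = iso_class G V'" using irreducible iso_class_eq by metis
  then show ?case
    using has_class.irreducible[OF irreducible_gmod_iso[OF irreducible]] by simp
next
  case (exact V U W x y)
  note V = exact(1) and V' = exact.prems(1)
  have U: "is_gmod G U" and W: "is_gmod G W" using exact has_class_is_gmod by blast+
  obtain f h where fh: "gmod_hom G U V f" "gmod_hom G V W h" "inj_on f (vecs U)"
    "f ` vecs U = {v \<in> vecs V. h v = 0}" "h ` vecs V = vecs W"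
    using short_exactE[OF exact(2)] .
  obtain k where k: "gmod_hom G V V' k" "inj_on k (vecs V)" "k ` vecs V = vecs V'"
    using exact.prems(2) by (auto simp: gmod_iso_def bij_betw_def)
  have kf: "gmod_hom G U V' (\<lambda>u. k (f u))" using gmod_hom_comp[OF fh(1) k(1)] .
  have injkf: "inj_on (\<lambda>u. k (f u)) (vecs U)"
    using comp_inj_on[OF fh(3), of k] inj_on_subset[OF k(2)] fh(4) by (simp add: comp_def)
  let ?I = "(\<lambda>u. k (f u)) ` vecs U"
  have I: "is_submodule G V' ?I" using is_submodule_image[OF U kf] .
  have U': "has_class G (sub_gmod V' ?I) x"
    using exact.IH(1)[OF is_gmod_sub[OF V' I] gmod_iso_image[OF kf injkf]] .
  obtain W' p where p: "is_gmod G W'" "gmod_hom G V' W' p" "p ` vecs V' = vecs W'"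
    "\<And>v. v \<in> vecs V' \<Longrightarrow> p v = 0 \<longleftrightarrow> v \<in> ?I" "vecs W' \<subseteq> vecs V'"
    using quotient_gmod_exists[OF V' I] by metis
  have pk: "gmod_hom G V W' (\<lambda>v. p (k v))" using gmod_hom_comp[OF k(1) p(2)] .
  have ker: "p (k v) = 0 \<longleftrightarrow> h v = 0" if v: "v \<in> vecs V" for v
  proof -
    have "p (k v) = 0 \<longleftrightarrow> k v \<in> k ` (f ` vecs U)"
      using p(4) k(3) v by (auto simp: image_image)
    also have "\<dots> \<longleftrightarrow> v \<in> f ` vecs U"
      using k(2) v fh(4) by (intro inj_on_image_mem_iff) auto
    also have "\<dots> \<longleftrightarrow> h v = 0" using fh(4) v by auto
    finally show ?thesis .
  qed
  obtain q where q: "gmod_hom G W W' q" "\<And>v. v \<in> vecs V \<Longrightarrow> q (h v) = p (k v)"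
    using gmod_hom_factor[OF V fh(2,5) pk] ker by metis
  have "inj_on q (vecs W)"
    unfolding gmod_hom_inj_iff[OF W q(1)] using q(2) ker by (auto simp: fh(5)[symmetric])
  moreover have "q ` vecs W = vecs W'"
  proof -
    have "q ` vecs W = (\<lambda>v. p (k v)) ` vecs V"
      unfolding fh(5)[symmetric] image_image using q(2) by (intro image_cong) auto
    also have "\<dots> = vecs W'" using k(3) p(3) by (metis image_image)
    finally show ?thesis .
  qed
  ultimately have "gmod_iso G W W'" using q(1) by (auto simp: gmod_iso_def bij_betw_def)
  then have W': "has_class G W' y" using exact.IH(2) p(1) by blast
  have "short_exact G (sub_gmod V' ?I) V' W'"
    using short_exact_submodule[OF I p(2,3,4)] .
  then show ?case using has_class.exact[OF V' _ U' W'] by blast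
qed

section \<open>Uniqueness of classes: refinement of exact sequences\<close>

lemma has_class_zeroD:
  assumes "has_class G V x" "vecs V = {0}"
  shows "x = 0"
  using assms
proof (induction rule: has_class.induct)
  case (exact V U W x y)
  obtain f h where fh: "gmod_hom G U V f" "gmod_hom G V W h" "inj_on f (vecs U)"
    "h ` vecs V = vecs W"
    using short_exactE[OF exact(2)] .
  have U: "is_gmod G U" using exact has_class_is_gmod by blast
  have V0: "vecs V = {0}" using exact.prems by (simp add: zero_fun_def)
  have "vecs U = {0}"
    using fh(3) gmod_homD(1)[OF fh(1)] V0 is_gmodD(1)[OF U]
    unfolding gmod_hom_inj_iff[OF U fh(1)] by auto
  moreover have "vecs W = {0}"
    using fh(4) V0 gmod_hom_zero[OF exact(1) fh(2)] by auto
  ultimately show ?case using exact.IH by (simp add: zero_fun_def)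
qed (auto simp: irreducible_gmod_def)

text \<open>
  The Jordan--Hoelder argument: an exact sequence \<open>U \<rightarrow> V \<rightarrow> W\<close> and the last step \<open>U' \<rightarrow> V \<rightarrow> W'\<close>
  of a derivation of \<open>[V]\<close> have a common refinement, namely the three by three diagram with
  corners \<open>U \<inter> U'\<close>, \<open>U / (U \<inter> U')\<close>, \<open>U' / (U \<inter> U')\<close> and \<open>V / (U + U')\<close>.
\<close>

lemma has_class_split:
  fixes U V W :: "('g, 'i) gmod"
  assumes "has_class G V x" "short_exact G U V W" "is_gmod G U" "is_gmod G W"
  shows "\<exists>a b. has_class G U a \<and> has_class G W b \<and> x = a + b"
  using assms
proof (induction arbitrary: U W rule: has_class.induct)
  case (zero V)
  obtain f h where fh: "gmod_hom G U V f" "gmod_hom G V W h" "inj_on f (vecs U)"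
    "f ` vecs U = {v \<in> vecs V. h v = 0}" "h ` vecs V = vecs W"
    using short_exactE[OF zero(3)] .
  have "vecs U = {0}"
    using fh(3) gmod_homD(1)[OF fh(1)] zero(2) is_gmodD(1)[OF zero(4)]
    unfolding gmod_hom_inj_iff[OF zero(4) fh(1)] by auto
  moreover have "vecs W = {0}"
    using fh(5) zero(2) gmod_hom_zero[OF zero(1) fh(2)] by auto
  ultimately show ?case
    using has_class.zero[OF zero(4)] has_class.zero[OF zero(5)] by force
next
  case (irreducible V)
  have V: "is_gmod G V" using irreducible(1) by (simp add: irreducible_gmod_def)
  obtain f h where fh: "gmod_hom G U V f" "gmod_hom G V W h" "inj_on f (vecs U)"
    "f ` vecs U = {v \<in> vecs V. h v = 0}" "h ` vecs V = vecs W"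
    using short_exactE[OF irreducible(2)] .
  have VV: "has_class G V (frag_of (iso_class G V))"
    using has_class.irreducible[OF irreducible(1)] .
  have "f ` vecs U = {0} \<or> f ` vecs U = vecs V"
    using is_submodule_image[OF irreducible(3) fh(1)] irreducible(1)
    by (simp add: irreducible_gmod_def)
  then show ?case
  proof
    assume f0: "f ` vecs U = {0}"
    then have "vecs U = {0}"
      using fh(3) is_gmodD(1)[OF irreducible(3)]
      unfolding gmod_hom_inj_iff[OF irreducible(3) fh(1)] by auto
    moreover have "gmod_iso G V W"
      unfolding gmod_iso_def bij_betw_def gmod_hom_inj_iff[OF V fh(2)]
      using f0 fh gmod_hom_inj_iff[OF V fh(2)] by (intro exI[of _ h]) auto
    ultimately show ?thesis
      using has_class.zero[OF irreducible(3)] has_class_iso[OF VV irreducible(4)] by force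
  next
    assume fV: "f ` vecs U = vecs V"
    have "h v = 0" if "v \<in> vecs V" for v using that fV fh(4) by auto
    then have "vecs W = {0}"
      using is_gmodD(1)[OF V] by (auto simp: fh(5)[symmetric])
    moreover have "gmod_iso G U V"
      unfolding gmod_iso_def bij_betw_def using fV fh by blast
    ultimately show ?thesis
      using has_class.zero[OF irreducible(4)]
        has_class_iso[OF VV irreducible(3) gmod_iso_sym[OF irreducible(3)]] by force
  qed
next
  case (exact V U' W' x y)
  note V = exact(1) and U = exact.prems(2) and W = exact.prems(3)
  have U': "is_gmod G U'" and W': "is_gmod G W'" using exact has_class_is_gmod by blast+
  obtain f h where fh: "gmod_hom G U V f" "gmod_hom G V W h" "inj_on f (vecs U)"
    "f ` vecs U = {v \<in> vecs V. h v = 0}" "h ` vecs V = vecs W"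
    using short_exactE[OF exact.prems(1)] .
  obtain f' h' where fh': "gmod_hom G U' V f'" "gmod_hom G V W' h'" "inj_on f' (vecs U')"
    "f' ` vecs U' = {v \<in> vecs V. h' v = 0}" "h' ` vecs V = vecs W'"
    using short_exactE[OF exact(2)] .
  have hf': "gmod_hom G U' W (\<lambda>u. h (f' u))" using gmod_hom_comp[OF fh'(1) fh(2)] .
  have h'f: "gmod_hom G U W' (\<lambda>u. h' (f u))" using gmod_hom_comp[OF fh(1) fh'(2)] .
  \<comment> \<open>\<open>?K\<close> and \<open>?K'\<close> are two copies of the corner U \<inter>
    U', which inside \<open>V\<close> is \<open>?I\<close>. The image \<open>?M\<close> of
    \<open>U'\<close> in \<open>W\<close> is the corner U' / (U \<inter> U'), and the image
    \<open>?N\<close> of \<open>U\<close> in \<open>W'\<close> is U / (U \<inter> U').\<close>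
  let ?K' = "{u \<in> vecs U'. h (f' u) = 0}" and ?K = "{u \<in> vecs U. h' (f u) = 0}"
  let ?M = "(\<lambda>u. h (f' u)) ` vecs U'" and ?N = "(\<lambda>u. h' (f u)) ` vecs U"
  let ?I = "{v \<in> vecs V. h v = 0 \<and> h' v = 0}"
  have K': "is_gmod G (sub_gmod U' ?K')" using is_gmod_sub[OF U' is_submodule_kernel[OF U' W hf']] .
  have K: "is_gmod G (sub_gmod U ?K)" using is_gmod_sub[OF U is_submodule_kernel[OF U W' h'f]] .
  have M: "is_gmod G (sub_gmod W ?M)" using is_gmod_sub[OF W is_submodule_image[OF U' hf']] .
  have N: "is_gmod G (sub_gmod W' ?N)" using is_gmod_sub[OF W' is_submodule_image[OF U h'f]] .
  have fK: "gmod_hom G (sub_gmod U ?K) V f" "inj_on f ?K" "f ` ?K = ?I"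
    using fh inj_on_subset[OF fh(3), of ?K]
    by (auto simp: gmod_hom_def linear_between_def)
  have fK': "gmod_hom G (sub_gmod U' ?K') V f'" "inj_on f' ?K'" "f' ` ?K' = ?I"
    using fh' inj_on_subset[OF fh'(3), of ?K']
    by (auto simp: gmod_hom_def linear_between_def)
  have isoK: "gmod_iso G (sub_gmod U ?K) (sub_gmod V ?I)"
    using gmod_iso_image[OF fK(1)] fK(2,3) by simp
  have isoK': "gmod_iso G (sub_gmod U' ?K') (sub_gmod V ?I)"
    using gmod_iso_image[OF fK'(1)] fK'(2,3) by simp
  \<comment> \<open>The last corner V / (U + U') is constructed as the quotient of \<open>W'\<close>
    by \<open>?N\<close>; the map \<open>q\<close> below exhibits it as the quotient of
    \<open>W\<close> by \<open>?M\<close> too.\<close>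
  obtain Q p where p: "is_gmod G Q" "gmod_hom G W' Q p" "p ` vecs W' = vecs Q"
    "\<And>v. v \<in> vecs W' \<Longrightarrow> p v = 0 \<longleftrightarrow> v \<in> ?N" "vecs Q \<subseteq> vecs W'"
    using quotient_gmod_exists[OF W' is_submodule_image[OF U h'f]] by metis
  obtain a b where ab: "has_class G (sub_gmod U' ?K') a" "has_class G (sub_gmod W ?M) b" "x = a + b"
    using exact.IH(1)[OF short_exact_kernel_image[OF U' W hf'] K' M] by blast
  have "short_exact G (sub_gmod W' ?N) W' Q"
    using short_exact_submodule[OF is_submodule_image[OF U h'f] p(2,3,4)] .
  then obtain c d where cd: "has_class G (sub_gmod W' ?N) c" "has_class G Q d" "y = c + d"
    using exact.IH(2)[OF _ N p(1)] by blast
  have "has_class G (sub_gmod U ?K) a"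
    using has_class_iso[OF ab(1) K gmod_iso_trans[OF isoK' gmod_iso_sym[OF K isoK]]] .
  then have Ua: "has_class G U (a + c)"
    using has_class.exact[OF U short_exact_kernel_image[OF U W' h'f] _ cd(1)] by blast
  have ph': "gmod_hom G V Q (\<lambda>v. p (h' v))" using gmod_hom_comp[OF fh'(2) p(2)] .
  have ker: "p (h' v) = 0" if "v \<in> vecs V" "h v = 0" for v
  proof -
    have "v \<in> f ` vecs U" using that fh(4) by auto
    then show ?thesis using p(4) gmod_homD(1)[OF fh'(2) that(1)] by auto
  qed
  obtain q where q: "gmod_hom G W Q q" "\<And>v. v \<in> vecs V \<Longrightarrow> q (h v) = p (h' v)"
    using gmod_hom_factor[OF V fh(2,5) ph' ker] by metis
  have qM: "?M = {w \<in> vecs W. q w = 0}"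
  proof (intro equalityI subsetI)
    fix w assume "w \<in> ?M"
    then obtain u where u: "u \<in> vecs U'" "w = h (f' u)" by auto
    have "f' u \<in> vecs V" "h' (f' u) = 0" using u(1) fh'(4) by auto
    then show "w \<in> {w \<in> vecs W. q w = 0}"
      using u q(2) gmod_hom_zero[OF W' p(2)] gmod_homD(1)[OF fh(2)] by auto
  next
    \<comment> \<open>If \<open>v\<close> dies in \<open>Q\<close>, then \<open>h' v\<close> already
      comes from some \<open>u\<close> in \<open>U\<close>. Subtracting \<open>f u\<close> does not
      change the image in \<open>W\<close>, but moves \<open>v\<close> into the kernel of
      \<open>h'\<close>, that is, into the image of \<open>U'\<close>.\<close>
    fix w assume "w \<in> {w \<in> vecs W. q w = 0}"
    then obtain v where v: "v \<in> vecs V" "w = h v" "p (h' v) = 0"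
      using q(2) by (auto simp: fh(5)[symmetric])
    then obtain u where u: "u \<in> vecs U" "h' v = h' (f u)"
      using p(4) gmod_homD(1)[OF fh'(2)] by auto
    have fu: "f u \<in> vecs V" "h (f u) = 0" using u(1) fh(4) by auto
    then have "v - f u \<in> f' ` vecs U'"
      using fh'(4) u(2) v(1) is_gmodD(3)[OF V] by (auto simp: gmod_hom_diff[OF V fh'(2)])
    then obtain u' where u': "u' \<in> vecs U'" "v - f u = f' u'" by auto
    have "w = h (v - f u)" using v fu by (simp add: gmod_hom_diff[OF V fh(2)])
    with u' show "w \<in> ?M" by auto
  qed
  have "q ` vecs W = (\<lambda>v. p (h' v)) ` vecs V"
    unfolding fh(5)[symmetric] image_image using q(2) by (intro image_cong) auto
  then have "q ` vecs W = vecs Q" using p(3) fh'(5) by (metis image_image)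
  then have "short_exact G (sub_gmod W ?M) W Q"
    using short_exact_submodule[OF is_submodule_image[OF U' hf'] q(1)] qM by blast
  then have "has_class G W (b + d)"
    using has_class.exact[OF W _ ab(2) cd(2)] by blast
  with Ua show ?case
    using ab(3) cd(3) by (intro exI[of _ "a + c"] exI[of _ "b + d"]) (auto simp: algebra_simps)
qed

text \<open>An exact sequence with irreducible middle term has one zero end and one end isomorphic
  to the middle, so every derivation collapses to the generator.\<close>

lemma has_class_irreducibleD:
  assumes "has_class G V x" "irreducible_gmod G V"
  shows "x = frag_of (iso_class G V)"
  using assms
proof (induction rule: has_class.induct)
  case (exact V U W x y)
  have U: "is_gmod G U" and W: "is_gmod G W" using exact has_class_is_gmod by blast+
  obtain f h where fh: "gmod_hom G U V f" "gmod_hom G V W h" "inj_on f (vecs U)"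
    "f ` vecs U = {v \<in> vecs V. h v = 0}" "h ` vecs V = vecs W"
    using short_exactE[OF exact(2)] .
  have "f ` vecs U = {0} \<or> f ` vecs U = vecs V"
    using is_submodule_image[OF U fh(1)] exact.prems by (simp add: irreducible_gmod_def)
  then show ?case
  proof
    assume f0: "f ` vecs U = {0}"
    then have "vecs U = {0}"
      using fh(3) is_gmodD(1)[OF U] unfolding gmod_hom_inj_iff[OF U fh(1)] by auto
    moreover have iso: "gmod_iso G V W"
      unfolding gmod_iso_def bij_betw_def
      using f0 fh gmod_hom_inj_iff[OF exact(1) fh(2)] by (intro exI[of _ h]) auto
    ultimately show ?thesis
      using exact.IH(2) has_class_zeroD[OF exact(3)] irreducible_gmod_iso[OF exact.prems W]
        iso_class_eq[OF exact(1) iso] iso by simp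
  next
    assume fV: "f ` vecs U = vecs V"
    have "h v = 0" if "v \<in> vecs V" for v using that fV fh(4) by auto
    then have "vecs W = {0}"
      using is_gmodD(1)[OF exact(1)] by (auto simp: fh(5)[symmetric])
    moreover have iso: "gmod_iso G U V"
      unfolding gmod_iso_def bij_betw_def using fV fh by blast
    ultimately show ?thesis
      using exact.IH(1) has_class_zeroD[OF exact(4)] iso_class_eq[OF U iso]
        irreducible_gmod_iso[OF exact.prems U gmod_iso_sym[OF U iso]] by simp
  qed
qed (auto simp: irreducible_gmod_def)

text \<open>Induction over the first derivation. In the exact step, \<open>has_class_split\<close>
  cuts the second derivation along the sequence used last in the first one.\<close>

lemma has_class_unique:
  assumes "has_class G V x" "has_class G V y"
  shows "x = y"
  using assms
proof (induction arbitrary: y rule: has_class.induct)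
  case (zero V)
  then show ?case using has_class_zeroD by blast
next
  case (irreducible V)
  then show ?case using has_class_irreducibleD by blast
next
  case (exact V U W a b)
  have "is_gmod G U" "is_gmod G W" using exact has_class_is_gmod by blast+
  then obtain a' b' where "has_class G U a'" "has_class G W b'" "y = a' + b'"
    using has_class_split[OF exact.prems exact(2)] by blast
  then show ?case using exact.IH by blast
qed

section \<open>Existence of classes by induction on the dimension\<close>

lemma dim_psubspace_less:
  assumes U: "cfun.subspace U" and V: "\<exists>B. finite B \<and> cfun.span B = V" and UV: "U \<subset> V"
  shows "cfun.dim U < cfun.dim V"
proof -
  obtain B where B: "finite B" "cfun.span B = V" using V by blast
  obtain C where C: "C \<subseteq> U" "cfun.independent C" "U \<subseteq> cfun.span C" "card C = cfun.dim U"
    using cfun.basis_exists by metis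
  obtain v where v: "v \<in> V" "v \<notin> U" using UV by blast
  have "cfun.span C \<subseteq> U" using C(1) U cfun.span_minimal by blast
  then have ind: "cfun.independent (insert v C)" using v C(2) cfun.independent_insertI by blast
  \<comment> \<open>Only \<open>V\<close> is known to be finite-dimensional, not the function space
    around it. Hence the enlarged independent set is completed inside \<open>V\<close>, and its
    finiteness comes from the spanning set \<open>B\<close>.\<close>
  obtain D where D: "insert v C \<subseteq> D" "D \<subseteq> V" "cfun.independent D" "V \<subseteq> cfun.span D"
    using cfun.maximal_independent_subset_extend[OF _ ind, of V] C(1) UV v by blast
  have fD: "finite D" using cfun.independent_span_bound[OF B(1) D(3)] D(2) B(2) by blast
  have "v \<notin> C" using C(1) v by blast
  then have "cfun.dim U < card (insert v C)" using C(4) finite_subset[OF _ fD] D(1) by simp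
  also have "\<dots> \<le> card D" using D(1) fD card_mono by blast
  also have "\<dots> = cfun.dim V" using cfun.basis_card_eq_dim[OF D(2,4,3)] .
  finally show ?thesis .
qed

text \<open>Both parts of a reducible module are proper subspaces of \<open>vecs V\<close>: the
  submodule by assumption, and the complement carrying the quotient because it meets a nonzero
  submodule only in 0. So both have smaller dimension.\<close>

lemma has_class_exists:
  assumes "is_gmod G V"
  shows "\<exists>x. has_class G V x"
  using assms
proof (induction "cfun.dim (vecs V)" arbitrary: V rule: less_induct)
  case less
  show ?case
  proof (cases "vecs V = {0} \<or> irreducible_gmod G V")
    case True
    then show ?thesis using less.prems has_class.zero has_class.irreducible by blast
  next
    case False
    then obtain U where U: "is_submodule G V U" "U \<noteq> {0}" "U \<noteq> vecs V"
      using less.prems by (auto simp: irreducible_gmod_def)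
    have fin: "\<exists>B. finite B \<and> cfun.span B = vecs V" using less.prems by (simp add: is_gmod_def)
    have sU: "cfun.subspace U" "U \<subset> vecs V" using U by (auto simp: is_submodule_def)
    obtain W h where h: "is_gmod G W" "gmod_hom G V W h" "h ` vecs V = vecs W"
      "\<And>v. v \<in> vecs V \<Longrightarrow> h v = 0 \<longleftrightarrow> v \<in> U" "vecs W \<subseteq> vecs V" "vecs W \<inter> U = {0}"
      using quotient_gmod_exists[OF less.prems U(1)] by metis
    have "vecs W \<subset> vecs V" using h(5,6) sU U(2) by blast
    then obtain y where y: "has_class G W y"
      using less.hyps[OF dim_psubspace_less[OF is_gmod_subspace[OF h(1)] fin] h(1)] by blast
    obtain x where x: "has_class G (sub_gmod V U) x"
      using less.hyps[of "sub_gmod V U"] dim_psubspace_less[OF sU(1) fin sU(2)]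
        is_gmod_sub[OF less.prems U(1)] by auto
    have "short_exact G (sub_gmod V U) V W"
      using short_exact_submodule[OF U(1) h(2,3,4)] .
    then show ?thesis using has_class.exact[OF less.prems _ x y] by blast
  qed
qed

lemma groth_class_eqI: "has_class G V x \<Longrightarrow> groth_class G V = x"
  unfolding groth_class_def using has_class_unique by blast

lemma has_class_groth_class: "is_gmod G V \<Longrightarrow> has_class G V (groth_class G V)"
  using has_class_exists groth_class_eqI by metis

lemma groth_class_iso:
  "is_gmod G V \<Longrightarrow> is_gmod G W \<Longrightarrow> gmod_iso G V W \<Longrightarrow> groth_class G V = groth_class G W"
  using has_class_iso has_class_groth_class groth_class_eqI by metis

lemma groth_class_exact:
  fixes U V W :: "('g, 'i) gmod"
  assumes "is_gmod G U" "is_gmod G V" "is_gmod G W" "short_exact G U V W"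
  shows "groth_class G V = groth_class G U + groth_class G W"
  using has_class.exact[OF assms(2,4) has_class_groth_class[OF assms(1)] has_class_groth_class[OF assms(3)]]
  by (rule groth_class_eqI)

text \<open>Numbering a basis \<open>B\<close> by an injection \<open>e\<close> transports \<open>V\<close> to \<open>nat \<Rightarrow> complex\<close>.\<close>

lemma nat_model_exists:
  assumes V: "is_gmod G V"
  shows "\<exists>S :: ('g, nat) gmod. is_gmod G S \<and> gmod_iso G V S"
proof -
  obtain A where A: "finite A" "cfun.span A = vecs V" using V by (auto simp: is_gmod_def)
  obtain B where B: "B \<subseteq> vecs V" "cfun.independent B" "vecs V \<subseteq> cfun.span B"
    using cfun.maximal_independent_subset by metis
  have fB: "finite B" using cfun.independent_span_bound[OF A(1) B(2)] B(1) A(2) by blast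
  have VB: "vecs V = cfun.span B"
    using B cfun.span_minimal[OF B(1) is_gmod_subspace[OF V]] by blast
  obtain e :: "_ \<Rightarrow> nat" where e: "inj_on e B"
    using finite_imp_inj_to_nat_seg[OF fB] by metis
  obtain F where F: "clinear F" "\<And>b. b \<in> B \<Longrightarrow> F b = (\<lambda>m. if m = e b then 1 else 0 :: complex)"
    using cpair.linear_independent_extend[OF B(2), of "\<lambda>b m. if m = e b then 1 else 0"] by blast
  have inj: "inj_on F (vecs V)"
  proof -
    have "v = 0" if v: "v \<in> cfun.span B" "F v = 0" for v
    proof -
      obtain c where c: "v = (\<Sum>b\<in>B. cscale (c b) b)" using v(1) cfun.span_finite[OF fB] by auto
      have "c b = 0" if b: "b \<in> B" for b
      proof -
        have "F v = (\<Sum>b\<in>B. cscale (c b) (F b))"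
          unfolding c by (simp add: clinear_sum[OF F(1)] clinearD[OF F(1)])
        \<comment> \<open>Evaluation at the number \<open>e b\<close> isolates the coefficient of
          \<open>b\<close>, since \<open>e\<close> is injective on the basis.\<close>
        then have "0 = (\<Sum>b'\<in>B. cscale (c b') (F b')) (e b)" using v(2) by simp
        also have "\<dots> = (\<Sum>b'\<in>B. c b' * (if e b = e b' then 1 else 0))"
          by (simp add: fun_sum_apply cscale_def F(2))
        also have "\<dots> = (\<Sum>b'\<in>B. if b' = b then c b' else 0)"
          using e b by (intro sum.cong) (auto simp: inj_on_def)
        also have "\<dots> = c b" using fB b by simp
        finally show ?thesis by simp
      qed
      then show ?thesis unfolding c by simp
    qed
    then have "\<forall>v\<in>vecs V. F v = 0 \<longrightarrow> v = 0" using VB by blast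
    then show ?thesis
      using clinearD(2)[OF F(1)] is_gmodD(3)[OF V] by (auto simp: inj_on_def) (metis right_minus_eq)
  qed
  obtain H where H: "clinear H" "\<And>v. v \<in> vecs V \<Longrightarrow> H (F v) = v"
    using cpair.linear_exists_left_inverse_on[OF F(1) is_gmod_subspace[OF V] inj] by blast
  define S where "S = \<lparr>vecs = F ` vecs V, act = (\<lambda>g s. F (act V g (H s)))\<rparr>"
  have hom: "gmod_hom G V S F"
    by (rule gmod_homI) (auto simp: S_def clinearD[OF F(1)] H(2))
  have "is_gmod G S"
    unfolding is_gmod_def
  proof (intro conjI ballI)
    show "cfun.subspace (vecs S)"
      using cpair.linear_subspace_image[OF F(1) is_gmod_subspace[OF V]] by (simp add: S_def)
    show "\<exists>B. finite B \<and> cfun.span B = vecs S"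
      using A cpair.linear_span_image[OF F(1), of A] by (intro exI[of _ "F ` A"]) (simp add: S_def)
    show "linear_between (vecs S) (vecs S) (act S g)" if "g \<in> carrier G" for g
      using is_gmodD(2,4-7)[OF V] that
      by (auto simp: S_def linear_between_def clinearD[OF F(1), symmetric] H(2))
    show "act S \<one>\<^bsub>G\<^esub> v = v" if "v \<in> vecs S" for v
      using that V by (auto simp: S_def is_gmod_def H(2))
    show "act S (g \<otimes>\<^bsub>G\<^esub> h) v = act S g (act S h v)"
      if "g \<in> carrier G" "h \<in> carrier G" "v \<in> vecs S" for g h v
      using that V is_gmodD(5)[OF V] by (auto simp: S_def is_gmod_def H(2))
  qed
  moreover have "gmod_iso G V S"
    using hom inj by (auto simp: gmod_iso_def bij_betw_def S_def)
  ultimately show ?thesis by blast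
qed

section \<open>Representatives of classes and subtraction in the Grothendieck ring\<close>

lemma class_rep_iso_class:
  assumes "is_gmod G V"
  shows "is_gmod G (class_rep (iso_class G V))" "gmod_iso G V (class_rep (iso_class G V))"
proof -
  have "\<exists>S. S \<in> iso_class G V" using nat_model_exists[OF assms] by (auto simp: iso_class_def)
  then have "class_rep (iso_class G V) \<in> iso_class G V" unfolding class_rep_def by (rule someI_ex)
  then show "is_gmod G (class_rep (iso_class G V))" "gmod_iso G V (class_rep (iso_class G V))"
    by (simp_all add: iso_class_def)
qed

text \<open>\<open>irr_classes\<close> only collects classes of irreducible modules inside
  \<open>nat \<Rightarrow> complex\<close>. For an irreducible \<open>V\<close> elsewhere, the
  representative of its class is such a module and has the same class.\<close>

lemma keys_has_class:
  assumes "has_class G V x"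
  shows "Poly_Mapping.keys x \<subseteq> irr_classes G"
  using assms
proof (induction rule: has_class.induct)
  case (irreducible V)
  have V: "is_gmod G V" using irreducible by (simp add: irreducible_gmod_def)
  let ?S = "class_rep (iso_class G V)"
  have "irreducible_gmod G ?S" "iso_class G V = iso_class G ?S"
    using irreducible_gmod_iso[OF irreducible] class_rep_iso_class[OF V] iso_class_eq[OF V] by blast+
  then have "iso_class G V \<in> irr_classes G" unfolding irr_classes_def by blast
  then show ?case by simp
next
  case (exact V U W x y)
  then show ?case using keys_add[of x y] by blast
qed simp

lemma groth_class_in_carrier:
  "is_gmod G V \<Longrightarrow> groth_class G V \<in> carrier (groth_ring G)"
  using keys_has_class[OF has_class_groth_class] by (simp add: groth_ring_def)

text \<open>The additive inverse in a ring is a definite description over the carrier. It is the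
  negative of the formal sum \<open>y\<close>, which has the same support as \<open>y\<close> and so
  stays in the carrier.\<close>

lemma groth_ring_minus:
  assumes "y \<in> carrier (groth_ring G)"
  shows "x \<ominus>\<^bsub>groth_ring G\<^esub> y = x - y"
proof -
  have y: "Poly_Mapping.keys y \<subseteq> irr_classes G" using assms by (simp add: groth_ring_def)
  have "(THE z. z \<in> carrier (groth_ring G) \<and> y + z = 0 \<and> z + y = 0) = - y"
    using y by (intro the_equality) (auto simp: groth_ring_def eq_neg_iff_add_eq_0 add.commute)
  then show ?thesis
    by (simp add: a_minus_def a_inv_def m_inv_def) (simp add: groth_ring_def)
qed

subsection \<open>Tensor products\<close>

text \<open>
  The tensor product of two linear maps, available on all functions and not only on the span of
  the pure tensors: apply \<open>L\<close> to the slices in the second variable, then \<open>K\<close> to those in the first.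
\<close>

definition tens ::
    "(('i \<Rightarrow> complex) \<Rightarrow> ('k \<Rightarrow> complex)) \<Rightarrow> (('j \<Rightarrow> complex) \<Rightarrow> ('l \<Rightarrow> complex)) \<Rightarrow>
     ('i \<times> 'j \<Rightarrow> complex) \<Rightarrow> ('k \<times> 'l \<Rightarrow> complex)" where
  "tens K L f = (\<lambda>(a, b). K (\<lambda>a'. L (\<lambda>b'. f (a', b')) b) a)"

lemma clinear_tens:
  fixes K :: "('i \<Rightarrow> complex) \<Rightarrow> ('k \<Rightarrow> complex)" and L :: "('j \<Rightarrow> complex) \<Rightarrow> ('l \<Rightarrow> complex)"
  assumes K: "clinear K" and L: "clinear L"
  shows "clinear (tens K L)"
proof (rule clinearI)
  fix x y :: "'i \<times> 'j \<Rightarrow> complex"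
  have L': "L (\<lambda>b'. x (a', b') + y (a', b')) = L (\<lambda>b'. x (a', b')) + L (\<lambda>b'. y (a', b'))" for a'
    using clinearD(1)[OF L, of "\<lambda>b'. x (a', b')" "\<lambda>b'. y (a', b')"] by (simp add: plus_fun_def)
  have "K (\<lambda>a'. L (\<lambda>b'. x (a', b')) b + L (\<lambda>b'. y (a', b')) b)
      = K (\<lambda>a'. L (\<lambda>b'. x (a', b')) b) + K (\<lambda>a'. L (\<lambda>b'. y (a', b')) b)" for b
    using clinearD(1)[OF K, of "\<lambda>a'. L (\<lambda>b'. x (a', b')) b" "\<lambda>a'. L (\<lambda>b'. y (a', b')) b"]
    by (simp add: plus_fun_def)
  then show "tens K L (x + y) = tens K L x + tens K L y"
    by (auto simp: tens_def fun_eq_iff L')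
next
  fix c and x :: "'i \<times> 'j \<Rightarrow> complex"
  have L': "L (\<lambda>b'. c * x (a', b')) = cscale c (L (\<lambda>b'. x (a', b')))" for a'
    using clinearD(3)[OF L, of c "\<lambda>b'. x (a', b')"] by (simp add: cscale_def)
  have "K (\<lambda>a'. c * L (\<lambda>b'. x (a', b')) b) = cscale c (K (\<lambda>a'. L (\<lambda>b'. x (a', b')) b))" for b
    using clinearD(3)[OF K, of c "\<lambda>a'. L (\<lambda>b'. x (a', b')) b"] by (simp add: cscale_def)
  then show "tens K L (cscale c x) = cscale c (tens K L x)"
    by (auto simp: tens_def fun_eq_iff L' cscale_def)
qed

lemma tens_pure:
  assumes K: "clinear K" and L: "clinear L"
  shows "tens K L (pure_tensor v w) = pure_tensor (K v) (L w)"
proof -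
  have "L (\<lambda>b'. v a' * w b') = cscale (v a') (L w)" for a'
    using clinearD(3)[OF L, of "v a'" w] by (simp add: cscale_def)
  moreover have "K (\<lambda>a'. v a' * L w b) = cscale (L w b) (K v)" for b
    using clinearD(3)[OF K, of "L w b" v] by (simp add: cscale_def mult.commute)
  ultimately show ?thesis
    by (auto simp: tens_def fun_eq_iff cscale_def pure_tensor_def)
qed

definition tspace :: "('i \<Rightarrow> complex) set \<Rightarrow> ('j \<Rightarrow> complex) set \<Rightarrow> ('i \<times> 'j \<Rightarrow> complex) set" where
  "tspace V W = cfun.span {pure_tensor v w | v w. v \<in> V \<and> w \<in> W}"

lemma vecs_gmod_tensor: "vecs (gmod_tensor V W) = tspace (vecs V) (vecs W)"
  by (simp add: gmod_tensor_def tspace_def)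

lemma pure_in_tspace: "v \<in> V \<Longrightarrow> w \<in> W \<Longrightarrow> pure_tensor v w \<in> tspace V W"
  unfolding tspace_def by (rule cfun.span_base) blast

lemma tspace_eq:
  assumes "clinear F" "clinear H" "x \<in> tspace V W"
    "\<And>v w. v \<in> V \<Longrightarrow> w \<in> W \<Longrightarrow> F (pure_tensor v w) = H (pure_tensor v w)"
  shows "F x = H x"
  using clinear_eq_on_span[OF assms(1,2) assms(3)[unfolded tspace_def]] assms(4) by blast

lemma clinear_image_tspace:
  assumes F: "clinear F" and S: "cfun.subspace S" and x: "x \<in> tspace V W"
    and pure: "\<And>v w. v \<in> V \<Longrightarrow> w \<in> W \<Longrightarrow> F (pure_tensor v w) \<in> S"
  shows "F x \<in> S"
proof -
  have "F ` tspace V W = cfun.span (F ` {pure_tensor v w | v w. v \<in> V \<and> w \<in> W})"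
    unfolding tspace_def using cpair.linear_span_image[OF F] by metis
  also have "\<dots> \<subseteq> S"
    using pure by (intro cfun.span_minimal[OF _ S]) blast
  finally show ?thesis using x by blast
qed

lemma subspace_tspace: "cfun.subspace (tspace V W)"
  by (simp add: tspace_def)

lemma tens_in_tspace:
  assumes "clinear K" "clinear L" "x \<in> tspace V W"
    "\<And>v. v \<in> V \<Longrightarrow> K v \<in> V'" "\<And>w. w \<in> W \<Longrightarrow> L w \<in> W'"
  shows "tens K L x \<in> tspace V' W'"
proof (rule clinear_image_tspace[OF clinear_tens[OF assms(1,2)] subspace_tspace assms(3)])
  show "tens K L (pure_tensor v w) \<in> tspace V' W'" if "v \<in> V" "w \<in> W" for v w
    using assms(4)[OF that(1)] assms(5)[OF that(2)] by (simp add: tens_pure[OF assms(1,2)] pure_in_tspace)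
qed

text \<open>Bilinearity is used in two rounds: with the left factor fixed in \<open>A\<close> the
  right one ranges over the span of \<open>B\<close>, and afterwards the left one over the span of
  \<open>A\<close>.\<close>

lemma tspace_finite_span:
  assumes "finite A" "cfun.span A = V" "finite B" "cfun.span B = W"
  shows "tspace V W = cfun.span ((\<lambda>(a, b). pure_tensor a b) ` (A \<times> B))"
proof
  let ?S = "cfun.span ((\<lambda>(a, b). pure_tensor a b) ` (A \<times> B))"
  have lin1: "clinear (\<lambda>v. pure_tensor v w)" for w :: "'b \<Rightarrow> complex"
    by (rule clinearI) (auto simp: pure_tensor_def fun_eq_iff cscale_def algebra_simps)
  have lin2: "clinear (\<lambda>w. pure_tensor v w)" for v :: "'a \<Rightarrow> complex"
    by (rule clinearI) (auto simp: pure_tensor_def fun_eq_iff cscale_def algebra_simps)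
  have 1: "pure_tensor a w \<in> ?S" if "a \<in> A" "w \<in> W" for a w
  proof -
    have "pure_tensor a ` cfun.span B = cfun.span (pure_tensor a ` B)"
      using cpair.linear_span_image[OF lin2] by metis
    also have "\<dots> \<subseteq> ?S" using that by (intro cfun.span_mono) auto
    finally show ?thesis using that assms(4) by blast
  qed
  have "pure_tensor v w \<in> ?S" if "v \<in> V" "w \<in> W" for v w
  proof -
    have "(\<lambda>v. pure_tensor v w) ` cfun.span A = cfun.span ((\<lambda>v. pure_tensor v w) ` A)"
      using cpair.linear_span_image[OF lin1] by metis
    also have "\<dots> \<subseteq> ?S" using 1 that by (intro cfun.span_minimal) auto
    finally show ?thesis using that assms(2) by blast
  qed
  then show "tspace V W \<subseteq> ?S"
    unfolding tspace_def by (intro cfun.span_minimal) auto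
  have "A \<subseteq> V" "B \<subseteq> W" using assms(2,4) cfun.span_superset by blast+
  then show "?S \<subseteq> tspace V W"
    unfolding tspace_def by (intro cfun.span_mono) fast
qed

text \<open>The action on a tensor product is a choice among linear maps with prescribed values on
  pure tensors. \<open>tens K L\<close> shows that such a map exists, and linearity forces any two
  of them to agree on the span.\<close>

lemma act_gmod_tensor_eq:
  assumes K: "clinear K" "\<And>v. v \<in> vecs V \<Longrightarrow> K v = act V g v"
    and L: "clinear L" "\<And>w. w \<in> vecs W \<Longrightarrow> L w = act W g w"
    and x: "x \<in> tspace (vecs V) (vecs W)"
  shows "act (gmod_tensor V W) g x = tens K L x"
proof -
  let ?P = "\<lambda>M. clinear M \<and> (\<forall>v\<in>vecs V. \<forall>w\<in>vecs W.
              M (pure_tensor v w) = pure_tensor (act V g v) (act W g w))"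
  have "?P (tens K L)" using K L by (simp add: clinear_tens tens_pure)
  then have P: "?P (SOME M. ?P M)" by (rule someI[of ?P])
  have "act (gmod_tensor V W) g = (SOME M. ?P M)" by (simp add: gmod_tensor_def)
  then have A: "?P (act (gmod_tensor V W) g)" by (rule ssubst[where P = ?P]) (rule P)
  show ?thesis
    by (rule tspace_eq[OF conjunct1[OF A] clinear_tens[OF K(1) L(1)] x])
      (simp add: A tens_pure[OF K(1) L(1)] K(2) L(2))
qed

lemma act_extend:
  assumes "is_gmod G V" "g \<in> carrier G"
  shows "\<exists>K. clinear K \<and> (\<forall>v\<in>vecs V. K v = act V g v)"
proof -
  have "linear_between (vecs V) (vecs V) (act V g)" using assms by (simp add: is_gmod_def)
  then obtain K where "clinear K" "\<And>v. v \<in> vecs V \<Longrightarrow> K v = act V g v"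
    using linear_between_extend[OF _ is_gmod_subspace[OF assms(1)]] by metis
  then show ?thesis by blast
qed

lemma act_gmod_tensor:
  assumes "is_gmod G V" "is_gmod G W" "g \<in> carrier G"
  shows "\<exists>K L. clinear K \<and> (\<forall>v\<in>vecs V. K v = act V g v) \<and> clinear L \<and> (\<forall>w\<in>vecs W. L w = act W g w) \<and>
    (\<forall>x\<in>tspace (vecs V) (vecs W). act (gmod_tensor V W) g x = tens K L x)"
proof -
  obtain K where K: "clinear K" "\<forall>v\<in>vecs V. K v = act V g v"
    using act_extend[OF assms(1,3)] by blast
  obtain L where L: "clinear L" "\<forall>v\<in>vecs W. L v = act W g v"
    using act_extend[OF assms(2,3)] by blast
  have "\<forall>x\<in>tspace (vecs V) (vecs W). act (gmod_tensor V W) g x = tens K L x"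
    by (intro ballI act_gmod_tensor_eq[OF K(1) _ L(1)]) (use K(2) L(2) in auto)
  then show ?thesis using K L by blast
qed

lemma is_gmod_tensor:
  assumes V: "is_gmod G V" and W: "is_gmod G W" and G: "\<one>\<^bsub>G\<^esub> \<in> carrier G"
    "\<And>g h. g \<in> carrier G \<Longrightarrow> h \<in> carrier G \<Longrightarrow> g \<otimes>\<^bsub>G\<^esub> h \<in> carrier G"
  shows "is_gmod G (gmod_tensor V W)"
proof -
  let ?T = "tspace (vecs V) (vecs W)" and ?act = "act (gmod_tensor V W)"
  have maps: "?act g x \<in> ?T" if g: "g \<in> carrier G" and x: "x \<in> ?T" for g x
  proof -
    obtain K L where KL: "clinear K" "\<And>v. v \<in> vecs V \<Longrightarrow> K v = act V g v"
      "clinear L" "\<And>w. w \<in> vecs W \<Longrightarrow> L w = act W g w" "\<And>x. x \<in> ?T \<Longrightarrow> ?act g x = tens K L x"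
      using act_gmod_tensor[OF V W g] by blast
    have "tens K L x \<in> ?T"
      using KL(2,4) is_gmodD(5)[OF V g] is_gmodD(5)[OF W g] by (intro tens_in_tspace[OF KL(1,3) x]) auto
    then show ?thesis using KL(5) x by simp
  qed
  show ?thesis
    unfolding is_gmod_def vecs_gmod_tensor
  proof (intro conjI ballI)
    show "cfun.subspace ?T" by (rule subspace_tspace)
    obtain A B where "finite A" "cfun.span A = vecs V" "finite B" "cfun.span B = vecs W"
      using V W by (auto simp: is_gmod_def)
    then show "\<exists>B. finite B \<and> cfun.span B = ?T"
      using tspace_finite_span finite_cartesian_product finite_imageI by metis
    show "linear_between ?T ?T (?act g)" if g: "g \<in> carrier G" for g
    proof -
      obtain K L where KL: "clinear K" "\<And>v. v \<in> vecs V \<Longrightarrow> K v = act V g v"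
        "clinear L" "\<And>w. w \<in> vecs W \<Longrightarrow> L w = act W g w" "\<And>x. x \<in> ?T \<Longrightarrow> ?act g x = tens K L x"
        using act_gmod_tensor[OF V W g] by blast
      show ?thesis
        using maps[OF g] KL(5) clinearD(1,3)[OF clinear_tens[OF KL(1,3)]] subspace_tspace[of "vecs V" "vecs W"]
        by (auto simp: linear_between_def cfun.subspace_add cfun.subspace_scale)
    qed
    show "?act \<one>\<^bsub>G\<^esub> x = x" if x: "x \<in> ?T" for x
    proof -
      obtain K L where KL: "clinear K" "\<And>v. v \<in> vecs V \<Longrightarrow> K v = act V \<one>\<^bsub>G\<^esub> v"
        "clinear L" "\<And>w. w \<in> vecs W \<Longrightarrow> L w = act W \<one>\<^bsub>G\<^esub> w"
        "\<And>x. x \<in> ?T \<Longrightarrow> ?act \<one>\<^bsub>G\<^esub> x = tens K L x"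
        using act_gmod_tensor[OF V W G(1)] by blast
      have "tens K L x = x"
        using V W KL(1-4)
        by (intro tspace_eq[OF clinear_tens[OF KL(1,3)] clinear_id x]) (auto simp: tens_pure is_gmod_def)
      then show ?thesis using KL(5) x by simp
    qed
    show "?act (g \<otimes>\<^bsub>G\<^esub> h) x = ?act g (?act h x)"
      if g: "g \<in> carrier G" and h: "h \<in> carrier G" and x: "x \<in> ?T" for g h x
    proof -
      obtain K L where KL: "clinear K" "\<And>v. v \<in> vecs V \<Longrightarrow> K v = act V g v"
        "clinear L" "\<And>w. w \<in> vecs W \<Longrightarrow> L w = act W g w" "\<And>x. x \<in> ?T \<Longrightarrow> ?act g x = tens K L x"
        using act_gmod_tensor[OF V W g] by blast
      obtain K' L' where KL': "clinear K'" "\<And>v. v \<in> vecs V \<Longrightarrow> K' v = act V h v"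
        "clinear L'" "\<And>w. w \<in> vecs W \<Longrightarrow> L' w = act W h w" "\<And>x. x \<in> ?T \<Longrightarrow> ?act h x = tens K' L' x"
        using act_gmod_tensor[OF V W h] by blast
      obtain K'' L'' where KL'': "clinear K''" "\<And>v. v \<in> vecs V \<Longrightarrow> K'' v = act V (g \<otimes>\<^bsub>G\<^esub> h) v"
        "clinear L''" "\<And>w. w \<in> vecs W \<Longrightarrow> L'' w = act W (g \<otimes>\<^bsub>G\<^esub> h) w"
        "\<And>x. x \<in> ?T \<Longrightarrow> ?act (g \<otimes>\<^bsub>G\<^esub> h) x = tens K'' L'' x"
        using act_gmod_tensor[OF V W G(2)[OF g h]] by blast
      have "tens K'' L'' x = tens K L (tens K' L' x)"
      proof (rule tspace_eq[OF clinear_tens[OF KL''(1,3)] _ x])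
        show "clinear (\<lambda>x. tens K L (tens K' L' x))"
          using clinear_comp[OF clinear_tens[OF KL(1,3)] clinear_tens[OF KL'(1,3)]] .
        fix v w assume vw: "v \<in> vecs V" "w \<in> vecs W"
        have "K'' v = K (K' v)"
          using KL(2) KL'(2) KL''(2) vw V g h is_gmodD(5)[OF V h] by (simp add: is_gmod_def)
        moreover have "L'' w = L (L' w)"
          using KL(4) KL'(4) KL''(4) vw W g h is_gmodD(5)[OF W h] by (simp add: is_gmod_def)
        ultimately show "tens K'' L'' (pure_tensor v w) = tens K L (tens K' L' (pure_tensor v w))"
          by (simp add: tens_pure KL KL' KL'')
      qed
      then show ?thesis using KL(5) KL'(5) KL''(5) x maps[OF h x] by simp
    qed
  qed
qed

section \<open>Functoriality and exactness of the tensor product\<close>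

lemma gmod_hom_tens:
  assumes V: "is_gmod G V" and W: "is_gmod G W" and V': "is_gmod G V'" and W': "is_gmod G W'"
    and F: "clinear F" "gmod_hom G V V' F" and H: "clinear H" "gmod_hom G W W' H"
  shows "gmod_hom G (gmod_tensor V W) (gmod_tensor V' W') (tens F H)"
proof (rule gmod_homI; unfold vecs_gmod_tensor)
  show maps: "tens F H x \<in> tspace (vecs V') (vecs W')" if "x \<in> tspace (vecs V) (vecs W)" for x
    using tens_in_tspace[OF F(1) H(1) that] gmod_homD(1)[OF F(2)] gmod_homD(1)[OF H(2)] by blast
  show "tens F H (x + y) = tens F H x + tens F H y" for x y
    by (rule clinearD(1)[OF clinear_tens[OF F(1) H(1)]])
  show "tens F H (cscale c x) = cscale c (tens F H x)" for c x
    by (rule clinearD(3)[OF clinear_tens[OF F(1) H(1)]])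
  fix g x assume g: "g \<in> carrier G" and x: "x \<in> tspace (vecs V) (vecs W)"
  obtain K L where KL: "clinear K" "\<And>v. v \<in> vecs V \<Longrightarrow> K v = act V g v"
    "clinear L" "\<And>w. w \<in> vecs W \<Longrightarrow> L w = act W g w"
    "\<And>x. x \<in> tspace (vecs V) (vecs W) \<Longrightarrow> act (gmod_tensor V W) g x = tens K L x"
    using act_gmod_tensor[OF V W g] by blast
  obtain K' L' where KL': "clinear K'" "\<And>v. v \<in> vecs V' \<Longrightarrow> K' v = act V' g v"
    "clinear L'" "\<And>w. w \<in> vecs W' \<Longrightarrow> L' w = act W' g w"
    "\<And>x. x \<in> tspace (vecs V') (vecs W') \<Longrightarrow> act (gmod_tensor V' W') g x = tens K' L' x"
    using act_gmod_tensor[OF V' W' g] by blast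
  have "tens F H (tens K L x) = tens K' L' (tens F H x)"
  proof (rule tspace_eq[OF _ _ x])
    show "clinear (\<lambda>x. tens F H (tens K L x))" "clinear (\<lambda>x. tens K' L' (tens F H x))"
      using clinear_comp[OF clinear_tens[OF F(1) H(1)] clinear_tens[OF KL(1,3)]]
        clinear_comp[OF clinear_tens[OF KL'(1,3)] clinear_tens[OF F(1) H(1)]] .
    fix v w assume "v \<in> vecs V" "w \<in> vecs W"
    then show "tens F H (tens K L (pure_tensor v w)) = tens K' L' (tens F H (pure_tensor v w))"
      using gmod_homD(1,4)[OF F(2)] gmod_homD(1,4)[OF H(2)] g
      by (simp add: tens_pure KL KL' F(1) H(1))
  qed
  then show "tens F H (act (gmod_tensor V W) g x) = act (gmod_tensor V' W') g (tens F H x)"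
    using KL(5) KL'(5) x maps[OF x] by simp
qed

lemma gmod_hom_extend:
  assumes V: "is_gmod G V" and f: "gmod_hom G V W f"
  obtains F where "clinear F" "gmod_hom G V W F" "\<And>v. v \<in> vecs V \<Longrightarrow> F v = f v"
proof -
  obtain F where F: "clinear F" "\<And>v. v \<in> vecs V \<Longrightarrow> F v = f v"
    using linear_between_extend[OF _ is_gmod_subspace[OF V]] f unfolding gmod_hom_def by metis
  moreover have "gmod_hom G V W F"
    using F(2) gmod_homD[OF f] is_gmodD(2,4,5)[OF V] by (intro gmod_homI) auto
  ultimately show ?thesis using that by blast
qed

lemma linear_section:
  assumes V: "cfun.subspace V" and F: "clinear F" and W: "F ` V = W"
  obtains S where "clinear S" "\<And>w. S w \<in> V" "\<And>w. w \<in> W \<Longrightarrow> F (S w) = w"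
  using cpair.linear_exists_right_inverse_on[OF F V] W by (metis range_subsetD)

text \<open>For bijectivity it is enough to tensor linear inverses \<open>F'\<close> and
  \<open>H'\<close>; equivariance is required only of \<open>tens F H\<close>.\<close>

lemma gmod_tensor_iso:
  assumes V: "is_gmod G V" and W: "is_gmod G W" and V': "is_gmod G V'" and W': "is_gmod G W'"
    and isoV: "gmod_iso G V V'" and isoW: "gmod_iso G W W'"
  shows "gmod_iso G (gmod_tensor V W) (gmod_tensor V' W')"
proof -
  obtain f where f: "gmod_hom G V V' f" "inj_on f (vecs V)" "f ` vecs V = vecs V'"
    using isoV by (auto simp: gmod_iso_def bij_betw_def)
  obtain F where F: "clinear F" "gmod_hom G V V' F" "\<And>v. v \<in> vecs V \<Longrightarrow> F v = f v"
    using gmod_hom_extend[OF V f(1)] by metis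
  have FV: "F ` vecs V = vecs V'" "inj_on F (vecs V)"
    using f F(3) by (force simp: inj_on_def)+
  obtain F' where F': "clinear F'" "\<And>w. F' w \<in> vecs V" "\<And>w. w \<in> vecs V' \<Longrightarrow> F (F' w) = w"
    using linear_section[OF is_gmod_subspace[OF V] F(1) FV(1)] by metis
  have FF: "F' (F v) = v" if "v \<in> vecs V" for v
    using inj_onD[OF FV(2), of "F' (F v)" v] F'(2,3) gmod_homD(1)[OF F(2)] that by blast
  obtain h where h: "gmod_hom G W W' h" "inj_on h (vecs W)" "h ` vecs W = vecs W'"
    using isoW by (auto simp: gmod_iso_def bij_betw_def)
  obtain H where H: "clinear H" "gmod_hom G W W' H" "\<And>v. v \<in> vecs W \<Longrightarrow> H v = h v"
    using gmod_hom_extend[OF W h(1)] by metis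
  have HV: "H ` vecs W = vecs W'" "inj_on H (vecs W)"
    using h H(3) by (force simp: inj_on_def)+
  obtain H' where H': "clinear H'" "\<And>w. H' w \<in> vecs W" "\<And>w. w \<in> vecs W' \<Longrightarrow> H (H' w) = w"
    using linear_section[OF is_gmod_subspace[OF W] H(1) HV(1)] by metis
  have HH: "H' (H v) = v" if "v \<in> vecs W" for v
    using inj_onD[OF HV(2), of "H' (H v)" v] H'(2,3) gmod_homD(1)[OF H(2)] that by blast
  have hom: "gmod_hom G (gmod_tensor V W) (gmod_tensor V' W') (tens F H)"
    by (rule gmod_hom_tens[OF V W V' W' F(1,2) H(1,2)])
  have "bij_betw (tens F H) (tspace (vecs V) (vecs W)) (tspace (vecs V') (vecs W'))"
  proof (rule bij_betw_byWitness[where f' = "tens F' H'"])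
    show "\<forall>x\<in>tspace (vecs V) (vecs W). tens F' H' (tens F H x) = x"
    proof
      fix x assume x: "x \<in> tspace (vecs V) (vecs W)"
      show "tens F' H' (tens F H x) = x"
        by (rule tspace_eq[OF clinear_comp[OF clinear_tens[OF F'(1) H'(1)] clinear_tens[OF F(1) H(1)]] clinear_id x])
          (simp add: tens_pure F(1) H(1) F'(1) H'(1) FF HH)
    qed
    show "\<forall>x\<in>tspace (vecs V') (vecs W'). tens F H (tens F' H' x) = x"
    proof
      fix x assume x: "x \<in> tspace (vecs V') (vecs W')"
      show "tens F H (tens F' H' x) = x"
        by (rule tspace_eq[OF clinear_comp[OF clinear_tens[OF F(1) H(1)] clinear_tens[OF F'(1) H'(1)]] clinear_id x])
          (simp add: tens_pure F(1) H(1) F'(1) H'(1) F'(3) H'(3))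
    qed
    show "tens F H ` tspace (vecs V) (vecs W) \<subseteq> tspace (vecs V') (vecs W')"
      using gmod_homD(1)[OF hom] by (auto simp: vecs_gmod_tensor)
    show "tens F' H' ` tspace (vecs V') (vecs W') \<subseteq> tspace (vecs V) (vecs W)"
      using tens_in_tspace[OF F'(1) H'(1)] F'(2) H'(2) by blast
  qed
  with hom show ?thesis by (auto simp: gmod_iso_def vecs_gmod_tensor)
qed

text \<open>Linear splittings \<open>id = F R + S H\<close> of the sequence tensor up, which gives exactness.\<close>

lemma linear_splitting:
  assumes U: "is_gmod G U" and V: "is_gmod G V" and W: "is_gmod G W" and ex: "short_exact G U V W"
  obtains F H R S where "clinear F" "clinear H" "clinear R" "clinear S"
    "gmod_hom G U V F" "gmod_hom G V W H"
    "\<And>u. u \<in> vecs U \<Longrightarrow> R (F u) = u" "\<And>u. u \<in> vecs U \<Longrightarrow> H (F u) = 0" "\<And>w. w \<in> vecs W \<Longrightarrow> H (S w) = w"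
    "\<And>v. v \<in> vecs V \<Longrightarrow> F (R v) + S (H v) = v" "\<And>v. R v \<in> vecs U" "\<And>w. S w \<in> vecs V"
proof -
  obtain f h where fh: "gmod_hom G U V f" "gmod_hom G V W h" "inj_on f (vecs U)"
    "f ` vecs U = {v \<in> vecs V. h v = 0}" "h ` vecs V = vecs W"
    using short_exactE[OF ex] .
  obtain F where F: "clinear F" "gmod_hom G U V F" "\<And>v. v \<in> vecs U \<Longrightarrow> F v = f v"
    using gmod_hom_extend[OF U fh(1)] by metis
  obtain H where H: "clinear H" "gmod_hom G V W H" "\<And>v. v \<in> vecs V \<Longrightarrow> H v = h v"
    using gmod_hom_extend[OF V fh(2)] by metis
  have injF: "inj_on F (vecs U)" using fh(3) F(3) by (simp add: inj_on_def)
  have FU: "F ` vecs U = {v \<in> vecs V. H v = 0}" using fh(4) F(3) H(3) by (auto simp: image_iff)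
  have HV: "H ` vecs V = vecs W" using fh(5) H(3) by force
  obtain R' where R': "range R' \<subseteq> vecs U" "clinear R'" "\<And>u. u \<in> vecs U \<Longrightarrow> R' (F u) = u"
    using cpair.linear_exists_left_inverse_on[OF F(1) is_gmod_subspace[OF U] injF] by blast
  obtain S where S: "clinear S" "\<And>w. S w \<in> vecs V" "\<And>w. w \<in> vecs W \<Longrightarrow> H (S w) = w"
    using linear_section[OF is_gmod_subspace[OF V] H(1) HV] by metis
  \<comment> \<open>A left inverse \<open>R'\<close> of \<open>F\<close> and a section
    \<open>S\<close> of \<open>H\<close>, chosen independently, need not be complementary. Removing
    the part \<open>S (H v)\<close> first leaves a vector in the image of \<open>F\<close>, where
    \<open>F\<close> after \<open>R'\<close> is the identity.\<close>
  define R where "R v = R' (v - S (H v))" for v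
  have R: "clinear R"
    unfolding R_def
    using clinear_comp[OF R'(2) clinear_diff[OF clinear_id clinear_comp[OF S(1) H(1)]]] .
  have HF: "H (F u) = 0" if "u \<in> vecs U" for u using FU that by auto
  have RF: "R (F u) = u" if "u \<in> vecs U" for u
    using that by (simp add: R_def HF R'(3) clinearD(4)[OF S(1)])
  have split: "F (R v) + S (H v) = v" if v: "v \<in> vecs V" for v
  proof -
    have "H v \<in> vecs W" using gmod_homD(1)[OF H(2) v] .
    then have "v - S (H v) \<in> F ` vecs U"
      unfolding FU using v S(2,3) is_gmodD(3)[OF V] by (simp add: clinearD(2)[OF H(1)])
    then obtain u where u: "u \<in> vecs U" "v - S (H v) = F u" by blast
    then have "F (R v) = v - S (H v)" by (simp add: R_def R'(3))
    then show ?thesis by simp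
  qed
  have "R v \<in> vecs U" for v using R'(1) by (auto simp: R_def)
  then show ?thesis
    using that[OF F(1) H(1) R S(1) F(2) H(2) RF HF S(3) split _ S(2)] by blast
qed

text \<open>The equation \<open>F (R v) + S (H v) = v\<close> puts the kernel of \<open>H\<close>
  into the image of \<open>F\<close>; for this \<open>S\<close> has to send 0 to 0.\<close>

lemma short_exactI_split:
  assumes "gmod_hom G U V F" "gmod_hom G V W H" "S 0 = 0"
    "\<And>u. u \<in> vecs U \<Longrightarrow> R (F u) = u" "\<And>u. u \<in> vecs U \<Longrightarrow> H (F u) = 0" "\<And>w. w \<in> vecs W \<Longrightarrow> H (S w) = w"
    "\<And>v. v \<in> vecs V \<Longrightarrow> F (R v) + S (H v) = v" "\<And>v. v \<in> vecs V \<Longrightarrow> R v \<in> vecs U"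
    "\<And>w. w \<in> vecs W \<Longrightarrow> S w \<in> vecs V"
  shows "short_exact G U V W"
proof (rule short_exactI[OF assms(1,2)])
  show "inj_on F (vecs U)" by (rule inj_on_inverseI[of _ R]) (rule assms(4))
  show "F ` vecs U = {v \<in> vecs V. H v = 0}"
    using assms(3,5,7,8) gmod_homD(1)[OF assms(1)] by (force simp: image_iff)
  show "H ` vecs V = vecs W"
    using assms(6,9) gmod_homD(1)[OF assms(2)] by (force simp: image_iff)
qed

lemma short_exact_tensor_left:
  assumes U: "is_gmod G U" and V: "is_gmod G V" and W: "is_gmod G W" and M: "is_gmod G M"
    and ex: "short_exact G U V W"
  shows "short_exact G (gmod_tensor U M) (gmod_tensor V M) (gmod_tensor W M)"
proof -
  obtain F H R S where s: "clinear F" "clinear H" "clinear R" "clinear S"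
    "gmod_hom G U V F" "gmod_hom G V W H"
    "\<And>u. u \<in> vecs U \<Longrightarrow> R (F u) = u" "\<And>u. u \<in> vecs U \<Longrightarrow> H (F u) = 0" "\<And>w. w \<in> vecs W \<Longrightarrow> H (S w) = w"
    "\<And>v. v \<in> vecs V \<Longrightarrow> F (R v) + S (H v) = v" "\<And>v. R v \<in> vecs U" "\<And>w. S w \<in> vecs V"
    using linear_splitting[OF U V W ex] by blast
  let ?t = "\<lambda>K. tens K (\<lambda>x. x)"
  have t: "clinear (?t K)" if "clinear K" for K using clinear_tens[OF that clinear_id] .
  have id: "gmod_hom G M M (\<lambda>x. x)" by (rule gmod_homI) simp_all
  have p: "?t K (pure_tensor v w) = pure_tensor (K v) w" if "clinear K" for K v w
    using tens_pure[OF that clinear_id] .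
  have padd: "pure_tensor v w + pure_tensor v' w = pure_tensor (v + v') w" for v v' w
    by (auto simp: pure_tensor_def fun_eq_iff algebra_simps)
  have p0: "pure_tensor 0 w = 0" for w by (auto simp: pure_tensor_def fun_eq_iff)
  show ?thesis
  proof (rule short_exactI_split[where R = "?t R" and S = "?t S"]; (unfold vecs_gmod_tensor)?)
    show "gmod_hom G (gmod_tensor U M) (gmod_tensor V M) (?t F)"
      by (rule gmod_hom_tens[OF U M V M s(1,5) clinear_id id])
    show "gmod_hom G (gmod_tensor V M) (gmod_tensor W M) (?t H)"
      by (rule gmod_hom_tens[OF V M W M s(2,6) clinear_id id])
    show "?t S 0 = 0" using clinearD(4)[OF t[OF s(4)]] .
    show "?t R (?t F x) = x" if "x \<in> tspace (vecs U) (vecs M)" for x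
      by (rule tspace_eq[OF clinear_comp[OF t[OF s(3)] t[OF s(1)]] clinear_id that]) (simp_all add: p s)
    show "?t H (?t F x) = 0" if "x \<in> tspace (vecs U) (vecs M)" for x
      by (rule tspace_eq[OF clinear_comp[OF t[OF s(2)] t[OF s(1)]] cpair.linear_zero that]) (simp_all add: p s p0)
    show "?t H (?t S x) = x" if "x \<in> tspace (vecs W) (vecs M)" for x
      by (rule tspace_eq[OF clinear_comp[OF t[OF s(2)] t[OF s(4)]] clinear_id that]) (simp_all add: p s)
    show "?t F (?t R x) + ?t S (?t H x) = x" if "x \<in> tspace (vecs V) (vecs M)" for x
      by (rule tspace_eq[OF clinear_add[OF clinear_comp[OF t[OF s(1)] t[OF s(3)]] clinear_comp[OF t[OF s(4)] t[OF s(2)]]] clinear_id that])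
        (simp_all add: p s padd)
    show "?t R x \<in> tspace (vecs U) (vecs M)" if "x \<in> tspace (vecs V) (vecs M)" for x
      by (rule tens_in_tspace[OF s(3) clinear_id that]) (simp_all add: s)
    show "?t S x \<in> tspace (vecs V) (vecs M)" if "x \<in> tspace (vecs W) (vecs M)" for x
      by (rule tens_in_tspace[OF s(4) clinear_id that]) (simp_all add: s)
  qed
qed

lemma short_exact_tensor_right:
  assumes U: "is_gmod G U" and V: "is_gmod G V" and W: "is_gmod G W" and M: "is_gmod G M"
    and ex: "short_exact G U V W"
  shows "short_exact G (gmod_tensor M U) (gmod_tensor M V) (gmod_tensor M W)"
proof -
  obtain F H R S where s: "clinear F" "clinear H" "clinear R" "clinear S"
    "gmod_hom G U V F" "gmod_hom G V W H"
    "\<And>u. u \<in> vecs U \<Longrightarrow> R (F u) = u" "\<And>u. u \<in> vecs U \<Longrightarrow> H (F u) = 0" "\<And>w. w \<in> vecs W \<Longrightarrow> H (S w) = w"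
    "\<And>v. v \<in> vecs V \<Longrightarrow> F (R v) + S (H v) = v" "\<And>v. R v \<in> vecs U" "\<And>w. S w \<in> vecs V"
    using linear_splitting[OF U V W ex] by blast
  let ?t = "\<lambda>K. tens (\<lambda>x. x) K"
  have t: "clinear (?t K)" if "clinear K" for K using clinear_tens[OF clinear_id that] .
  have id: "gmod_hom G M M (\<lambda>x. x)" by (rule gmod_homI) simp_all
  have p: "?t K (pure_tensor w v) = pure_tensor w (K v)" if "clinear K" for K v w
    using tens_pure[OF clinear_id that] .
  have padd: "pure_tensor w v + pure_tensor w v' = pure_tensor w (v + v')" for v v' w
    by (auto simp: pure_tensor_def fun_eq_iff algebra_simps)
  have p0: "pure_tensor w 0 = 0" for w by (auto simp: pure_tensor_def fun_eq_iff)
  show ?thesis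
  proof (rule short_exactI_split[where R = "?t R" and S = "?t S"]; (unfold vecs_gmod_tensor)?)
    show "gmod_hom G (gmod_tensor M U) (gmod_tensor M V) (?t F)"
      by (rule gmod_hom_tens[OF M U M V clinear_id id s(1,5)])
    show "gmod_hom G (gmod_tensor M V) (gmod_tensor M W) (?t H)"
      by (rule gmod_hom_tens[OF M V M W clinear_id id s(2,6)])
    show "?t S 0 = 0" using clinearD(4)[OF t[OF s(4)]] .
    show "?t R (?t F x) = x" if "x \<in> tspace (vecs M) (vecs U)" for x
      by (rule tspace_eq[OF clinear_comp[OF t[OF s(3)] t[OF s(1)]] clinear_id that]) (simp_all add: p s)
    show "?t H (?t F x) = 0" if "x \<in> tspace (vecs M) (vecs U)" for x
      by (rule tspace_eq[OF clinear_comp[OF t[OF s(2)] t[OF s(1)]] cpair.linear_zero that]) (simp_all add: p s p0)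
    show "?t H (?t S x) = x" if "x \<in> tspace (vecs M) (vecs W)" for x
      by (rule tspace_eq[OF clinear_comp[OF t[OF s(2)] t[OF s(4)]] clinear_id that]) (simp_all add: p s)
    show "?t F (?t R x) + ?t S (?t H x) = x" if "x \<in> tspace (vecs M) (vecs V)" for x
      by (rule tspace_eq[OF clinear_add[OF clinear_comp[OF t[OF s(1)] t[OF s(3)]] clinear_comp[OF t[OF s(4)] t[OF s(2)]]] clinear_id that])
        (simp_all add: p s padd)
    show "?t R x \<in> tspace (vecs M) (vecs U)" if "x \<in> tspace (vecs M) (vecs V)" for x
      by (rule tens_in_tspace[OF clinear_id s(3) that]) (simp_all add: s)
    show "?t S x \<in> tspace (vecs M) (vecs V)" if "x \<in> tspace (vecs M) (vecs W)" for x
      by (rule tens_in_tspace[OF clinear_id s(4) that]) (simp_all add: s)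
  qed
qed

section \<open>Multiplicativity of classes\<close>

lemma tspace_zero: "tspace {0} W = {0}" "tspace V {0} = {0}"
proof -
  have *: "{pure_tensor v w | v w. v \<in> {0} \<and> w \<in> W} \<subseteq> {0}" "{pure_tensor v w | v w. v \<in> V \<and> w \<in> {0}} \<subseteq> {0}"
    by (auto simp: pure_tensor_def fun_eq_iff)
  have "tspace {0} W \<subseteq> {0}" "tspace V {0} \<subseteq> {0}"
    unfolding tspace_def
    using cfun.span_minimal[OF *(1) cfun.subspace_single_0] cfun.span_minimal[OF *(2) cfun.subspace_single_0] .
  then show "tspace {0} W = {0}" "tspace V {0} = {0}"
    using cfun.subspace_0[OF subspace_tspace] by blast+
qed

text \<open>The ring product is the biadditive extension from generators, so a double induction
  applies: \<open>irr\<close> keeps an irreducible left factor and follows the derivation of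
  \<open>y\<close>, then the derivation of \<open>x\<close> is followed with \<open>W\<close> fixed.
  Exact steps use exactness of the tensor product in either variable; for two irreducible modules,
  the representatives in the definition of the product are isomorphic to the given modules.\<close>

lemma has_class_tensor:
  assumes G: "\<one>\<^bsub>G\<^esub> \<in> carrier G" "\<And>g h. g \<in> carrier G \<Longrightarrow> h \<in> carrier G \<Longrightarrow> g \<otimes>\<^bsub>G\<^esub> h \<in> carrier G"
    and x: "has_class G V x" and y: "has_class G W y"
  shows "has_class G (gmod_tensor V W) (x \<otimes>\<^bsub>groth_ring G\<^esub> y)"
proof -
  let ?m = "\<lambda>p q. groth_class G (gmod_tensor (class_rep p) (class_rep q))"
  have W: "is_gmod G W" using has_class_is_gmod[OF y] .
  have irr: "has_class G (gmod_tensor V W) (frag_extend (?m (iso_class G V)) y)"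
    if V: "irreducible_gmod G V" and y: "has_class G W y" for V W y
    using y
  proof (induction rule: has_class.induct)
    case (zero W)
    have gV: "is_gmod G V" using V by (simp add: irreducible_gmod_def)
    show ?case
      using is_gmod_tensor[OF gV zero(1) G] zero is_gmodD(1)[OF gV]
      by (auto intro!: has_class.zero simp: vecs_gmod_tensor tspace_zero)
  next
    case (irreducible W)
    have gV: "is_gmod G V" and gW: "is_gmod G W"
      using V irreducible by (simp_all add: irreducible_gmod_def)
    note rV = class_rep_iso_class[OF gV] and rW = class_rep_iso_class[OF gW]
    have "groth_class G (gmod_tensor V W) = ?m (iso_class G V) (iso_class G W)"
      using groth_class_iso gmod_tensor_iso[OF gV gW rV(1) rW(1) rV(2) rW(2)]
        is_gmod_tensor[OF gV gW G] is_gmod_tensor[OF rV(1) rW(1) G] by blast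
    then show ?case using has_class_groth_class[OF is_gmod_tensor[OF gV gW G]] by simp
  next
    case (exact W A B a b)
    have gV: "is_gmod G V" using V by (simp add: irreducible_gmod_def)
    have AB: "is_gmod G A" "is_gmod G B" using exact has_class_is_gmod by blast+
    show ?case
      unfolding frag_extend_add
      using has_class.exact[OF is_gmod_tensor[OF gV exact(1) G]
          short_exact_tensor_right[OF AB(1) exact(1) AB(2) gV exact(2)] exact.IH] .
  qed
  have "has_class G (gmod_tensor V W) (frag_extend (\<lambda>p. frag_extend (?m p) y) x)"
    using x
  proof (induction rule: has_class.induct)
    case (zero V)
    then show ?case
      using is_gmod_tensor[OF zero(1) W G] is_gmodD(1)[OF W]
      by (auto intro!: has_class.zero simp: vecs_gmod_tensor tspace_zero)
  next
    case (irreducible V)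
    then show ?case using irr[OF _ y] by simp
  next
    case (exact V A B a b)
    have AB: "is_gmod G A" "is_gmod G B" using exact has_class_is_gmod by blast+
    show ?case
      unfolding frag_extend_add
      using has_class.exact[OF is_gmod_tensor[OF exact(1) W G]
          short_exact_tensor_left[OF AB(1) exact(1) AB(2) W exact(2)] exact.IH] .
  qed
  then show ?thesis by (simp add: groth_ring_def)
qed

lemma groth_class_tensor:
  assumes "Group.monoid G" "is_gmod G V" "is_gmod G W"
  shows "groth_class G (gmod_tensor V W) = groth_class G V \<otimes>\<^bsub>groth_ring G\<^esub> groth_class G W"
  using has_class_tensor[OF _ _ has_class_groth_class[OF assms(2)] has_class_groth_class[OF assms(3)]]
    Group.monoid.one_closed[OF assms(1)] Group.monoid.m_closed[OF assms(1)] groth_class_eqI by blast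

subsection \<open>Generators acting on the exterior algebra\<close>

text \<open>The sign for sorting \<open>a\<close> into its place when it stands in front of the
  generators in \<open>C\<close>. As \<open>a\<close> is not smaller than itself, it does not matter
  whether \<open>C\<close> contains it.\<close>

definition sgn_at :: "'x::linorder \<Rightarrow> 'x set \<Rightarrow> complex" where
  "sgn_at a C = (-1) ^ card {b \<in> C. b < a}"

text \<open>Left multiplication by the generator \<open>a\<close>. Finiteness of \<open>C\<close> is
  demanded because \<open>ext_mult\<close> sums over \<open>Pow C\<close>, which gives 0 at an
  infinite \<open>C\<close>.\<close>

definition ext_left :: "'x::linorder \<Rightarrow> ('x set \<Rightarrow> complex) \<Rightarrow> 'x set \<Rightarrow> complex" where
  "ext_left a f = (\<lambda>C. if finite C \<and> a \<in> C then sgn_at a C * f (C - {a}) else 0)"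

text \<open>The interior product with the functional dual to the generator \<open>a\<close>.\<close>

definition ext_contr :: "'x::linorder \<Rightarrow> ('x set \<Rightarrow> complex) \<Rightarrow> 'x set \<Rightarrow> complex" where
  "ext_contr a f = (\<lambda>C. if finite C \<and> a \<notin> C then sgn_at a C * f (insert a C) else 0)"

definition ext_basis :: "'x set \<Rightarrow> 'x set \<Rightarrow> complex" where
  "ext_basis A = (\<lambda>C. if C = A then 1 else 0)"

lemma clinear_ext_left: "clinear (ext_left a)"
  by (rule clinearI) (auto simp: ext_left_def cscale_def fun_eq_iff algebra_simps)

lemma clinear_ext_contr: "clinear (ext_contr a)"
  by (rule clinearI) (auto simp: ext_contr_def cscale_def fun_eq_iff algebra_simps)

lemma sgn_at_insert:
  assumes "finite C" "b \<notin> C"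
  shows "sgn_at a (insert b C) = (if b < a then - sgn_at a C else sgn_at a C)"
proof (cases "b < a")
  case True
  then have "{x \<in> insert b C. x < a} = insert b {x \<in> C. x < a}" by auto
  then show ?thesis using assms True by (simp add: sgn_at_def)
next
  case False
  then have "{x \<in> insert b C. x < a} = {x \<in> C. x < a}" by auto
  then show ?thesis using False by (simp add: sgn_at_def)
qed

lemma sgn_at_remove:
  assumes "finite C" "b \<in> C"
  shows "sgn_at a (C - {b}) = (if b < a then - sgn_at a C else sgn_at a C)"
  using sgn_at_insert[of "C - {b}" b a] assms by (auto simp: insert_absorb split: if_splits)

lemma sgn_at_square: "sgn_at a C * (sgn_at a C * x) = x"
  by (simp add: sgn_at_def mult.assoc[symmetric] power_add[symmetric])

lemma ext_mult_gen: "ext_mult (ext_gen a) f = ext_left a f"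
proof
  fix C
  show "ext_mult (ext_gen a) f C = ext_left a f C"
  proof (cases "finite C")
    case True
    have "ext_mult (ext_gen a) f C
        = (\<Sum>A\<in>Pow C. if A = {a} then ext_sign {a} (C - {a}) * f (C - {a}) else 0)"
      unfolding ext_mult_def ext_gen_def by (intro sum.cong) auto
    also have "\<dots> = (if a \<in> C then ext_sign {a} (C - {a}) * f (C - {a}) else 0)"
      using True by (simp add: sum.delta)
    also have "ext_sign {a} (C - {a}) = sgn_at a C"
    proof -
      have "{(x, b). x \<in> {a} \<and> b \<in> C - {a} \<and> b < x} = Pair a ` {b \<in> C. b < a}" by auto
      then show ?thesis by (simp add: ext_sign_def sgn_at_def card_image inj_on_def)
    qed
    finally show ?thesis using True by (simp add: ext_left_def)
  qed (simp add: ext_mult_def ext_left_def)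
qed

lemma sgn_at_min:
  assumes "\<And>c. c \<in> C \<Longrightarrow> a \<le> c"
  shows "sgn_at a C = 1"
proof -
  have "{c \<in> C. c < a} = {}" using assms by (auto simp: not_less[symmetric])
  then show ?thesis unfolding sgn_at_def by (simp only: card.empty power_0)
qed

lemma ext_left_zero [simp]: "ext_left a (\<lambda>C. 0) = 0" "ext_left a 0 = 0"
  by (auto simp: ext_left_def fun_eq_iff)

lemma ext_left_left: "ext_left a (ext_left b f) = - ext_left b (ext_left a f)"
proof
  fix C
  show "ext_left a (ext_left b f) C = (- ext_left b (ext_left a f)) C"
  proof (cases "finite C \<and> a \<in> C \<and> b \<in> C \<and> a \<noteq> b")
    case True
    then have C: "finite C" "a \<in> C" "b \<in> C" "a \<in> C - {b}" "b \<in> C - {a}" by auto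
    have D: "C - {a} - {b} = C - {b} - {a}" by blast
    have "a \<noteq> b" using True by simp
    then have "a < b \<and> \<not> b < a \<or> b < a \<and> \<not> a < b" by auto
    \<comment> \<open>Removing one letter affects the sign of the other only if the removed letter
      is the smaller one, so exactly one of the two products changes its sign.\<close>
    then have "sgn_at a C * sgn_at b (C - {a}) = - (sgn_at b C * sgn_at a (C - {b}))"
      using C by (auto simp: sgn_at_remove)
    then have "sgn_at a C * sgn_at b (C - {a}) * f (C - {b} - {a})
        = - (sgn_at b C * sgn_at a (C - {b}) * f (C - {b} - {a}))"
      by simp
    moreover have "ext_left a (ext_left b f) C = sgn_at a C * sgn_at b (C - {a}) * f (C - {b} - {a})"
      unfolding ext_left_def using C by (simp add: D)
    moreover have "ext_left b (ext_left a f) C = sgn_at b C * sgn_at a (C - {b}) * f (C - {b} - {a})"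
      unfolding ext_left_def using C by simp
    ultimately show ?thesis by simp
  next
    case False
    then show ?thesis by (auto simp: ext_left_def)
  qed
qed

lemma ext_left_same [simp]: "ext_left a (ext_left a f) = 0"
  by (auto simp: ext_left_def fun_eq_iff)

text \<open>The canonical anticommutation relation of creation and annihilation operators. Both
  operators produce 0 at infinite sets, while \<open>f\<close> itself occurs on the right, so the
  support of \<open>f\<close> has to consist of finite sets.\<close>

lemma ext_contr_left:
  "ext_contr b (ext_left a f) = (if a = b then f else 0) - ext_left a (ext_contr b f)"
  if "\<And>C. f C \<noteq> 0 \<Longrightarrow> finite C"
proof
  fix C
  show "ext_contr b (ext_left a f) C = ((if a = b then f else 0) - ext_left a (ext_contr b f)) C"
  proof (cases "finite C")
    case True
    show ?thesis
    proof (cases "a = b")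
      case eq: True
      show ?thesis
      proof (cases "b \<in> C")
        case True
        then have "insert b (C - {b}) = C" by auto
        then show ?thesis
          using True \<open>finite C\<close> eq
          by (simp add: ext_left_def ext_contr_def sgn_at_remove sgn_at_square)
      next
        case False
        then have "insert b C - {b} = C" by auto
        then show ?thesis
          using False \<open>finite C\<close> eq
          by (simp add: ext_left_def ext_contr_def sgn_at_insert sgn_at_square)
      qed
    next
      case neq: False
      then have "insert b C - {a} = insert b (C - {a})" by auto
      moreover have "a < b \<and> \<not> b < a \<or> b < a \<and> \<not> a < b" using neq by auto
      ultimately show ?thesis
        using neq \<open>finite C\<close>
        by (auto simp: ext_left_def ext_contr_def sgn_at_insert sgn_at_remove)
    qed
  next
    case False
    then show ?thesis using that[of C] by (auto simp: ext_left_def ext_contr_def)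
  qed
qed

lemma ext_alg_finite: "finite X \<Longrightarrow> f \<in> ext_alg X \<Longrightarrow> f C \<noteq> 0 \<Longrightarrow> finite C"
  by (rule finite_subset[of C X]) (simp_all add: ext_alg_def)

lemma subspace_ext_alg: "cfun.subspace (ext_alg X)"
proof -
  have "ext_alg X = {f. \<forall>A. \<not> A \<subseteq> X \<longrightarrow> f A = 0}" by (auto simp: ext_alg_def)
  moreover have "cfun.subspace {f :: 'a set \<Rightarrow> complex. \<forall>A. \<not> A \<subseteq> X \<longrightarrow> f A = 0}"
    by (rule cfun.subspaceI) (simp_all add: cscale_def)
  ultimately show ?thesis by simp
qed

lemma ext_left_in_ext_alg: "a \<in> X \<Longrightarrow> f \<in> ext_alg X \<Longrightarrow> ext_left a f \<in> ext_alg X"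
  unfolding ext_alg_def ext_left_def by (auto split: if_splits)

lemma ext_contr_in_ext_alg: "f \<in> ext_alg X \<Longrightarrow> ext_contr a f \<in> ext_alg X"
  unfolding ext_alg_def ext_contr_def by (auto split: if_splits)

lemma ext_one_basis: "ext_one = ext_basis {}"
  by (simp add: ext_one_def ext_basis_def)

lemma ext_basis_in_ext_alg: "A \<subseteq> X \<Longrightarrow> ext_basis A \<in> ext_alg X"
  by (simp add: ext_alg_def ext_basis_def)

lemma ext_one_in_ext_alg: "ext_one \<in> ext_alg X"
  by (simp add: ext_one_basis ext_basis_in_ext_alg)

section \<open>Monomials and induction over the exterior algebra\<close>

lemma ext_alg_expand:
  assumes "finite X" "f \<in> ext_alg X"
  shows "f = (\<Sum>A\<in>Pow X. cscale (f A) (ext_basis A))"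
proof
  fix C
  have "(\<Sum>A\<in>Pow X. cscale (f A) (ext_basis A)) C = (\<Sum>A\<in>Pow X. if C = A then f A else 0)"
    unfolding fun_sum_apply by (intro sum.cong) (auto simp: cscale_def ext_basis_def)
  also have "\<dots> = (if C \<in> Pow X then f C else 0)"
    using assms(1) by (simp add: sum.delta')
  also have "\<dots> = f C" using assms(2) by (auto simp: ext_alg_def)
  finally show "f C = (\<Sum>A\<in>Pow X. cscale (f A) (ext_basis A)) C" by simp
qed

lemma ext_left_basis_min:
  assumes "finite A" "\<forall>a\<in>A. b < a"
  shows "ext_left b (ext_basis A) = ext_basis (insert b A)"
proof
  fix C
  have "sgn_at b (insert b A) = 1" using assms(2) by (intro sgn_at_min) auto
  moreover have "C - {b} = A \<and> b \<in> C \<longleftrightarrow> C = insert b A" using assms(2) by blast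
  ultimately show "ext_left b (ext_basis A) C = ext_basis (insert b A) C"
    using assms(1) unfolding ext_left_def ext_basis_def by (cases "C = insert b A") auto
qed

text \<open>A monomial is built up from its largest generator downwards: each new generator is
  smaller than those present and is put in front without a sign.\<close>

lemma ext_basis_induct:
  assumes "finite X" "A \<subseteq> X" "P ext_one"
    "\<And>b A. insert b A \<subseteq> X \<Longrightarrow> \<forall>a\<in>A. b < a \<Longrightarrow> P (ext_basis A) \<Longrightarrow> P (ext_left b (ext_basis A))"
  shows "P (ext_basis (A :: 'x::linorder set))"
proof -
  have "finite A" using assms(1,2) finite_subset by blast
  then show ?thesis
    using assms(2)
  proof (induction rule: finite_linorder_min_induct)
    case empty
    then show ?case using assms(3) by (simp add: ext_one_basis)
  next
    case (insert b A)
    then show ?case using assms(4)[of b A] by (simp add: ext_left_basis_min)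
  qed
qed

lemma ext_alg_induct:
  assumes X: "finite X" and S: "cfun.subspace S" and f: "f \<in> ext_alg (X :: 'x::linorder set)"
    and one: "ext_one \<in> S"
    and left: "\<And>a f. a \<in> X \<Longrightarrow> f \<in> ext_alg X \<Longrightarrow> f \<in> S \<Longrightarrow> ext_left a f \<in> S"
  shows "f \<in> S"
proof -
  have "ext_basis A \<in> S" if "A \<subseteq> X" for A
    using ext_basis_induct[OF X that, of "\<lambda>f. f \<in> S"] one left ext_basis_in_ext_alg by (metis insert_subset)
  then have "(\<Sum>A\<in>Pow X. cscale (f A) (ext_basis A)) \<in> S"
    by (intro cfun.subspace_sum[OF S] cfun.subspace_scale[OF S]) auto
  then show ?thesis using ext_alg_expand[OF X f] by simp
qed

text \<open>The set where two linear maps agree is a subspace, so \<open>ext_alg_induct\<close>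
  applies. Functoriality of \<open>ext_perm\<close> and the commutation relations of all operators
  below are obtained from this principle.\<close>

lemma ext_alg_eqI:
  assumes X: "finite X" and f: "f \<in> ext_alg (X :: 'x::linorder set)"
    and F: "clinear F" and H: "clinear H" and one: "F ext_one = H ext_one"
    and left: "\<And>a f. a \<in> X \<Longrightarrow> f \<in> ext_alg X \<Longrightarrow> F f = H f \<Longrightarrow> F (ext_left a f) = H (ext_left a f)"
  shows "F f = H f"
proof -
  have "cfun.subspace {f. F f = H f}"
    by (rule cfun.subspaceI) (auto simp: clinearD[OF F] clinearD[OF H])
  then have "f \<in> {f. F f = H f}"
    by (rule ext_alg_induct[OF X _ f]) (use one left in auto)
  then show ?thesis by simp
qed

subsection \<open>Automorphisms induced by permutations of the generators\<close>

text \<open>The image of the monomial x_A under the substitution \<sigma>. The letters follow the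
  order of \<open>A\<close>, not that of their images, so the word may differ from a monomial by a
  sign.\<close>

definition ext_word :: "('x::linorder \<Rightarrow> 'x) \<Rightarrow> 'x set \<Rightarrow> 'x set \<Rightarrow> complex" where
  "ext_word \<sigma> A = foldr (\<lambda>a. ext_left (\<sigma> a)) (sorted_list_of_set A) ext_one"

lemma ext_perm_altdef: "ext_perm X \<sigma> f = (\<Sum>A\<in>Pow X. cscale (f A) (ext_word \<sigma> A))"
proof -
  have "foldr ext_mult (map (\<lambda>a. ext_gen (\<sigma> a)) xs) ext_one = foldr (\<lambda>a. ext_left (\<sigma> a)) xs ext_one" for xs
    by (induction xs) (auto simp: ext_mult_gen)
  then show ?thesis by (simp add: ext_perm_def ext_word_def)
qed

lemma clinear_ext_perm: "clinear (ext_perm X \<sigma>)"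
  by (rule clinearI)
    (auto simp: ext_perm_altdef cfun.scale_left_distrib sum.distrib cfun.scale_sum_right cscale_def[of _ "_ :: 'a set \<Rightarrow> complex"] mult.assoc fun_eq_iff fun_sum_apply sum_distrib_left distrib_right)

lemma ext_perm_basis:
  assumes "finite X" "A \<subseteq> X"
  shows "ext_perm X \<sigma> (ext_basis A) = ext_word \<sigma> A"
proof -
  have "ext_perm X \<sigma> (ext_basis A) = (\<Sum>B\<in>Pow X. if B = A then ext_word \<sigma> B else 0)"
    unfolding ext_perm_altdef by (intro sum.cong) (auto simp: ext_basis_def cscale_def fun_eq_iff)
  then show ?thesis using assms by (simp add: sum.delta)
qed

lemma ext_word_insert_min:
  assumes "finite A" "\<forall>a\<in>A. b < a"
  shows "ext_word \<sigma> (insert b A) = ext_left (\<sigma> b) (ext_word \<sigma> A)"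
proof -
  have "b \<notin> A" using assms(2) by auto
  then have "sorted_list_of_set (insert b A) = insort b (sorted_list_of_set A)"
    using assms(1) by simp
  also have "\<dots> = b # sorted_list_of_set A"
    using assms by (intro insort_is_Cons) (auto intro: less_imp_le)
  finally show ?thesis by (simp add: ext_word_def)
qed

text \<open>Moving \<open>\<sigma> a\<close> to its place in the word costs one sign for each smaller letter.\<close>

lemma ext_left_word:
  assumes "finite A"
  shows "ext_left (\<sigma> a) (ext_word \<sigma> A) = (if a \<in> A then 0 else cscale (sgn_at a A) (ext_word \<sigma> (insert a A)))"
  using assms
proof (induction arbitrary: a rule: finite_linorder_min_induct)
  case empty
  then show ?case by (simp add: sgn_at_def ext_word_insert_min)
next
  case (insert b A)
  have w: "ext_word \<sigma> (insert b A) = ext_left (\<sigma> b) (ext_word \<sigma> A)"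
    using insert by (intro ext_word_insert_min) auto
  consider "a < b" | "a = b" | "b < a" by fastforce
  then show ?case
  proof cases
    case 1
    then have "\<forall>x\<in>insert b A. a < x" using insert(2) by auto
    moreover from this have "sgn_at a (insert b A) = 1" "a \<notin> insert b A"
      by (auto intro!: sgn_at_min less_imp_le)
    ultimately show ?thesis
      using insert(1) ext_word_insert_min[of "insert b A" a \<sigma>] by (simp del: sorted_list_of_set_insert_remove)
  next
    case 2
    then show ?thesis by (simp add: w)
  next
    case 3
    have "b \<notin> A" using insert(2) by auto
    have "ext_left (\<sigma> a) (ext_word \<sigma> (insert b A)) = - ext_left (\<sigma> b) (ext_left (\<sigma> a) (ext_word \<sigma> A))"
      unfolding w by (rule ext_left_left)
    also have "\<dots> = (if a \<in> A then 0 else cscale (- sgn_at a A) (ext_left (\<sigma> b) (ext_word \<sigma> (insert a A))))"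
      using insert(3) by (simp add: clinearD[OF clinear_ext_left])
    also have "ext_left (\<sigma> b) (ext_word \<sigma> (insert a A)) = ext_word \<sigma> (insert b (insert a A))"
      using insert 3 by (intro ext_word_insert_min[symmetric]) auto
    also have "- sgn_at a A = sgn_at a (insert b A)"
      using sgn_at_insert[OF insert(1) \<open>b \<notin> A\<close>] 3 by simp
    finally show ?thesis using 3 by (auto simp: insert_commute)
  qed
qed

lemma ext_left_basis:
  assumes "finite A"
  shows "ext_left a (ext_basis A) = (if a \<in> A then 0 else cscale (sgn_at a A) (ext_basis (insert a A)))"
proof -
  have "sgn_at a (insert a A) = sgn_at a A" if "a \<notin> A" using sgn_at_insert[OF assms that] by simp
  moreover have "C = insert a A" if "C - {a} = A" "a \<in> C" for C using that by auto
  ultimately show ?thesis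
    using assms by (auto simp: ext_left_def ext_basis_def fun_eq_iff cscale_def)
qed

lemma ext_perm_one: "finite X \<Longrightarrow> ext_perm X \<sigma> ext_one = ext_one"
  unfolding ext_one_basis by (subst ext_perm_basis) (auto simp: ext_word_def ext_one_basis)

text \<open>On a monomial, inserting \<open>a\<close> costs the same sign before and after the
  substitution, by \<open>ext_left_basis\<close> and \<open>ext_left_word\<close>. This is
  multiplicativity of \<open>ext_perm\<close> for a generator on the left, the form used
  below.\<close>

lemma ext_perm_left:
  assumes X: "finite X" and a: "a \<in> X" and f: "f \<in> ext_alg X"
  shows "ext_perm X \<sigma> (ext_left a f) = ext_left (\<sigma> a) (ext_perm X \<sigma> f)"
proof -
  have basis: "ext_perm X \<sigma> (ext_left a (ext_basis A)) = ext_left (\<sigma> a) (ext_perm X \<sigma> (ext_basis A))"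
    if A: "A \<subseteq> X" for A
  proof -
    have fA: "finite A" using A X finite_subset by blast
    show ?thesis
      using a A by (simp add: ext_left_basis[OF fA] ext_perm_basis[OF X] ext_left_word[OF fA] clinearD[OF clinear_ext_perm])
  qed
  have "ext_perm X \<sigma> (ext_left a f)
      = (\<Sum>A\<in>Pow X. cscale (f A) (ext_perm X \<sigma> (ext_left a (ext_basis A))))"
    by (subst ext_alg_expand[OF X f])
      (simp add: clinear_sum[OF clinear_ext_left] clinear_sum[OF clinear_ext_perm]
        clinearD(3)[OF clinear_ext_left] clinearD(3)[OF clinear_ext_perm])
  also have "\<dots> = (\<Sum>A\<in>Pow X. cscale (f A) (ext_left (\<sigma> a) (ext_perm X \<sigma> (ext_basis A))))"
    using basis by (intro sum.cong) auto
  also have "\<dots> = ext_left (\<sigma> a) (ext_perm X \<sigma> f)"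
    by (subst (2) ext_alg_expand[OF X f])
      (simp add: clinear_sum[OF clinear_ext_left] clinear_sum[OF clinear_ext_perm]
        clinearD(3)[OF clinear_ext_left] clinearD(3)[OF clinear_ext_perm])
  finally show ?thesis .
qed

lemma ext_perm_in_ext_alg:
  assumes X: "finite X" and \<sigma>: "\<sigma> ` X \<subseteq> X" and f: "f \<in> ext_alg X"
  shows "ext_perm X \<sigma> f \<in> ext_alg X"
proof -
  have "cfun.subspace {f. ext_perm X \<sigma> f \<in> ext_alg X}"
    using subspace_ext_alg[of X]
    by (intro cfun.subspaceI)
      (auto simp: clinearD[OF clinear_ext_perm] cfun.subspace_0 cfun.subspace_add cfun.subspace_scale)
  then have "f \<in> {f. ext_perm X \<sigma> f \<in> ext_alg X}"
    by (rule ext_alg_induct[OF X _ f])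
      (use \<sigma> in \<open>auto simp: ext_perm_one[OF X] ext_one_in_ext_alg ext_perm_left[OF X] intro!: ext_left_in_ext_alg\<close>)
  then show ?thesis by simp
qed

lemma ext_perm_id:
  assumes "finite X" "\<And>x. x \<in> X \<Longrightarrow> \<sigma> x = x" "f \<in> ext_alg X"
  shows "ext_perm X \<sigma> f = f"
  by (rule ext_alg_eqI[OF assms(1,3) clinear_ext_perm clinear_id])
    (simp_all add: ext_perm_one ext_perm_left assms)

lemma ext_perm_comp:
  assumes "finite X" "\<And>x. x \<in> X \<Longrightarrow> \<rho> x = \<sigma> (\<tau> x)" "\<tau> ` X \<subseteq> X" "f \<in> ext_alg X"
  shows "ext_perm X \<rho> f = ext_perm X \<sigma> (ext_perm X \<tau> f)"
  by (rule ext_alg_eqI[OF assms(1,4) clinear_ext_perm clinear_comp[OF clinear_ext_perm clinear_ext_perm]])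
    (use assms in \<open>simp_all add: ext_perm_one ext_perm_left ext_perm_in_ext_alg image_subset_iff\<close>)

subsection \<open>Gradings\<close>

text \<open>The number of generators from \<open>Y\<close>, as a derivation whose eigenspaces are the graded parts.\<close>

definition ext_number :: "'x set \<Rightarrow> ('x set \<Rightarrow> complex) \<Rightarrow> 'x set \<Rightarrow> complex" where
  "ext_number Y f = (\<lambda>C. of_nat (card (C \<inter> Y)) * f C)"

lemma clinear_ext_number: "clinear (ext_number Y)"
  by (rule clinearI) (auto simp: ext_number_def cscale_def fun_eq_iff algebra_simps)

lemma ext_number_one: "ext_number Y ext_one = 0"
  by (auto simp: ext_number_def ext_one_def fun_eq_iff)

lemma ext_number_left:
  "ext_number Y (ext_left a f) = ext_left a (ext_number Y f) + (if a \<in> Y then ext_left a f else 0)"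
proof
  fix C
  have "card (C \<inter> Y) = card ((C - {a}) \<inter> Y) + (if a \<in> Y then 1 else 0)" if "finite C" "a \<in> C"
  proof (cases "a \<in> Y")
    case True
    then have "C \<inter> Y = insert a ((C - {a}) \<inter> Y)" using that by auto
    then show ?thesis using that True by simp
  next
    case False
    then have "C \<inter> Y = (C - {a}) \<inter> Y" by auto
    then show ?thesis using False by simp
  qed
  then show "ext_number Y (ext_left a f) C = (ext_left a (ext_number Y f) + (if a \<in> Y then ext_left a f else 0)) C"
    by (auto simp: ext_number_def ext_left_def algebra_simps)
qed

lemma ext_number_in_ext_alg: "f \<in> ext_alg X \<Longrightarrow> ext_number Y f \<in> ext_alg X"
  by (auto simp: ext_alg_def ext_number_def)

lemma ext_number_eigen_iff:
  "ext_number Y f = cscale (of_int m) f \<longleftrightarrow> (\<forall>C. f C \<noteq> 0 \<longrightarrow> int (card (C \<inter> Y)) = m)"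
proof -
  have "of_nat (card (C \<inter> Y)) * f C = of_int m * f C \<longleftrightarrow> (f C \<noteq> 0 \<longrightarrow> int (card (C \<inter> Y)) = m)" for C
    by (metis mult_cancel_right of_int_eq_iff of_int_of_nat_eq)
  then show ?thesis by (simp add: ext_number_def cscale_def fun_eq_iff)
qed

text \<open>Graded parts are eigenspaces of \<open>ext_number\<close>, so commuting with it means
  preserving the grading.\<close>

lemma ext_number_perm:
  assumes X: "finite X" and Y: "\<And>a. a \<in> X \<Longrightarrow> \<sigma> a \<in> Y \<longleftrightarrow> a \<in> Y" and f: "f \<in> ext_alg X"
  shows "ext_number Y (ext_perm X \<sigma> f) = ext_perm X \<sigma> (ext_number Y f)"
proof (rule ext_alg_eqI[OF X f clinear_comp[OF clinear_ext_number clinear_ext_perm]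
      clinear_comp[OF clinear_ext_perm clinear_ext_number]])
  show "ext_number Y (ext_perm X \<sigma> ext_one) = ext_perm X \<sigma> (ext_number Y ext_one)"
    by (simp add: ext_perm_one[OF X] ext_number_one clinearD(4)[OF clinear_ext_perm])
  show "ext_number Y (ext_perm X \<sigma> (ext_left a f)) = ext_perm X \<sigma> (ext_number Y (ext_left a f))"
    if "a \<in> X" "f \<in> ext_alg X" "ext_number Y (ext_perm X \<sigma> f) = ext_perm X \<sigma> (ext_number Y f)" for a f
    using that Y[OF that(1)]
    by (simp add: ext_number_left ext_perm_left[OF X] clinearD[OF clinear_ext_perm] ext_number_in_ext_alg)
qed

text \<open>Serves both the bigraded parts of the algebra and the exterior powers; \<sigma> is the
  action of the group on the generators.\<close>

lemma is_gmod_ext_perm: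
  assumes X: "finite X" and U: "cfun.subspace U" "U \<subseteq> ext_alg X"
    and maps: "\<And>g. g \<in> carrier G \<Longrightarrow> \<sigma> g ` X \<subseteq> X"
      "\<And>g f. g \<in> carrier G \<Longrightarrow> f \<in> U \<Longrightarrow> ext_perm X (\<sigma> g) f \<in> U"
    and one: "\<And>x. x \<in> X \<Longrightarrow> \<sigma> \<one>\<^bsub>G\<^esub> x = x"
    and mult: "\<And>g h x. g \<in> carrier G \<Longrightarrow> h \<in> carrier G \<Longrightarrow> x \<in> X \<Longrightarrow> \<sigma> (g \<otimes>\<^bsub>G\<^esub> h) x = \<sigma> g (\<sigma> h x)"
  shows "is_gmod G \<lparr>vecs = U, act = (\<lambda>g. ext_perm X (\<sigma> g))\<rparr>"
proof -
  have "U \<subseteq> cfun.span (ext_basis ` Pow X)"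
  proof
    fix f assume "f \<in> U"
    then have "f = (\<Sum>A\<in>Pow X. cscale (f A) (ext_basis A))" using U(2) ext_alg_expand[OF X] by blast
    also have "\<dots> \<in> cfun.span (ext_basis ` Pow X)"
      by (intro cfun.span_sum cfun.span_scale cfun.span_base) auto
    finally show "f \<in> cfun.span (ext_basis ` Pow X)" .
  qed
  then have "\<exists>B. finite B \<and> cfun.span B = U"
    using X by (intro finite_span_subspace[OF _ U(1)]) auto
  moreover have "ext_perm X (\<sigma> \<one>\<^bsub>G\<^esub>) f = f" if "f \<in> U" for f
    using ext_perm_id[OF X one] U(2) that by blast
  moreover have "ext_perm X (\<sigma> (g \<otimes>\<^bsub>G\<^esub> h)) f = ext_perm X (\<sigma> g) (ext_perm X (\<sigma> h) f)"
    if "g \<in> carrier G" "h \<in> carrier G" "f \<in> U" for g h f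
    using ext_perm_comp[where \<sigma> = "\<sigma> g" and \<tau> = "\<sigma> h", OF X mult[OF that(1,2)] maps(1)[OF that(2)]]
      U(2) that(3) by blast
  ultimately show ?thesis
    using U(1) maps(2) unfolding is_gmod_def linear_between_def
    by (auto simp: clinearD[OF clinear_ext_perm])
qed

subsection \<open>Representations of \<open>sl\<^sub>2\<close> on bigraded spaces\<close>

text \<open>By \<open>comm\<close>, the Cartan element of sl_2 acts on \<open>V i j\<close> as the
  scalar i - j. The vanishing in negative degrees makes \<open>e\<close> locally nilpotent, since it
  lowers the second degree, and likewise \<open>f\<close> by symmetry.\<close>

locale bigraded_sl2 =
  fixes e f :: "('i \<Rightarrow> complex) \<Rightarrow> ('i \<Rightarrow> complex)" and V :: "int \<Rightarrow> int \<Rightarrow> ('i \<Rightarrow> complex) set"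
  assumes lin_e: "clinear e" and lin_f: "clinear f"
    and sub: "cfun.subspace (V i j)"
    and e_in: "x \<in> V i j \<Longrightarrow> e x \<in> V (i + 1) (j - 1)"
    and f_in: "x \<in> V i j \<Longrightarrow> f x \<in> V (i - 1) (j + 1)"
    and comm: "x \<in> V i j \<Longrightarrow> e (f x) = f (e x) + cscale (of_int (i - j)) x"
    and vanish: "x \<in> V i j \<Longrightarrow> i < 0 \<or> j < 0 \<Longrightarrow> x = 0"
begin

lemma e_pow_in: "x \<in> V i j \<Longrightarrow> (e ^^ m) x \<in> V (i + int m) (j - int m)"
proof (induction m)
  case (Suc m)
  show ?case using e_in[OF Suc.IH[OF Suc.prems]] by (simp add: algebra_simps)
qed simp

lemma clinear_e_pow: "clinear (e ^^ m)"
  using lin_e by (induction m) (auto intro: clinear_id[folded id_def] clinear_comp[folded comp_def])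

lemma e_nilpotent:
  assumes "x \<in> V i j"
  shows "\<exists>m. (e ^^ m) x = 0"
  using vanish[OF e_pow_in[OF assms, of "nat (j + 1)"]] by (intro exI[of _ "nat (j + 1)"]) auto

text \<open>Moving \<open>f\<close> past the k-th further factor \<open>e\<close> contributes the
  weight i - j + 2k of the vector it meets. Summing over k = 0, ..., m gives the coefficient (m +
  1)(i - j + m).\<close>

lemma comm_pow:
  assumes "x \<in> V i j"
  shows "(e ^^ Suc m) (f x) = f ((e ^^ Suc m) x) + cscale (of_int ((int m + 1) * (i - j + int m))) ((e ^^ m) x)"
proof (induction m)
  case 0
  then show ?case using comm[OF assms] by simp
next
  case (Suc m)
  let ?y = "(e ^^ Suc m) x"
  have "(e ^^ Suc (Suc m)) (f x) = e (f ?y) + cscale (of_int ((int m + 1) * (i - j + int m))) ?y"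
  proof -
    have "(e ^^ Suc m) (f x) = f ?y + cscale (of_int ((int m + 1) * (i - j + int m))) ((e ^^ m) x)"
      using Suc by (simp only: plus_fun_def)
    then have "e ((e ^^ Suc m) (f x)) = e (f ?y + cscale (of_int ((int m + 1) * (i - j + int m))) ((e ^^ m) x))"
      by (rule arg_cong)
    then show ?thesis by (simp only: clinearD(1,3)[OF lin_e] funpow.simps comp_apply)
  qed
  also have "e (f ?y) = f (e ?y) + cscale (of_int ((i + int (Suc m)) - (j - int (Suc m)))) ?y"
    by (rule comm[OF e_pow_in[OF assms]])
  also have "\<dots> + cscale (of_int ((int m + 1) * (i - j + int m))) ?y
      = f (e ?y) + cscale (of_int ((int (Suc m) + 1) * (i - j + int (Suc m)))) ?y"
  proof -
    have "(i + int (Suc m)) - (j - int (Suc m)) + (int m + 1) * (i - j + int m)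
        = (int (Suc m) + 1) * (i - j + int (Suc m))"
      by (simp add: algebra_simps)
    then show ?thesis
      by (simp only: add.assoc cfun.scale_left_distrib[symmetric] of_int_add[symmetric])
  qed
  finally show ?case by (simp only: plus_fun_def funpow.simps comp_apply)
qed

text \<open>Induction on the number of applications of \<open>e\<close> that kill \<open>g\<close>.
  With \<open>c\<close> the coefficient of \<open>comm_pow\<close>, the vector
  \<open>e (f g) - cscale c g\<close> is killed one step earlier; if \<open>x\<close> is a preimage
  of it, then \<open>f g - x\<close> divided by \<open>c\<close> is a preimage of \<open>g\<close>.
  Positive weight ensures that \<open>c\<close> is nonzero.\<close>

lemma e_surj:
  assumes "g \<in> V i j" "i > j"
  shows "\<exists>x \<in> V (i - 1) (j + 1). e x = g"
proof -
  have "\<exists>x \<in> V (i - 1) (j + 1). e x = g" if "(e ^^ m) g = 0" "g \<in> V i j" for m g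
    using that
  proof (induction m arbitrary: g)
    case 0
    then show ?case
      using cfun.subspace_0[OF sub] clinearD(4)[OF lin_e] by (intro bexI[of _ 0]) (auto simp: zero_fun_def)
  next
    case (Suc m)
    define c :: complex where "c = of_int ((int m + 1) * (i - j + int m))"
    have "(int m + 1) * (i - j + int m) > 0" using assms(2) by (intro mult_pos_pos) auto
    then have c0: "c \<noteq> 0" unfolding c_def of_int_eq_0_iff by linarith
    have fg: "f g \<in> V (i - 1) (j + 1)" using f_in[OF Suc.prems(2)] .
    then have efg: "e (f g) \<in> V i j" using e_in[OF fg] by simp
    have e0: "(e ^^ Suc m) g = 0" using Suc.prems(1) .
    have "(e ^^ m) (e (f g) - cscale c g) = (e ^^ Suc m) (f g) - cscale c ((e ^^ m) g)"
      by (simp only: clinearD[OF clinear_e_pow] funpow_swap1 funpow.simps comp_apply)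
    also have "\<dots> = 0"
      unfolding comm_pow[OF Suc.prems(2)] e0 by (simp add: clinearD(4)[OF lin_f] c_def)
    finally have "\<exists>x \<in> V (i - 1) (j + 1). e x = e (f g) - cscale c g"
      using efg Suc.prems(2) by (intro Suc.IH cfun.subspace_diff[OF sub] cfun.subspace_scale[OF sub])
    then obtain x where x: "x \<in> V (i - 1) (j + 1)" "e x = e (f g) - cscale c g" by blast
    have "e (cscale (1 / c) (f g - x)) = g"
      using c0 by (simp add: clinearD[OF lin_e] x(2))
    moreover have "cscale (1 / c) (f g - x) \<in> V (i - 1) (j + 1)"
      by (intro cfun.subspace_scale[OF sub] cfun.subspace_diff[OF sub] fg x(1))
    ultimately show ?case by blast
  qed
  then show ?thesis using e_nilpotent[OF assms(1)] assms(1) by blast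
qed

text \<open>Take the last k for which the k-th power of \<open>e\<close> does not kill
  \<open>x\<close>. When \<open>f x = 0\<close>, \<open>comm_pow\<close> retains only the term with
  this power, and its coefficient is positive in positive weight.\<close>

lemma f_inj:
  assumes "x \<in> V i j" "f x = 0" "i > j"
  shows "x = 0"
proof (rule ccontr)
  assume x0: "x \<noteq> 0"
  obtain m where m: "(e ^^ m) x = 0" "\<And>k. k < m \<Longrightarrow> (e ^^ k) x \<noteq> 0"
    using e_nilpotent[OF assms(1)] exists_least_iff[of "\<lambda>m. (e ^^ m) x = 0"] by blast
  then obtain k where k: "m = Suc k" using x0 by (cases m) auto
  have "(int k + 1) * (i - j + int k) > 0" using assms(3) by (intro mult_pos_pos) auto
  then have "(of_int ((int k + 1) * (i - j + int k)) :: complex) \<noteq> 0"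
    unfolding of_int_eq_0_iff by linarith
  moreover have "cscale (of_int ((int k + 1) * (i - j + int k))) ((e ^^ k) x) = 0"
    using comm_pow[OF assms(1), of k] m(1) clinearD(4)[OF clinear_e_pow, of "Suc k"] clinearD(4)[OF lin_f]
    unfolding k assms(2) by (metis add_0)
  ultimately show False using m(2)[of k] k by simp
qed

end

text \<open>Exchanging the two operators together with the two degrees negates the weight, so the
  locale is symmetric; this turns \<open>f_inj\<close> into injectivity of \<open>e\<close> in
  negative weight.\<close>

lemma (in bigraded_sl2) swap: "bigraded_sl2 f e (\<lambda>i j. V j i)"
proof (rule bigraded_sl2.intro)
  show "f (e x) = e (f x) + cscale (of_int (i - j)) x" if "x \<in> V j i" for x i j
    using comm[OF that] by (simp add: add.assoc cfun.scale_left_distrib[symmetric])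
qed (use lin_e lin_f sub e_in f_in vanish in auto)

lemma (in bigraded_sl2) e_inj: "x \<in> V i j \<Longrightarrow> e x = 0 \<Longrightarrow> i < j \<Longrightarrow> x = 0"
  using bigraded_sl2.f_inj[OF swap] by blast

subsection \<open>The raising and lowering derivations\<close>

text \<open>The derivation of the exterior algebra sending \<open>q k\<close> to \<open>p k\<close>, for \<open>k \<in> K\<close>.\<close>

definition ext_shift :: "'k set \<Rightarrow> ('k \<Rightarrow> 'x::linorder) \<Rightarrow> ('k \<Rightarrow> 'x) \<Rightarrow> ('x set \<Rightarrow> complex) \<Rightarrow> 'x set \<Rightarrow> complex" where
  "ext_shift K p q f = (\<Sum>k\<in>K. ext_left (p k) (ext_contr (q k) f))"

lemma clinear_ext_shift: "clinear (ext_shift K p q)"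
  by (rule clinearI)
    (simp_all add: ext_shift_def clinearD[OF clinear_ext_left] clinearD[OF clinear_ext_contr]
      sum.distrib cfun.scale_sum_right)

lemma ext_shift_one: "ext_shift K p q ext_one = 0"
proof -
  have "ext_contr a ext_one = 0" for a :: 'a
    by (auto simp: ext_contr_def ext_one_def fun_eq_iff)
  then show ?thesis by (simp add: ext_shift_def)
qed

text \<open>The Leibniz rule for a generator. Passing \<open>a\<close> through a contraction and
  through a left multiplication costs two signs, which cancel; the extra term comes from the
  contraction meeting its own generator.\<close>

lemma ext_shift_left:
  assumes X: "finite X" and f: "f \<in> ext_alg X"
  shows "ext_shift K p q (ext_left a f) = ext_left a (ext_shift K p q f) + (\<Sum>k\<in>K. if q k = a then ext_left (p k) f else 0)"
proof -
  have "ext_left (p k) (ext_contr (q k) (ext_left a f))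
      = ext_left a (ext_left (p k) (ext_contr (q k) f)) + (if q k = a then ext_left (p k) f else 0)" for k
    using ext_contr_left[OF ext_alg_finite[OF X f], where b = "q k" and a = a] ext_left_left[of a "p k" "ext_contr (q k) f"]
    by (cases "q k = a") (simp_all add: clinearD[OF clinear_ext_left])
  then show ?thesis
    by (simp add: ext_shift_def sum.distrib clinear_sum[OF clinear_ext_left])
qed

lemma ext_shift_in_ext_alg:
  assumes "p ` K \<subseteq> X" "f \<in> ext_alg X"
  shows "ext_shift K p q f \<in> ext_alg X"
  unfolding ext_shift_def using assms
  by (intro cfun.subspace_sum[OF subspace_ext_alg] ext_left_in_ext_alg ext_contr_in_ext_alg) auto

section \<open>The sl_2-triple on the bigraded algebra\<close>

lemma finite_gens: "finite (gens n)"
  by (simp add: gens_def)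

lemma gens_cases:
  assumes "a \<in> gens n"
  obtains k where "k \<in> {1..n}" "a = Alpha k" | k where "k \<in> {1..n}" "a = Theta k"
  using assms by (auto simp: gens_def)

lemma Alpha_in_gens: "Alpha k \<in> gens n \<longleftrightarrow> k \<in> {1..n}"
  and Theta_in_gens: "Theta k \<in> gens n \<longleftrightarrow> k \<in> {1..n}"
  by (auto simp: gens_def)

definition raise :: "nat \<Rightarrow> (gen set \<Rightarrow> complex) \<Rightarrow> gen set \<Rightarrow> complex" where
  "raise n = ext_shift {1..n} Alpha Theta"

definition lower :: "nat \<Rightarrow> (gen set \<Rightarrow> complex) \<Rightarrow> gen set \<Rightarrow> complex" where
  "lower n = ext_shift {1..n} Theta Alpha"

lemma clinear_raise: "clinear (raise n)" and clinear_lower: "clinear (lower n)"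
  by (simp_all add: raise_def lower_def clinear_ext_shift)

lemma raise_in_E: "f \<in> E_alg n \<Longrightarrow> raise n f \<in> E_alg n"
  and lower_in_E: "f \<in> E_alg n \<Longrightarrow> lower n f \<in> E_alg n"
  unfolding raise_def lower_def by (auto intro!: ext_shift_in_ext_alg simp: gens_def)

lemma raise_one: "raise n ext_one = 0" and lower_one: "lower n ext_one = 0"
  by (simp_all add: raise_def lower_def ext_shift_one)

lemma raise_left:
  assumes "f \<in> E_alg n"
  shows "raise n (ext_left (Alpha k) f) = ext_left (Alpha k) (raise n f)"
    "k \<in> {1..n} \<Longrightarrow> raise n (ext_left (Theta k) f) = ext_left (Theta k) (raise n f) + ext_left (Alpha k) f"
  unfolding raise_def ext_shift_left[OF finite_gens assms] by (simp_all add: sum.delta)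

lemma lower_left:
  assumes "f \<in> E_alg n"
  shows "lower n (ext_left (Theta k) f) = ext_left (Theta k) (lower n f)"
    "k \<in> {1..n} \<Longrightarrow> lower n (ext_left (Alpha k) f) = ext_left (Alpha k) (lower n f) + ext_left (Theta k) f"
  unfolding lower_def ext_shift_left[OF finite_gens assms] by (simp_all add: sum.delta)

abbreviation num_alpha :: "(gen set \<Rightarrow> complex) \<Rightarrow> gen set \<Rightarrow> complex" where
  "num_alpha \<equiv> ext_number (range Alpha)"

abbreviation num_theta :: "(gen set \<Rightarrow> complex) \<Rightarrow> gen set \<Rightarrow> complex" where
  "num_theta \<equiv> ext_number (range Theta)"

lemma num_left:
  "num_alpha (ext_left (Alpha k) f) = ext_left (Alpha k) (num_alpha f) + ext_left (Alpha k) f"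
  "num_alpha (ext_left (Theta k) f) = ext_left (Theta k) (num_alpha f)"
  "num_theta (ext_left (Alpha k) f) = ext_left (Alpha k) (num_theta f)"
  "num_theta (ext_left (Theta k) f) = ext_left (Theta k) (num_theta f) + ext_left (Theta k) f"
  by (auto simp: ext_number_left)

lemmas E_linear = clinearD[OF clinear_raise] clinearD[OF clinear_lower] clinearD[OF clinear_ext_left]
  clinearD[OF clinear_ext_number]

lemmas E_closed = raise_in_E lower_in_E ext_number_in_ext_alg

text \<open>In terms of eigenspaces, these relations say that \<open>raise\<close> has bidegree (1,
  -1) and \<open>lower\<close> has bidegree (-1, 1).\<close>

lemma num_raise:
  assumes "f \<in> E_alg n"
  shows "num_alpha (raise n f) = raise n (num_alpha f) + raise n f"
    "num_theta (raise n f) = raise n (num_theta f) - raise n f"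
    "num_alpha (lower n f) = lower n (num_alpha f) - lower n f"
    "num_theta (lower n f) = lower n (num_theta f) + lower n f"
proof -
  note lin = clinear_comp[OF clinear_ext_number clinear_raise] clinear_comp[OF clinear_ext_number clinear_lower]
    clinear_comp[OF clinear_raise clinear_ext_number] clinear_comp[OF clinear_lower clinear_ext_number]
  note linr = clinear_add[OF lin(3) clinear_raise] clinear_diff[OF lin(3) clinear_raise]
    clinear_diff[OF lin(4) clinear_lower] clinear_add[OF lin(4) clinear_lower]
  show "num_alpha (raise n f) = raise n (num_alpha f) + raise n f"
    by (rule ext_alg_eqI[OF finite_gens assms lin(1) linr(1)])
      (auto simp: raise_one ext_number_one E_linear raise_left num_left E_closed elim!: gens_cases)
  show "num_theta (raise n f) = raise n (num_theta f) - raise n f"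
    by (rule ext_alg_eqI[OF finite_gens assms lin(1) linr(2)])
      (auto simp: raise_one ext_number_one E_linear raise_left num_left E_closed elim!: gens_cases)
  show "num_alpha (lower n f) = lower n (num_alpha f) - lower n f"
    by (rule ext_alg_eqI[OF finite_gens assms lin(2) linr(3)])
      (auto simp: lower_one ext_number_one E_linear lower_left num_left E_closed elim!: gens_cases)
  show "num_theta (lower n f) = lower n (num_theta f) + lower n f"
    by (rule ext_alg_eqI[OF finite_gens assms lin(2) linr(4)])
      (auto simp: lower_one ext_number_one E_linear lower_left num_left E_closed elim!: gens_cases)
qed

text \<open>On each plane spanned by \<alpha>_k and \<theta>_k the three operators are the standard
  triple of sl_2, and a commutator of derivations is again a derivation; so checking it against the
  generators suffices.\<close>

lemma raise_lower:
  assumes "f \<in> E_alg n"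
  shows "raise n (lower n f) = lower n (raise n f) + (num_alpha f - num_theta f)"
  by (rule ext_alg_eqI[OF finite_gens assms clinear_comp[OF clinear_raise clinear_lower]
        clinear_add[OF clinear_comp[OF clinear_lower clinear_raise] clinear_diff[OF clinear_ext_number clinear_ext_number]]])
    (auto simp: raise_one lower_one ext_number_one E_linear raise_left lower_left num_left E_closed elim!: gens_cases)

lemma E_part_iff:
  "f \<in> E_part n i j \<longleftrightarrow> f \<in> E_alg n \<and> num_alpha f = cscale (of_int i) f \<and> num_theta f = cscale (of_int j) f"
  unfolding E_part_def ext_number_eigen_iff by auto

lemma E_sl2: "bigraded_sl2 (raise n) (lower n) (E_part n)"
proof (rule bigraded_sl2.intro)
  show "cfun.subspace (E_part n i j)" for i j
    by (rule cfun.subspaceI)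
      (auto simp: E_part_iff E_linear cfun.subspace_0[OF subspace_ext_alg] cfun.subspace_add[OF subspace_ext_alg]
        cfun.subspace_scale[OF subspace_ext_alg] cfun.scale_right_distrib mult.commute)
  show "raise n f \<in> E_part n (i + 1) (j - 1)" if "f \<in> E_part n i j" for f i j
    using that
    by (auto simp: E_part_iff num_raise E_linear E_closed cfun.scale_left_distrib cfun.scale_left_diff_distrib)
  show "lower n f \<in> E_part n (i - 1) (j + 1)" if "f \<in> E_part n i j" for f i j
    using that
    by (auto simp: E_part_iff num_raise E_linear E_closed cfun.scale_left_distrib cfun.scale_left_diff_distrib)
  show "raise n (lower n f) = lower n (raise n f) + cscale (of_int (i - j)) f" if "f \<in> E_part n i j" for f i j
    using that by (auto simp: E_part_iff raise_lower cfun.scale_left_diff_distrib)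
  show "f = 0" if "f \<in> E_part n i j" "i < 0 \<or> j < 0" for f i j
    using that by (auto simp: E_part_def fun_eq_iff)
qed (rule clinear_raise clinear_lower)+

text \<open>A permutation moves \<alpha>_k and \<theta>_k to generators with the same new index, so
  it carries the pairs that define the derivation to such pairs.\<close>

lemma raise_perm:
  assumes w: "w permutes {1..n}" and f: "f \<in> E_alg n"
  shows "raise n (E_act n w f) = E_act n w (raise n f)"
proof -
  have gw: "gen_perm w ` gens n \<subseteq> gens n" and wk: "\<And>k. w k \<in> {1..n} \<longleftrightarrow> k \<in> {1..n}"
    using permutes_in_image[OF w] by (auto simp: gens_def)
  let ?P = "ext_perm (gens n) (gen_perm w)"
  note P_left = ext_perm_left[OF finite_gens, where \<sigma> = "gen_perm w"]
  note P_in = ext_perm_in_ext_alg[OF finite_gens gw]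
  show ?thesis
    unfolding E_act_def
  proof (rule ext_alg_eqI[OF finite_gens f clinear_comp[OF clinear_raise clinear_ext_perm]
          clinear_comp[OF clinear_ext_perm clinear_raise]])
    show "raise n (?P ext_one) = ?P (raise n ext_one)"
      by (simp add: ext_perm_one finite_gens raise_one clinearD[OF clinear_ext_perm])
    fix a f assume a: "a \<in> gens n" and f: "f \<in> E_alg n" and IH: "raise n (?P f) = ?P (raise n f)"
    show "raise n (?P (ext_left a f)) = ?P (raise n (ext_left a f))"
      using a
    proof (cases rule: gens_cases)
      case (1 k)
      then show ?thesis
        using P_left[OF a f] P_left[OF a raise_in_E[OF f]] IH
        by (simp add: raise_left(1)[OF f] raise_left(1)[OF P_in[OF f]])
    next
      case (2 k)
      then have k': "Alpha k \<in> gens n" "w k \<in> {1..n}" by (simp_all only: Alpha_in_gens wk)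
      show ?thesis
        using P_left[OF a f] P_left[OF a raise_in_E[OF f]] P_left[OF k'(1) f] IH
          raise_left(2)[OF f 2(1)] raise_left(2)[OF P_in[OF f] k'(2)]
        by (simp add: 2(2) clinearD[OF clinear_ext_perm])
    qed
  qed
qed

subsection \<open>The invariants of \<open>T\<close>\<close>

text \<open>
  On \<open>E_alg n\<close> we have \<open>T = exp raise\<close>. Instead of the exponential series, the proof uses
  \<open>T raise = T N - N T\<close>, with \<open>N\<close> the \<open>\<theta>\<close>-degree, and that \<open>T - id\<close> lowers the \<open>\<theta>\<close>-degree.
\<close>

locale shear =
  fixes n :: nat and T :: "(gen set \<Rightarrow> complex) \<Rightarrow> (gen set \<Rightarrow> complex)"
  assumes lin: "clinear T" and T_one: "T ext_one = ext_one"
    and T_in: "f \<in> E_alg n \<Longrightarrow> T f \<in> E_alg n"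
    and T_Alpha: "k \<in> {1..n} \<Longrightarrow> f \<in> E_alg n \<Longrightarrow> T (ext_left (Alpha k) f) = ext_left (Alpha k) (T f)"
    and T_Theta: "k \<in> {1..n} \<Longrightarrow> f \<in> E_alg n \<Longrightarrow>
      T (ext_left (Theta k) f) = ext_left (Theta k) (T f) + ext_left (Alpha k) (T f)"
begin

text \<open>For T = exp D, the relation D N - N D = D gives T N = (N + D) T, and T commutes with D.
  In this form the identity can be checked generator by generator.\<close>

lemma T_raise:
  assumes "f \<in> E_alg n"
  shows "T (raise n f) = T (num_theta f) - num_theta (T f)"
  by (rule ext_alg_eqI[OF finite_gens assms clinear_comp[OF lin clinear_raise]
        clinear_diff[OF clinear_comp[OF lin clinear_ext_number] clinear_comp[OF clinear_ext_number lin]]])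
    (auto simp: raise_one ext_number_one T_one clinearD[OF lin] E_linear raise_left num_left T_Alpha T_Theta
      E_closed ext_left_in_ext_alg Alpha_in_gens Theta_in_gens T_in elim!: gens_cases)

text \<open>Expanding the image of a monomial replaces some of its \<theta>_k by \<alpha>_k.
  Choosing no replacement returns the monomial itself, and every other choice loses at least one
  \<theta>.\<close>

lemma T_basis_lower:
  assumes "A \<subseteq> gens n"
  shows "\<forall>C. (T (ext_basis A) - ext_basis A) C \<noteq> 0 \<longrightarrow> card (C \<inter> range Theta) < card (A \<inter> range Theta)"
  using finite_subset[OF assms finite_gens] assms
proof (induction rule: finite_linorder_min_induct)
  case empty
  then show ?case by (simp add: ext_one_basis[symmetric] T_one)
next
  case (insert b A)
  let ?x = "ext_basis A" and ?d = "\<lambda>C :: gen set. card (C \<inter> range Theta)"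
  have x: "?x \<in> E_alg n" using insert by (intro ext_basis_in_ext_alg) auto
  have b: "ext_basis (insert b A) = ext_left b ?x" using ext_left_basis_min[OF insert(1,2)] by simp
  have bA: "b \<notin> A" using insert(2) by auto
  have IH: "?d C < ?d A" if "T ?x C \<noteq> ?x C" for C using insert that by auto
  \<comment> \<open>The weak bound that also covers the monomial itself; it handles the term in
    which the new \<theta>_k is replaced by \<alpha>_k.\<close>
  have Tx: "?d C \<le> ?d A" if "T ?x C \<noteq> 0" for C
    using IH[of C] that by (cases "C = A") (auto simp: ext_basis_def)
  have "b \<in> gens n" using insert by simp
  then show ?case
  proof (cases rule: gens_cases)
    case (1 k)
    have "Alpha k \<notin> range Theta" by auto
    then have d: "?d (C - {Alpha k}) = ?d C" for C by (simp add: Diff_Int_distrib2)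
    have "?d C < ?d (insert b A)" if "(T (ext_left b ?x) - ext_left b ?x) C \<noteq> 0" for C
    proof -
      have "T ?x (C - {b}) \<noteq> ?x (C - {b})"
      proof -
        have "ext_left b (T ?x) C \<noteq> ext_left b ?x C" using that by (auto simp: 1 T_Alpha[OF 1(1) x])
        then show ?thesis by (auto simp: ext_left_def split: if_splits)
      qed
      from IH[OF this] show ?thesis using d[of C] d[of "insert b A"] bA by (simp add: 1)
    qed
    then show ?thesis by (simp add: b)
  next
    case (2 k)
    have d2: "?d (C - {Theta k}) + 1 = ?d C" if "finite C" "Theta k \<in> C" for C
    proof -
      have "C \<inter> range Theta = insert (Theta k) ((C - {Theta k}) \<inter> range Theta)" using that by auto
      then show ?thesis using that by simp
    qed
    have "Alpha k \<notin> range Theta" by auto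
    then have d1: "?d (C - {Alpha k}) = ?d C" for C by (simp add: Diff_Int_distrib2)
    have dA: "?d (insert b A) = ?d A + 1"
      using d2[of "insert b A"] bA insert(1) by (simp add: 2)
    have "?d C < ?d (insert b A)" if C: "(T (ext_left b ?x) - ext_left b ?x) C \<noteq> 0" for C
    proof -
      \<comment> \<open>A difference comes either from the shorter monomial, where the strict bound
        is inherited, or from the term with \<alpha>_k, which lacks the additional \<theta> of
        \<open>insert b A\<close>.\<close>
      have "ext_left b (T ?x) C \<noteq> ext_left b ?x C \<or> ext_left (Alpha k) (T ?x) C \<noteq> 0"
        using C by (auto simp: 2 T_Theta[OF 2(1) x])
      then show ?thesis
      proof
        assume "ext_left b (T ?x) C \<noteq> ext_left b ?x C"
        then have "finite C" "b \<in> C" "T ?x (C - {b}) \<noteq> ?x (C - {b})"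
          by (auto simp: ext_left_def split: if_splits)
        then show ?thesis using IH[of "C - {b}"] d2[of C] dA by (simp add: 2)
      next
        assume "ext_left (Alpha k) (T ?x) C \<noteq> 0"
        then have "T ?x (C - {Alpha k}) \<noteq> 0" by (auto simp: ext_left_def split: if_splits)
        then show ?thesis using Tx[of "C - {Alpha k}"] d1[of C] dA by simp
      qed
    qed
    then show ?thesis by (simp add: b)
  qed
qed

lemma T_lower:
  assumes f: "f \<in> E_alg n" "num_theta f = cscale (of_int j) f" and C: "T f C \<noteq> f C"
  shows "int (card (C \<inter> range Theta)) < j"
proof -
  have "(T f - f) = (\<Sum>A\<in>Pow (gens n). cscale (f A) (T (ext_basis A) - ext_basis A))"
  proof -
    have "T f = (\<Sum>A\<in>Pow (gens n). cscale (f A) (T (ext_basis A)))"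
      by (subst ext_alg_expand[OF finite_gens f(1)]) (simp add: clinear_sum[OF lin] clinearD(3)[OF lin])
    then show ?thesis
      using ext_alg_expand[OF finite_gens f(1)] by (simp add: cfun.scale_right_diff_distrib sum_subtractf)
  qed
  then have "(T f - f) C = (\<Sum>A\<in>Pow (gens n). f A * (T (ext_basis A) - ext_basis A) C)"
    by (simp only: fun_sum_apply cscale_def)
  moreover have "(T f - f) C \<noteq> 0" using C by simp
  ultimately have "(\<Sum>A\<in>Pow (gens n). f A * (T (ext_basis A) - ext_basis A) C) \<noteq> 0" by metis
  then obtain A where A: "A \<in> Pow (gens n)" "f A * (T (ext_basis A) - ext_basis A) C \<noteq> 0"
    by (rule sum.not_neutral_contains_not_neutral)
  then have "card (C \<inter> range Theta) < card (A \<inter> range Theta)" using T_basis_lower by auto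
  moreover have "int (card (A \<inter> range Theta)) = j"
    using A(2) f(2) unfolding ext_number_eigen_iff by auto
  ultimately show ?thesis by simp
qed

text \<open>By \<open>T_lower\<close> the component of \<open>T f\<close> of \<theta>-degree j is
  that of \<open>f\<close>, and a homogeneous \<open>f\<close> has no other component.\<close>

lemma T_injective:
  assumes f: "f \<in> E_alg n" "num_theta f = cscale (of_int j) f" and "T f = 0"
  shows "f = 0"
proof -
  have "f C = 0" for C
    using T_lower[OF f, of C] f(2) assms(3) unfolding ext_number_eigen_iff by force
  then show ?thesis by (simp add: fun_eq_iff)
qed

text \<open>If \<open>T f = f\<close>, then \<open>T_raise\<close> gives
  \<open>T (raise n f) = 0\<close>, because both terms on its right equal j f; injectivity finishes.
  If \<open>raise n f = 0\<close>, the same identity makes \<open>T f\<close> homogeneous of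
  \<theta>-degree j, whereas its difference from \<open>f\<close> lives in smaller degrees.\<close>

lemma T_fixed_iff:
  assumes f: "f \<in> E_part n i j"
  shows "T f = f \<longleftrightarrow> raise n f = 0"
proof
  have fE: "f \<in> E_alg n" and j: "num_theta f = cscale (of_int j) f" using f by (auto simp: E_part_iff)
  {
    assume "T f = f"
    then have "T (raise n f) = 0" using T_raise[OF fE] j by (simp add: clinearD[OF lin])
    moreover have "num_theta (raise n f) = cscale (of_int (j - 1)) (raise n f)"
      using bigraded_sl2.e_in[OF E_sl2 f] by (simp add: E_part_iff)
    ultimately show "raise n f = 0" using T_injective raise_in_E[OF fE] by blast
  next
    assume "raise n f = 0"
    then have "num_theta (T f) = cscale (of_int j) (T f)"
      using T_raise[OF fE] j by (simp add: clinearD[OF lin])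
    then have "T f C = f C" for C
      using T_lower[OF fE j, of C] j unfolding ext_number_eigen_iff by (metis less_irrefl)
    then show "T f = f" by blast
  }
qed

end

subsection \<open>The bigraded algebra as a tensor product\<close>

lemma gen_less_simps [simp]:
  "Alpha x < Alpha y \<longleftrightarrow> x < y" "Alpha x < Theta y" "\<not> Theta x < Alpha y" "Theta x < Theta y \<longleftrightarrow> x < y"
  by (auto simp: less_gen_def)

text \<open>All \<alpha> precede all \<theta> in the order of generators, so each monomial is
  already an \<alpha>-monomial times a \<theta>-monomial and the coefficients are copied without
  signs.\<close>

definition ext_split :: "(gen set \<Rightarrow> complex) \<Rightarrow> nat set \<times> nat set \<Rightarrow> complex" where
  "ext_split f = (\<lambda>(A, B). f (Alpha ` A \<union> Theta ` B))"

text \<open>The grading automorphism. It enters because a \<theta> multiplied from the left has to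
  pass every \<alpha> of a monomial.\<close>

definition parity :: "('x set \<Rightarrow> complex) \<Rightarrow> 'x set \<Rightarrow> complex" where
  "parity f = (\<lambda>A. (-1) ^ card A * f A)"

lemma clinear_ext_split: "clinear ext_split"
  by (rule clinearI) (auto simp: ext_split_def cscale_def fun_eq_iff)

lemma clinear_parity: "clinear parity"
  by (rule clinearI) (auto simp: parity_def cscale_def fun_eq_iff algebra_simps)

lemma parity_in_ext_alg: "f \<in> ext_alg X \<Longrightarrow> parity f \<in> ext_alg X"
  by (auto simp: ext_alg_def parity_def)

lemma parity_left: "parity (ext_left a f) = - ext_left a (parity f)"
proof
  fix C
  show "parity (ext_left a f) C = (- ext_left a (parity f)) C"
  proof (cases "finite C \<and> a \<in> C")
    case True
    then obtain m where "card (C - {a}) = m" "card C = Suc m" using card.remove[of C a] by blast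
    then show ?thesis using True unfolding parity_def ext_left_def by (simp del: card_Diff_singleton)
  qed (auto simp: parity_def ext_left_def)
qed

lemma parity_one: "parity ext_one = ext_one"
  by (auto simp: parity_def ext_one_def fun_eq_iff)

lemma parity_perm:
  assumes X: "finite X" and f: "f \<in> ext_alg X"
  shows "parity (ext_perm X \<sigma> f) = ext_perm X \<sigma> (parity f)"
proof (rule ext_alg_eqI[OF X f clinear_comp[OF clinear_parity clinear_ext_perm]
      clinear_comp[OF clinear_ext_perm clinear_parity]])
  show "parity (ext_perm X \<sigma> ext_one) = ext_perm X \<sigma> (parity ext_one)"
    by (simp add: ext_perm_one[OF X] parity_one)
  show "parity (ext_perm X \<sigma> (ext_left a f)) = ext_perm X \<sigma> (parity (ext_left a f))"
    if "a \<in> X" "f \<in> ext_alg X" "parity (ext_perm X \<sigma> f) = ext_perm X \<sigma> (parity f)" for a f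
    using that
    by (simp add: ext_perm_left[OF X] parity_left parity_in_ext_alg clinearD[OF clinear_ext_perm])
qed

lemma sgn_at_Alpha: "sgn_at (Alpha k) (Alpha ` A \<union> Theta ` B) = sgn_at k A"
proof -
  have "{b \<in> Alpha ` A \<union> Theta ` B. b < Alpha k} = Alpha ` {a \<in> A. a < k}" by auto
  then show ?thesis by (simp add: sgn_at_def card_image inj_on_def)
qed

lemma sgn_at_Theta:
  assumes "finite A" "finite B"
  shows "sgn_at (Theta k) (Alpha ` A \<union> Theta ` B) = (-1) ^ card A * sgn_at k B"
proof -
  have "{b \<in> Alpha ` A \<union> Theta ` B. b < Theta k} = Alpha ` A \<union> Theta ` {b \<in> B. b < k}" by auto
  moreover have "card (Alpha ` A \<union> Theta ` {b \<in> B. b < k}) = card A + card {b \<in> B. b < k}"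
    using assms by (subst card_Un_disjoint) (auto simp: card_image inj_on_def)
  ultimately show ?thesis by (simp add: sgn_at_def power_add)
qed

lemma ext_split_Alpha:
  assumes "f \<in> E_alg n"
  shows "ext_split (ext_left (Alpha k) f) = tens (ext_left k) (\<lambda>x. x) (ext_split f)"
proof -
  have "ext_left (Alpha k) f (Alpha ` A \<union> Theta ` B)
      = (if finite A \<and> k \<in> A then sgn_at k A * f (Alpha ` (A - {k}) \<union> Theta ` B) else 0)" for A B
  proof -
    have "Alpha ` A \<union> Theta ` B - {Alpha k} = Alpha ` (A - {k}) \<union> Theta ` B" by auto
    \<comment> \<open>\<open>ext_left\<close> demands that the whole union be finite, while the
      tensored operator sees only \<open>A\<close>; at infinite \<open>B\<close> both sides vanish
      because of the support of \<open>f\<close>.\<close>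
    moreover have "finite B" if "f (Alpha ` (A - {k}) \<union> Theta ` B) \<noteq> 0"
      using ext_alg_finite[OF finite_gens assms that] by (auto dest: finite_imageD simp: inj_on_def)
    moreover have "finite (Alpha ` A \<union> Theta ` B) \<longleftrightarrow> finite A \<and> finite B"
      by (auto dest: finite_imageD simp: inj_on_def)
    ultimately show ?thesis by (auto simp: ext_left_def sgn_at_Alpha)
  qed
  then show ?thesis by (auto simp: ext_split_def tens_def fun_eq_iff ext_left_def)
qed

lemma ext_split_Theta:
  assumes "f \<in> E_alg n"
  shows "ext_split (ext_left (Theta k) f) = tens parity (ext_left k) (ext_split f)"
proof -
  have "ext_left (Theta k) f (Alpha ` A \<union> Theta ` B)
      = (-1) ^ card A * (if finite B \<and> k \<in> B then sgn_at k B * f (Alpha ` A \<union> Theta ` (B - {k})) else 0)" for A B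
  proof -
    have "Alpha ` A \<union> Theta ` B - {Theta k} = Alpha ` A \<union> Theta ` (B - {k})" by auto
    moreover have "finite A" if "f (Alpha ` A \<union> Theta ` (B - {k})) \<noteq> 0"
      using ext_alg_finite[OF finite_gens assms that] by (auto dest: finite_imageD simp: inj_on_def)
    moreover have "finite (Alpha ` A \<union> Theta ` B) \<longleftrightarrow> finite A \<and> finite B"
      by (auto dest: finite_imageD simp: inj_on_def)
    ultimately show ?thesis by (auto simp: ext_left_def sgn_at_Theta)
  qed
  then show ?thesis by (auto simp: ext_split_def tens_def fun_eq_iff ext_left_def parity_def)
qed

text \<open>Both claims are proved in one induction: commuting the operators past each other is
  checked on pure tensors, which requires that the split element is already known to lie in their
  span. For a \<theta> it matters that \<open>parity\<close> commutes with permutations.\<close>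

lemma ext_split_perm:
  assumes w: "w permutes {1..n}" and f: "f \<in> E_alg n"
  defines "P \<equiv> ext_perm {1..n} w"
  shows "ext_split f \<in> tspace (ext_alg {1..n}) (ext_alg {1..n}) \<and>
    ext_split (E_act n w f) = tens P P (ext_split f)"
proof -
  let ?X = "{1..n}" and ?PE = "ext_perm (gens n) (gen_perm w)"
  let ?TS = "tspace (ext_alg ?X) (ext_alg ?X)"
  let ?S = "{f. ext_split f \<in> ?TS \<and> ext_split (?PE f) = tens P P (ext_split f)}"
  have wX: "w ` ?X \<subseteq> ?X" using permutes_image[OF w] by simp
  have gw: "gen_perm w ` gens n \<subseteq> gens n"
    using permutes_in_image[OF w] by (auto simp: gens_def)
  have P: "clinear P" unfolding P_def by (rule clinear_ext_perm)
  have P_left: "P (ext_left a v) = ext_left (w a) (P v)" if "a \<in> ?X" "v \<in> ext_alg ?X" for a v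
    unfolding P_def by (rule ext_perm_left[OF finite_atLeastAtMost that])
  have tP: "clinear (tens P P)" using clinear_tens[OF P P] .
  have one: "ext_split ext_one = pure_tensor ext_one ext_one"
    by (auto simp: ext_split_def ext_one_def pure_tensor_def fun_eq_iff)
  have S: "cfun.subspace ?S"
    by (rule cfun.subspaceI)
      (auto simp: clinearD[OF clinear_ext_split] clinearD[OF clinear_ext_perm] clinearD[OF tP]
        cfun.subspace_0[OF subspace_tspace] cfun.subspace_add[OF subspace_tspace] cfun.subspace_scale[OF subspace_tspace])
  have "f \<in> ?S"
  proof (rule ext_alg_induct[OF finite_gens S f])
    have "P ext_one = ext_one" by (simp add: P_def ext_perm_one)
    then show "ext_one \<in> ?S"
      by (simp add: one ext_perm_one[OF finite_gens] tens_pure[OF P P] pure_in_tspace ext_one_in_ext_alg)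
  next
    fix a f assume a: "a \<in> gens n" and f: "f \<in> E_alg n" and "f \<in> ?S"
    then have IH: "ext_split f \<in> ?TS" "ext_split (?PE f) = tens P P (ext_split f)" by auto
    have PEf: "?PE f \<in> E_alg n" using ext_perm_in_ext_alg[OF finite_gens gw f] .
    show "ext_left a f \<in> ?S"
      using a
    proof (cases rule: gens_cases)
      case (1 k)
      note L = clinear_tens[OF clinear_ext_left clinear_id]
      have "tens (ext_left (w k)) (\<lambda>x. x) (tens P P (ext_split f)) = tens P P (tens (ext_left k) (\<lambda>x. x) (ext_split f))"
        by (rule tspace_eq[OF clinear_comp[OF L tP] clinear_comp[OF tP L] IH(1)])
          (simp add: tens_pure[OF P P] tens_pure[OF clinear_ext_left clinear_id] P_left[OF 1(1)])
      moreover have "ext_split (ext_left a f) \<in> ?TS"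
        unfolding 1(2) ext_split_Alpha[OF f]
        by (rule tens_in_tspace[OF clinear_ext_left clinear_id IH(1)]) (use 1 in \<open>auto intro: ext_left_in_ext_alg\<close>)
      ultimately show ?thesis
        using ext_perm_left[OF finite_gens a f, of "gen_perm w"] IH(2)
        by (simp add: 1(2) ext_split_Alpha[OF f] ext_split_Alpha[OF PEf])
    next
      case (2 k)
      note L = clinear_tens[OF clinear_parity clinear_ext_left]
      have "tens parity (ext_left (w k)) (tens P P (ext_split f)) = tens P P (tens parity (ext_left k) (ext_split f))"
        by (rule tspace_eq[OF clinear_comp[OF L tP] clinear_comp[OF tP L] IH(1)])
          (simp add: tens_pure[OF P P] tens_pure[OF clinear_parity clinear_ext_left] P_left[OF 2(1)]
            parity_perm[OF finite_atLeastAtMost, of _ 1 n w, folded P_def])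
      moreover have "ext_split (ext_left a f) \<in> ?TS"
        unfolding 2(2) ext_split_Theta[OF f]
        by (rule tens_in_tspace[OF clinear_parity clinear_ext_left IH(1)])
          (use 2 in \<open>auto intro: ext_left_in_ext_alg parity_in_ext_alg\<close>)
      ultimately show ?thesis
        using ext_perm_left[OF finite_gens a f, of "gen_perm w"] IH(2)
        by (simp add: 2(2) ext_split_Theta[OF f] ext_split_Theta[OF PEf])
    qed
  qed
  then show ?thesis by (simp add: E_act_def)
qed

text \<open>Describing the tensor product by supports, through its basis of pure tensors of
  monomials, reduces bijectivity of \<open>ext_split\<close> to a relabelling of index sets.\<close>

lemma tspace_ext_power:
  "tspace (vecs (ext_power n i)) (vecs (ext_power n j)) =
    {g. \<forall>A B. g (A, B) \<noteq> 0 \<longrightarrow> A \<subseteq> {1..n} \<and> B \<subseteq> {1..n} \<and> int (card A) = i \<and> int (card B) = j}" (is "?L = ?R")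
proof
  have "?R = {g. \<forall>A B. \<not> (A \<subseteq> {1..n} \<and> B \<subseteq> {1..n} \<and> int (card A) = i \<and> int (card B) = j) \<longrightarrow> g (A, B) = 0}"
    by blast
  moreover have "cfun.subspace \<dots>" by (rule cfun.subspaceI) (simp_all add: cscale_def)
  ultimately have "cfun.subspace ?R" by simp
  then show "?L \<subseteq> ?R"
    unfolding tspace_def
    by (intro cfun.span_minimal) (auto simp: pure_tensor_def ext_power_def ext_alg_def)
  show "?R \<subseteq> ?L"
  proof
    fix g :: "nat set \<times> nat set \<Rightarrow> complex" assume g: "g \<in> ?R"
    let ?b = "\<lambda>(A, B). cscale (g (A, B)) (pure_tensor (ext_basis A) (ext_basis B))"
    have "g = (\<Sum>x\<in>Pow {1..n} \<times> Pow {1..n}. ?b x)"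
    proof
      fix C
      have "(\<Sum>x\<in>Pow {1..n} \<times> Pow {1..n}. ?b x) C = (\<Sum>x\<in>Pow {1..n} \<times> Pow {1..n}. if C = x then g x else 0)"
        unfolding fun_sum_apply
        by (intro sum.cong) (auto simp: cscale_def pure_tensor_def ext_basis_def split: prod.splits)
      also have "\<dots> = (if C \<in> Pow {1..n} \<times> Pow {1..n} then g C else 0)" by (simp add: sum.delta')
      also have "\<dots> = g C"
      proof -
        have "C \<in> Pow {1..n} \<times> Pow {1..n}" if "g C \<noteq> 0" using g that by (cases C) blast
        then show ?thesis by auto
      qed
      finally show "g C = (\<Sum>x\<in>Pow {1..n} \<times> Pow {1..n}. ?b x) C" by simp
    qed
    moreover have "?b (A, B) \<in> ?L" for A B
    proof (cases "g (A, B) = 0")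
      case True
      then show ?thesis using cfun.subspace_0[OF subspace_tspace] by simp
    next
      case False
      then have "ext_basis A \<in> vecs (ext_power n i)" "ext_basis B \<in> vecs (ext_power n j)"
        using g by (auto simp: ext_power_def ext_basis_in_ext_alg) (auto simp: ext_basis_def split: if_splits)
      then show ?thesis by (simp add: cfun.subspace_scale[OF subspace_tspace] pure_in_tspace)
    qed
    ultimately show "g \<in> ?L"
      using cfun.subspace_sum[OF subspace_tspace, of "Pow {1..n} \<times> Pow {1..n}" ?b] by auto
  qed
qed

lemma ext_split_bij:
  "bij_betw ext_split (E_part n i j) (tspace (vecs (ext_power n i)) (vecs (ext_power n j)))"
  unfolding tspace_ext_power
proof (rule bij_betw_byWitness[where f' = "\<lambda>g C. g (Alpha -` C, Theta -` C)"])
  have C: "Alpha ` (Alpha -` C) \<union> Theta ` (Theta -` C) = C" for C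
  proof -
    have "x \<in> Alpha ` (Alpha -` C) \<union> Theta ` (Theta -` C)" if "x \<in> C" for x using that by (cases x) auto
    then show ?thesis by auto
  qed
  show "\<forall>f\<in>E_part n i j. (\<lambda>C. ext_split f (Alpha -` C, Theta -` C)) = f"
    by (intro ballI) (simp only: ext_split_def prod.case C)
  have AB: "Alpha -` (Alpha ` A \<union> Theta ` B) = A" "Theta -` (Alpha ` A \<union> Theta ` B) = B" for A B by auto
  show "\<forall>g\<in>{g. \<forall>A B. g (A, B) \<noteq> 0 \<longrightarrow> A \<subseteq> {1..n} \<and> B \<subseteq> {1..n} \<and> int (card A) = i \<and> int (card B) = j}.
      ext_split (\<lambda>C. g (Alpha -` C, Theta -` C)) = g"
    by (intro ballI ext) (simp only: ext_split_def prod.case AB split: prod.split, simp)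
  have card_AB: "card ((Alpha ` A \<union> Theta ` B) \<inter> range Alpha) = card A"
    "card ((Alpha ` A \<union> Theta ` B) \<inter> range Theta) = card B" for A B
  proof -
    have "(Alpha ` A \<union> Theta ` B) \<inter> range Alpha = Alpha ` A" "(Alpha ` A \<union> Theta ` B) \<inter> range Theta = Theta ` B"
      by auto
    then show "card ((Alpha ` A \<union> Theta ` B) \<inter> range Alpha) = card A"
      "card ((Alpha ` A \<union> Theta ` B) \<inter> range Theta) = card B"
      by (simp_all add: card_image inj_on_def)
  qed
  have gens_AB: "Alpha ` A \<union> Theta ` B \<subseteq> gens n \<longleftrightarrow> A \<subseteq> {1..n} \<and> B \<subseteq> {1..n}" for A B
    by (auto simp: gens_def)
  show "ext_split ` E_part n i j \<subseteq>
      {g. \<forall>A B. g (A, B) \<noteq> 0 \<longrightarrow> A \<subseteq> {1..n} \<and> B \<subseteq> {1..n} \<and> int (card A) = i \<and> int (card B) = j}"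
  proof (intro image_subsetI CollectI allI impI)
    fix f A B assume "f \<in> E_part n i j" "ext_split f (A, B) \<noteq> 0"
    then show "A \<subseteq> {1..n} \<and> B \<subseteq> {1..n} \<and> int (card A) = i \<and> int (card B) = j"
      unfolding E_part_def ext_alg_def ext_split_def prod.case mem_Collect_eq
      using gens_AB[of A B] card_AB[of A B] by metis
  qed
  show "(\<lambda>g C. g (Alpha -` C, Theta -` C)) `
      {g. \<forall>A B. g (A, B) \<noteq> 0 \<longrightarrow> A \<subseteq> {1..n} \<and> B \<subseteq> {1..n} \<and> int (card A) = i \<and> int (card B) = j} \<subseteq> E_part n i j"
  proof (rule image_subsetI)
    fix g :: "nat set \<times> nat set \<Rightarrow> complex"
    assume "g \<in> {g. \<forall>A B. g (A, B) \<noteq> 0 \<longrightarrow> A \<subseteq> {1..n} \<and> B \<subseteq> {1..n} \<and> int (card A) = i \<and> int (card B) = j}"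
    then have g: "A \<subseteq> {1..n} \<and> B \<subseteq> {1..n} \<and> int (card A) = i \<and> int (card B) = j" if "g (A, B) \<noteq> 0" for A B
      using that by blast
    show "(\<lambda>C. g (Alpha -` C, Theta -` C)) \<in> E_part n i j"
      unfolding E_part_def ext_alg_def mem_Collect_eq
    proof (intro conjI allI impI)
      fix D assume "g (Alpha -` D, Theta -` D) \<noteq> 0"
      note gD = g[OF this]
      show "D \<subseteq> gens n" using gens_AB[of "Alpha -` D" "Theta -` D", unfolded C] gD by metis
      show "int (card (D \<inter> range Alpha)) = i" "int (card (D \<inter> range Theta)) = j"
        using card_AB[of "Alpha -` D" "Theta -` D", unfolded C] gD by metis+
    qed
  qed
qed

section \<open>The modules of the symmetric group and their classes\<close>

lemma subspace_E_part: "cfun.subspace (E_part n i j)"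
  using bigraded_sl2.sub[OF E_sl2] .

lemma is_gmod_E_gmod: "is_gmod (sym_group n) (E_gmod n i j)"
proof -
  have gw: "gen_perm w ` gens n \<subseteq> gens n" if "w \<in> carrier (sym_group n)" for w
    using permutes_in_image[of w "{1..n}"] that by (auto simp: gens_def sym_group_carrier)
  have "is_gmod (sym_group n) \<lparr>vecs = E_part n i j, act = (\<lambda>w. ext_perm (gens n) (gen_perm w))\<rparr>"
  proof (rule is_gmod_ext_perm[OF finite_gens subspace_E_part _ gw])
    show "E_part n i j \<subseteq> E_alg n" by (auto simp: E_part_def)
    show "ext_perm (gens n) (gen_perm w) f \<in> E_part n i j" if w: "w \<in> carrier (sym_group n)" and f: "f \<in> E_part n i j" for w f
    proof -
      have "gen_perm w a \<in> range Alpha \<longleftrightarrow> a \<in> range Alpha" "gen_perm w a \<in> range Theta \<longleftrightarrow> a \<in> range Theta" for a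
        by (cases a; auto)+
      then show ?thesis
        using f ext_number_perm[OF finite_gens] ext_perm_in_ext_alg[OF finite_gens gw[OF w]]
        by (simp add: E_part_iff clinearD[OF clinear_ext_perm])
    qed
    show "gen_perm \<one>\<^bsub>sym_group n\<^esub> x = x" for x
      by (cases x) (auto simp: sym_group_one)
    show "gen_perm (w \<otimes>\<^bsub>sym_group n\<^esub> h) x = gen_perm w (gen_perm h x)" for w h x
      by (cases x) (auto simp: sym_group_mult)
  qed
  then show ?thesis by (simp add: E_gmod_def E_act_def[abs_def])
qed

lemma is_gmod_ext_power: "is_gmod (sym_group n) (ext_power n k)"
proof -
  let ?U = "{f \<in> ext_alg {1..n}. \<forall>A. f A \<noteq> 0 \<longrightarrow> int (card A) = k}"
  \<comment> \<open>Counting all generators turns the total degree into an eigenvalue, so that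
    subspace and stability follow from the facts on \<open>ext_number\<close>.\<close>
  have U: "?U = {f \<in> ext_alg {1..n}. ext_number UNIV f = cscale (of_int k) f}"
    unfolding ext_number_eigen_iff by simp
  have sU: "cfun.subspace ?U"
    unfolding U using subspace_ext_alg[of "{1..n}"]
    by (intro cfun.subspaceI)
      (auto simp: clinearD[OF clinear_ext_number] cfun.subspace_0 cfun.subspace_add cfun.subspace_scale
        cfun.scale_right_distrib mult.commute)
  have wX: "w ` {1..n} \<subseteq> {1..n}" if "w \<in> carrier (sym_group n)" for w
    using permutes_image[of w "{1..n}"] that by (simp add: sym_group_carrier)
  have "is_gmod (sym_group n) \<lparr>vecs = ?U, act = (\<lambda>w. ext_perm {1..n} w)\<rparr>"
  proof (rule is_gmod_ext_perm[OF _ sU _ wX])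
    fix w assume w: "w \<in> carrier (sym_group n)"
    show "ext_perm {1..n} w f \<in> ?U" if "f \<in> ?U" for f
      using that ext_number_perm[of "{1..n}" w UNIV f] ext_perm_in_ext_alg[OF _ wX[OF w], of f]
      unfolding U by (simp add: clinearD[OF clinear_ext_perm])
  qed (auto simp: sym_group_one sym_group_mult)
  then show ?thesis by (simp add: ext_power_def)
qed

lemma E_gmod_iso_tensor:
  "gmod_iso (sym_group n) (E_gmod n i j) (gmod_tensor (ext_power n i) (ext_power n j))"
proof -
  have "gmod_hom (sym_group n) (E_gmod n i j) (gmod_tensor (ext_power n i) (ext_power n j)) ext_split"
  proof (rule gmod_homI)
    show "ext_split f \<in> vecs (gmod_tensor (ext_power n i) (ext_power n j))" if "f \<in> vecs (E_gmod n i j)" for f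
      using bij_betwE[OF ext_split_bij] that by (simp add: vecs_gmod_tensor E_gmod_def)
    show "ext_split (act (E_gmod n i j) w f) = act (gmod_tensor (ext_power n i) (ext_power n j)) w (ext_split f)"
      if w: "w \<in> carrier (sym_group n)" and f: "f \<in> vecs (E_gmod n i j)" for w f
    proof -
      have "act (gmod_tensor (ext_power n i) (ext_power n j)) w (ext_split f)
          = tens (ext_perm {1..n} w) (ext_perm {1..n} w) (ext_split f)"
        using bij_betwE[OF ext_split_bij] f
        by (intro act_gmod_tensor_eq clinear_ext_perm) (auto simp: ext_power_def E_gmod_def)
      then show ?thesis
        using ext_split_perm[of w n f] w f by (simp add: E_gmod_def sym_group_carrier E_part_def)
    qed
  qed (simp_all add: clinearD[OF clinear_ext_split])
  then show ?thesis
    using ext_split_bij by (auto simp: gmod_iso_def vecs_gmod_tensor E_gmod_def)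
qed

lemma groth_class_E_gmod:
  "groth_class (sym_group n) (E_gmod n i j) =
    groth_class (sym_group n) (ext_power n i) \<otimes>\<^bsub>groth_ring (sym_group n)\<^esub> groth_class (sym_group n) (ext_power n j)"
proof -
  have G: "Group.monoid (sym_group n)" using sym_group_is_group group.is_monoid by blast
  have "is_gmod (sym_group n) (gmod_tensor (ext_power n i) (ext_power n j))"
    by (rule is_gmod_tensor[OF is_gmod_ext_power is_gmod_ext_power
          Group.monoid.one_closed[OF G] Group.monoid.m_closed[OF G]])
  then have "groth_class (sym_group n) (E_gmod n i j) = groth_class (sym_group n) (gmod_tensor (ext_power n i) (ext_power n j))"
    using groth_class_iso is_gmod_E_gmod E_gmod_iso_tensor by blast
  then show ?thesis using groth_class_tensor[OF G is_gmod_ext_power is_gmod_ext_power] by simp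
qed

lemma E_part_subset: "E_part n i j \<subseteq> E_alg n"
  by (auto simp: E_part_def)

lemma gmod_hom_raise: "gmod_hom (sym_group n) (E_gmod n i j) (E_gmod n (i + 1) (j - 1)) (raise n)"
  by (rule gmod_homI)
    (auto simp: E_gmod_def clinearD[OF clinear_raise] sym_group_carrier
      intro: raise_perm bigraded_sl2.e_in[OF E_sl2] E_part_subset[THEN subsetD])

section \<open>Reduction of the given endomorphism to a shear\<close>

lemma ext_mult_add_left: "ext_mult (f + g) h = ext_mult f h + ext_mult g h"
  by (auto simp: ext_mult_def fun_eq_iff algebra_simps sum.distrib)

lemma ext_gen_in_ext_alg: "a \<in> X \<Longrightarrow> ext_gen a \<in> ext_alg X"
  by (auto simp: ext_gen_def ext_alg_def)

text \<open>Outside \<open>E_alg n\<close> the map \<open>T\<close> is arbitrary, hence the linear extension.\<close>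

lemma shear_exists:
  assumes T: "ext_endo (gens n) T"
    and Theta: "\<And>k. k \<in> {1..n} \<Longrightarrow> T (ext_gen (Theta k)) = ext_gen (Theta k) + ext_gen (Alpha k)"
    and Alpha: "\<And>k. k \<in> {1..n} \<Longrightarrow> T (ext_gen (Alpha k)) = ext_gen (Alpha k)"
  shows "\<exists>S. shear n S \<and> (\<forall>f\<in>E_alg n. S f = T f)"
proof -
  have lin: "linear_between (E_alg n) (E_alg n) T" using T by (simp add: ext_endo_def)
  obtain S where S: "clinear S" "\<And>f. f \<in> E_alg n \<Longrightarrow> S f = T f"
    using linear_between_extend[OF lin subspace_ext_alg] by metis
  have mult: "T (ext_left a f) = ext_mult (T (ext_gen a)) (T f)" if "a \<in> gens n" "f \<in> E_alg n" for a f
  proof -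
    have "T (ext_mult (ext_gen a) f) = ext_mult (T (ext_gen a)) (T f)"
      using T that(2) ext_gen_in_ext_alg[OF that(1)] unfolding ext_endo_def by blast
    then show ?thesis by (simp only: ext_mult_gen)
  qed
  have "shear n S"
  proof
    show "S ext_one = ext_one" using T S(2)[OF ext_one_in_ext_alg] by (simp add: ext_endo_def)
    show "S f \<in> E_alg n" if "f \<in> E_alg n" for f
      using S(2)[OF that] linear_betweenD(1)[OF lin that that] by simp
    fix k f assume k: "k \<in> {1..n}" and f: "f \<in> E_alg n"
    have g: "Alpha k \<in> gens n" "Theta k \<in> gens n" using k by (auto simp: gens_def)
    show "S (ext_left (Alpha k) f) = ext_left (Alpha k) (S f)"
      using mult[OF g(1) f] Alpha[OF k] S(2) f ext_left_in_ext_alg[OF g(1) f] by (simp add: ext_mult_gen)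
    show "S (ext_left (Theta k) f) = ext_left (Theta k) (S f) + ext_left (Alpha k) (S f)"
      using mult[OF g(2) f] Theta[OF k] S(2) f ext_left_in_ext_alg[OF g(2) f]
      by (simp add: ext_mult_gen ext_mult_add_left)
  qed (use S(1) clinearD[OF S(1)] in auto)
  then show ?thesis using S(2) by blast
qed

theorem theorem3p3:
  fixes n :: nat
    and T :: "(gen set \<Rightarrow> complex) \<Rightarrow> (gen set \<Rightarrow> complex)"
    and i j :: int
  assumes "n \<ge> 1"
    and "ext_endo (gens n) T"
    and "\<And>k. k \<in> {1..n} \<Longrightarrow> T (ext_gen (Theta k)) = ext_gen (Theta k) + ext_gen (Alpha k)"
    and "\<And>k. k \<in> {1..n} \<Longrightarrow> T (ext_gen (Alpha k)) = ext_gen (Alpha k)"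
  shows "is_submodule (sym_group n) (E_gmod n i j) (H0 n T \<inter> E_part n i j)
    \<and> (\<not> i \<ge> j \<longrightarrow> H0 n T \<inter> E_part n i j = {0})
    \<and> (i \<ge> j \<longrightarrow>
        groth_class (sym_group n) (H0_gmod n T i j)
          = (groth_class (sym_group n) (ext_power n i)
               \<otimes>\<^bsub>groth_ring (sym_group n)\<^esub> groth_class (sym_group n) (ext_power n j))
            \<ominus>\<^bsub>groth_ring (sym_group n)\<^esub>
            (groth_class (sym_group n) (ext_power n (i + 1))
               \<otimes>\<^bsub>groth_ring (sym_group n)\<^esub> groth_class (sym_group n) (ext_power n (j - 1)))
      \<and> groth_class (sym_group n) (H0_gmod n T i j)
          = groth_class (sym_group n) (E_gmod n i j)
            \<ominus>\<^bsub>groth_ring (sym_group n)\<^esub> groth_class (sym_group n) (E_gmod n (i + 1) (j - 1)))"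
proof -
  let ?G = "sym_group n" and ?E = "E_gmod n i j" and ?E' = "E_gmod n (i + 1) (j - 1)"
  obtain S where S: "shear n S" "\<forall>f\<in>E_alg n. S f = T f"
    using shear_exists[OF assms(2-4)] by blast
  \<comment> \<open>On a bidegree the invariants become the kernel of a module homomorphism, which
    yields both the submodule property and the left end of the exact sequence.\<close>
  have H: "H0 n T \<inter> E_part n i j = {f \<in> vecs ?E. raise n f = 0}"
    using shear.T_fixed_iff[OF S(1)] S(2) by (auto simp: H0_def E_gmod_def E_part_def)
  note E = is_gmod_E_gmod[of n i j] and E' = is_gmod_E_gmod[of n "i + 1" "j - 1"]
  have sub: "is_submodule ?G ?E (H0 n T \<inter> E_part n i j)"
    unfolding H by (rule is_submodule_kernel[OF E E' gmod_hom_raise])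
  \<comment> \<open>Here the weight i - j is negative, where the raising operator is
    injective.\<close>
  have zero: "H0 n T \<inter> E_part n i j = {0}" if "i < j"
  proof -
    have "f = 0" if "f \<in> H0 n T \<inter> E_part n i j" for f
      using that bigraded_sl2.e_inj[OF E_sl2 _ _ \<open>i < j\<close>] unfolding H by (auto simp: E_gmod_def)
    moreover have "0 \<in> H0 n T \<inter> E_part n i j"
      using sub cfun.subspace_0 unfolding is_submodule_def by blast
    ultimately show ?thesis by blast
  qed
  have H0: "H0_gmod n T i j = sub_gmod ?E (H0 n T \<inter> E_part n i j)"
    by (simp add: H0_gmod_def sub_gmod_def E_gmod_def)
  have diff: "groth_class ?G (H0_gmod n T i j) = groth_class ?G ?E \<ominus>\<^bsub>groth_ring ?G\<^esub> groth_class ?G ?E'"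
    if "i \<ge> j"
  proof -
    have "raise n ` vecs ?E \<subseteq> vecs ?E'" using gmod_homD(1)[OF gmod_hom_raise] by blast
    \<comment> \<open>The target has weight (i + 1) - (j - 1), which is positive when i \<ge> j, so
      \<open>e_surj\<close> applies.\<close>
    moreover have "g \<in> raise n ` vecs ?E" if "g \<in> vecs ?E'" for g
      using bigraded_sl2.e_surj[OF E_sl2, of g n "i + 1" "j - 1"] that \<open>i \<ge> j\<close> by (auto simp: E_gmod_def)
    ultimately have "raise n ` vecs ?E = vecs ?E'" by blast
    then have "sub_gmod ?E' (raise n ` vecs ?E) = ?E'" by (simp add: sub_gmod_def)
    then have "short_exact ?G (H0_gmod n T i j) ?E ?E'"
      using short_exact_kernel_image[OF E E' gmod_hom_raise] unfolding H0 H by simp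
    then have "groth_class ?G ?E = groth_class ?G (H0_gmod n T i j) + groth_class ?G ?E'"
      using groth_class_exact[OF is_gmod_sub[OF E sub] E E'] unfolding H0 by blast
    \<comment> \<open>Additivity gives an equation of formal sums; the class of \<open>?E'\<close>
      lies in the carrier, so its subtraction is the subtraction of the ring.\<close>
    then show ?thesis by (simp add: groth_ring_minus[OF groth_class_in_carrier[OF E']])
  qed
  show ?thesis
    using sub zero diff groth_class_E_gmod[of n i j] groth_class_E_gmod[of n "i + 1" "j - 1"]
    by (simp add: not_le)
qed

end
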